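(* Let $k\ge 3$ and $d$ be integers with $0\le d<k/2$. Then for each $\varepsilon>0$, \[ I_{k,d}(X)-T_k(X)\ll X^{\gamma'_{k,d}+\varepsilon}\qquad (X\ge 1), \] with implicit constant depending on $\varepsilon,k,d$, where \[ \gamma'_{k,d}=\min_{2\le r\le k}\biggl( r+k^{1-r}\sum_{i=1}^{k-1}i^{r-1}+\sum_{l=1}^r\max\{d-l+1,0\}\biggr). \] In particular, if $d\ge 1$ and $k\ge 4d+2$, then $I_{k,d}(X)=k!X^k+O(X^{k-1/2})$.
   Context: For integers $k\ge 2$, $0\le d<k$ and real $X\ge 1$, $I_{k,d}(X)$ denotes the number of pairs of integer $k$-tuples $(x_1,\dots,x_k)$, $(y_1,\dots,y_k)$ with $1\le x_i,y_i\le X$ for all $i$ satisfying $x_1^j+\dots+x_k^j=y_1^j+\dots+y_k^j$ for all $j$ with $1\le j\le k$, $j\ne k-d$. $T_k(X)$ denotes the number of pairs of integer $k$-tuples $\mathbf{x},\mathbf{y}$ with $1\le x_i,y_i\le X$ such that $\mathbf{x}$ is a permutation of $\mathbf{y}$. *)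

theory Defs
  imports "HOL-Analysis.Analysis" "HOL-Combinatorics.Permutations"
begin

text \<open>A \<open>k\<close>-tuple of integers is an extensional function on the index set \<open>{1..k}\<close>, so that
  distinct functions are distinct tuples and the cardinalities below count tuples.\<close>

definition box :: "nat \<Rightarrow> real \<Rightarrow> (nat \<Rightarrow> int) set" where
  "box k X = {1..k} \<rightarrow>\<^sub>E {n::int. 1 \<le> n \<and> real_of_int n \<le> X}"

text \<open>In \<open>I_count\<close> the subtraction \<open>k - d\<close> is on natural numbers; the function is meant for \<open>d < k\<close>.\<close>

definition I_count :: "nat \<Rightarrow> nat \<Rightarrow> real \<Rightarrow> nat" where
  "I_count k d X = card {(x, y). x \<in> box k X \<and> y \<in> box k X \<and>
     (\<forall>j\<in>{1..k}. j \<noteq> k - d \<longrightarrow> (\<Sum>i=1..k. x i ^ j) = (\<Sum>i=1..k. y i ^ j))}"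

definition T_count :: "nat \<Rightarrow> real \<Rightarrow> nat" where
  "T_count k X = card {(x, y). x \<in> box k X \<and> y \<in> box k X \<and>
     (\<exists>\<pi>. \<pi> permutes {1..k} \<and> (\<forall>i\<in>{1..k}. x i = y (\<pi> i)))}"

definition gamma_exponent :: "nat \<Rightarrow> nat \<Rightarrow> real" where
  "gamma_exponent k d = (MIN r\<in>{2..k}.
     real r + real k powi (1 - int r) * (\<Sum>i=1..k-1. real i ^ (r - 1))
       + (\<Sum>l=1..r. max (real d - real l + 1) 0))"

end

theory Submission
  imports Defs "HOL-Computational_Algebra.Polynomial" "HOL-Computational_Algebra.Primes"
begin

text \<open>Let \<open>P\<close> and \<open>R\<close> be the monic polynomials whose roots are the \<open>x\<^sub>i\<close> and the \<open>y\<^sub>j\<close>, with no common root.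
  The equations say that \<open>P - R = H \<tau>\<close>, where \<open>H\<close> is an integer and \<open>\<tau>\<close> is monic of degree \<open>d\<close>; hence
  \<open>\<Prod>\<^sub>i (y\<^sub>j - x\<^sub>i) = H \<tau>(y\<^sub>j)\<close>, and outside a known finite set of primes every prime factor of \<open>x\<^sub>i - y\<^sub>j\<close> divides \<open>H\<close>.
  A solution is recorded as a list: \<open>r\<close> of the \<open>y\<^sub>j\<close>, the divided differences of \<open>\<tau>\<close> at them, then the \<open>x\<^sub>i\<close>,
  ordered such that each shares as many primes as possible with what is known, and after \<open>b\<close> of them the
  remaining \<open>y\<^sub>j\<close>. The entries carry weights whose sum over all candidates is \<open>O(N powr \<epsilon>)\<close> (a Kraft inequality;
  the Chinese remainder theorem turns known primes into residue classes), so the number of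
  solutions is bounded by the largest reciprocal weight of a list. In units of \<open>log N\<close> its logarithm is the
  value of a small linear program in the sizes of the known and unknown parts. A suitable choice of \<open>r\<close>
  and \<open>b\<close> (about \<open>\<surd>k / 2\<close> and \<open>2 \<surd>k\<close> if \<open>k\<close> is large compared with \<open>d\<close>) yields at most
  \<open>r + k / r - 1 / 2 + (\<Sum>l<r. max (d - l) 0)\<close> for every \<open>r \<ge> 2\<close>, which the trapezoidal rule compares with the terms of
  the stated minimum. Solutions in which \<open>c\<close> of the variables cancel lead to the parameters \<open>k - c\<close>, \<open>d - c\<close>.\<close>

section \<open>Smooth parts of integers\<close>

text \<open>By the trapezoidal rule each term of the minimum is at least r + k / r - 1 / 2 plus the
  sum over max (d - l) 0, so the target lies half a power below the obvious bound. Listing all x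
  costs at most 1 / r of log |H|: each x shows r differences, and their new primes together divide
  H. As log |H| <= k log N - log |\<tau>|, this saves d / r, which reaches 1 / 2 only for r <= 2 d.
  For larger r one has to stop early: after b of the x, the missing primes of H are paid for by the
  remaining y, each of which meets b known x, so the divisor r is replaced by b. The price is that
  the first b costs need a bound of their own. It comes from the order of the x: when much of H is
  known, some remaining x has a large known part and is cheap. The cost of an entry depends on the
  solution and on the entries before it, so the entries cannot be counted one at a time. Weights
  with a bounded sum for each prefix avoid this: only the total cost of a single list matters, and
  the total is what the linear program controls.\<close>

definition prime_part :: "int set \<Rightarrow> int \<Rightarrow> int" where
  "prime_part Q m = prod_mset (filter_mset (\<lambda>p. p \<in> Q) (prime_factorization m))"

lemma prime_part_mult:
  assumes "m \<noteq> 0" "n \<noteq> 0"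
  shows "prime_part Q (m * n) = prime_part Q m * prime_part Q n"
  using assms by (simp add: prime_part_def prime_factorization_mult)

lemma prime_part_1 [simp]: "prime_part Q 1 = 1"
  by (simp add: prime_part_def)

lemma prime_part_prod_mset:
  assumes "\<And>i. i \<in># M \<Longrightarrow> f i \<noteq> 0"
  shows "prime_part Q (\<Prod>i\<in>#M. f i) = (\<Prod>i\<in>#M. prime_part Q (f i))"
  using assms
proof (induction M)
  case (add x M)
  then have "(\<Prod>i\<in>#M. f i) \<noteq> 0" by (auto simp: prod_mset_zero_iff)
  with add show ?case by (simp add: prime_part_mult)
qed simp

lemma prime_factorization_prime_part:
  "prime_factorization (prime_part Q m) = filter_mset (\<lambda>p. p \<in> Q) (prime_factorization m)"
  unfolding prime_part_def by (rule prime_factorization_prod_mset_primes) auto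

lemma prime_factors_prime_part: "prime_factors (prime_part Q m) = prime_factors m \<inter> Q"
  by (auto simp: prime_factorization_prime_part)

lemma prod_mset_pos_int: "(\<And>p. p \<in># M \<Longrightarrow> p > (0::int)) \<Longrightarrow> prod_mset M > 0"
  by (induction M) (auto simp: zero_less_mult_iff)

lemma prime_part_pos [simp]: "prime_part Q m > 0"
  unfolding prime_part_def
  by (rule prod_mset_pos_int) (auto dest: in_prime_factors_imp_prime simp: prime_gt_0_int)

lemma prime_part_nonzero [simp]: "prime_part Q m \<noteq> 0"
  using prime_part_pos[of Q m] by linarith

lemma prime_part_ge_1: "prime_part Q m \<ge> 1"
  using prime_part_pos[of Q m] by linarith

lemma prime_part_Un:
  assumes "Q \<inter> R = {}"
  shows "prime_part (Q \<union> R) m = prime_part Q m * prime_part R m"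
proof -
  have "filter_mset (\<lambda>p. p \<in> Q \<union> R) M = filter_mset (\<lambda>p. p \<in> Q) M + filter_mset (\<lambda>p. p \<in> R) M" for M
    using assms by (induction M) auto
  then show ?thesis by (simp add: prime_part_def)
qed

lemma prime_part_cong:
  assumes "\<And>p. p \<in> prime_factors m \<Longrightarrow> p \<in> Q \<longleftrightarrow> p \<in> R"
  shows "prime_part Q m = prime_part R m"
  unfolding prime_part_def using assms by (metis (no_types, lifting) filter_mset_cong)

lemma prime_part_UNIV: "m \<noteq> 0 \<Longrightarrow> prime_part UNIV m = \<bar>m\<bar>"
  by (simp add: prime_part_def prod_mset_prime_factorization)

lemma prime_part_Compl: "m \<noteq> 0 \<Longrightarrow> prime_part Q m * prime_part (- Q) m = \<bar>m\<bar>"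
  using prime_part_Un[of Q "- Q" m] by (simp add: prime_part_UNIV Compl_partition)

lemma prime_part_dvd: "m \<noteq> 0 \<Longrightarrow> prime_part Q m dvd m"
  by (metis prime_part_Compl dvd_abs_iff dvd_triv_left)

lemma prime_part_le: "m \<noteq> 0 \<Longrightarrow> prime_part Q m \<le> \<bar>m\<bar>"
  by (simp add: prime_part_dvd zdvd_imp_le)

lemma prime_part_eq_1: "prime_factors m \<inter> Q = {} \<Longrightarrow> prime_part Q m = 1"
  using prime_part_cong[of m Q "{}"] by (auto simp: prime_part_def)

lemma coprime_if_disjoint_prime_factors:
  fixes a b :: int
  assumes "a \<noteq> 0" "b \<noteq> 0" "prime_factors a \<inter> prime_factors b = {}"
  shows "coprime a b"
proof (rule ccontr)
  assume "\<not> coprime a b"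
  then have "\<not> is_unit (gcd a b)" by (simp add: coprime_iff_gcd_eq_1)
  moreover have "gcd a b \<noteq> 0" using assms by simp
  ultimately obtain p where "prime p" "p dvd gcd a b"
    using prime_divisor_exists by blast
  then have "p \<in> prime_factors a \<inter> prime_factors b"
    using assms by (auto simp: in_prime_factors_iff)
  then show False using assms by blast
qed

lemma dvd_prime_part:
  assumes "a dvd m" "m \<noteq> 0" "prime_factors a \<subseteq> Q"
  shows "a dvd prime_part Q m"
proof -
  have a0: "a \<noteq> 0" using assms by auto
  have "a dvd prime_part Q m * prime_part (- Q) m"
    using assms by (simp add: prime_part_Compl)
  moreover have "coprime a (prime_part (- Q) m)"
    using assms a0 by (intro coprime_if_disjoint_prime_factors)
      (simp_all add: prime_factors_prime_part, blast)
  ultimately show ?thesis by (simp add: coprime_dvd_mult_left_iff)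
qed

section \<open>Counting integers composed of given primes\<close>

definition smooth_ints :: "int set \<Rightarrow> real \<Rightarrow> int set" where
  "smooth_ints P N = {n. 1 \<le> n \<and> real_of_int n \<le> N \<and> prime_factors n \<subseteq> P}"

lemma finite_int_bounded: "finite {n::int. 1 \<le> n \<and> real_of_int n \<le> N}"
  by (rule finite_subset[of _ "{1..\<lfloor>N\<rfloor>}"]) (auto simp: le_floor_iff)

lemma finite_smooth_ints [simp]: "finite (smooth_ints P N)"
  unfolding smooth_ints_def by (rule finite_subset[OF _ finite_int_bounded[of N]]) auto

text \<open>A finite form of the Euler product. Splitting off the exact power of p sends the
  integers injectively to pairs of an exponent and an integer composed of the other primes; the
  weight is multiplicative, and the exponents contribute part of a geometric series.\<close>

lemma sum_smooth_ints_le: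
  fixes \<epsilon> :: real
  assumes "finite P" "\<And>p. p \<in> P \<Longrightarrow> prime p" "\<epsilon> > 0"
  shows "(\<Sum>n\<in>smooth_ints P N. real_of_int n powr (- \<epsilon>)) \<le> (\<Prod>p\<in>P. 1 / (1 - real_of_int p powr (- \<epsilon>)))"
  using assms(1,2)
proof (induction P rule: finite_induct)
  case empty
  \<comment> \<open>Only an inclusion, since the set is empty for N < 1.\<close>
  have "smooth_ints {} N \<subseteq> {1}"
  proof
    fix n assume "n \<in> smooth_ints {} N"
    then have "n \<ge> 1" "prime_factors n = {}" by (auto simp: smooth_ints_def)
    then have "is_unit n" by (simp add: prime_factorization_empty_iff)
    then show "n \<in> {1}" using \<open>n \<ge> 1\<close> by simp
  qed
  then have "(\<Sum>n\<in>smooth_ints {} N. real_of_int n powr (- \<epsilon>)) \<le> (\<Sum>n\<in>{1}. real_of_int n powr (- \<epsilon>))"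
    by (intro sum_mono2) auto
  then show ?case by simp
next
  case (insert p P)
  have p: "prime p" and P: "\<And>q. q \<in> P \<Longrightarrow> prime q" using insert by auto
  have p2: "p \<ge> 2" using p by (simp add: prime_ge_2_int)
  define q where "q = real_of_int p powr (- \<epsilon>)"
  have q: "0 < q" "q < 1" using p2 assms(3) by (auto simp: q_def powr_less_one)
  define S where "S = smooth_ints P N"
  define f where "f = (\<lambda>n. (multiplicity p n, n div p ^ multiplicity p n))"
  have f_ex: "n = p ^ fst (f n) * snd (f n)" if "n \<in> smooth_ints (insert p P) N" for n
    by (simp add: f_def multiplicity_dvd)
  have f_S: "snd (f n) \<in> S" if n: "n \<in> smooth_ints (insert p P) N" for n
  proof -
    have n1: "n \<ge> 1" "real_of_int n \<le> N" "prime_factors n \<subseteq> insert p P" using n by (auto simp: smooth_ints_def)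
    obtain m where m: "n = p ^ multiplicity p n * m" "\<not> p dvd m"
      using multiplicity_decompose'[of n p] n1 p by (metis not_one_le_zero not_prime_unit)
    have sm: "snd (f n) = m" using m(1) p2
      by (simp add: f_def) (metis m(1) nonzero_mult_div_cancel_left not_one_le_zero numeral_One power_not_zero rel_simps(28) zero_le_numeral dual_order.trans order.refl not_numeral_le_zero)
    have pp: "p ^ multiplicity p n \<ge> 1" using p2 by simp
    have "m > 0" using m(1) n1 pp by (smt (verit) mult_nonneg_nonpos)
    moreover have "m \<le> n" using m(1) pp \<open>m > 0\<close> by (smt (verit) mult_le_cancel_right1)
    moreover have "prime_factors m \<subseteq> P"
    proof
      fix r assume r: "r \<in> prime_factors m"
      then have "r dvd n" using m(1) by (metis dvd_mult in_prime_factors_iff)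
      then have "r \<in> prime_factors n" using r n1 by (auto simp: in_prime_factors_iff)
      moreover have "r \<noteq> p" using r m(2) by (auto simp: in_prime_factors_iff)
      ultimately show "r \<in> P" using n1 by auto
    qed
    ultimately show ?thesis using sm n1 by (auto simp: S_def smooth_ints_def)
  qed
  define A where "A = smooth_ints (insert p P) N"
  have finA: "finite A" by (simp add: A_def)
  have "inj_on f A"
    by (rule inj_onI) (metis f_ex A_def)
  define J where "J = Max (insert 0 (fst ` f ` A))"
  have fA: "f ` A \<subseteq> {..J} \<times> S"
  proof
    fix z assume "z \<in> f ` A"
    then obtain n where n: "n \<in> A" "z = f n" by auto
    have "fst z \<le> J" unfolding J_def using n finA by (intro Max_ge) auto
    moreover have "snd z \<in> S" using n f_S by (simp add: A_def)
    ultimately show "z \<in> {..J} \<times> S" by (cases z) auto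
  qed
  define g where "g = (\<lambda>(j, m). q ^ j * real_of_int m powr (- \<epsilon>))"
  have "(\<Sum>n\<in>A. real_of_int n powr (- \<epsilon>)) = (\<Sum>n\<in>A. g (f n))"
  proof (rule sum.cong[OF refl])
    fix n assume n: "n \<in> A"
    obtain j m where jm: "f n = (j, m)" by (cases "f n")
    have e: "n = p ^ j * m" using f_ex[of n] n jm by (simp add: A_def)
    have m0: "m \<ge> 1" using f_S[of n] n jm by (auto simp: A_def S_def smooth_ints_def)
    have "real_of_int n powr (- \<epsilon>) = (real_of_int p ^ j) powr (- \<epsilon>) * real_of_int m powr (- \<epsilon>)"
      unfolding e using m0 p2 by (simp add: powr_mult)
    also have "(real_of_int p ^ j) powr (- \<epsilon>) = q ^ j"
      unfolding q_def using p2 by (simp add: powr_powr powr_realpow[symmetric] mult.commute)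
    finally show "real_of_int n powr (- \<epsilon>) = g (f n)" by (simp add: g_def jm)
  qed
  also have "\<dots> = (\<Sum>z\<in>f ` A. g z)"
    using \<open>inj_on f A\<close> by (simp add: sum.reindex)
  also have "\<dots> \<le> (\<Sum>z\<in>{..J} \<times> S. g z)"
    using fA q by (intro sum_mono2) (auto simp: g_def S_def)
  also have "\<dots> = (\<Sum>j\<le>J. q ^ j) * (\<Sum>m\<in>S. real_of_int m powr (- \<epsilon>))"
    by (simp add: g_def sum.cartesian_product[symmetric] sum_product)
  also have "\<dots> \<le> (1 / (1 - q)) * (\<Sum>m\<in>S. real_of_int m powr (- \<epsilon>))"
  proof (rule mult_right_mono)
    have "(\<Sum>j\<le>J. q ^ j) \<le> (\<Sum>j. q ^ j)"
      using q by (intro sum_le_suminf summable_geometric) auto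
    also have "\<dots> = 1 / (1 - q)" using q by (intro suminf_geometric) auto
    finally show "(\<Sum>j\<le>J. q ^ j) \<le> 1 / (1 - q)" .
  qed (auto intro: sum_nonneg)
  also have "\<dots> \<le> (1 / (1 - q)) * (\<Prod>p\<in>P. 1 / (1 - real_of_int p powr (- \<epsilon>)))"
    using insert.IH P q unfolding S_def by (intro mult_left_mono) auto
  finally show ?case using insert.hyps by (simp add: A_def q_def)
qed

text \<open>Rankin's trick: for n <= N the weight (N / n) powr \<epsilon> is at least 1, so the
  count is at most N powr \<epsilon> times the Euler product. Factors of large primes are at most p
  powr \<epsilon>, and these multiply to at most |D| powr \<epsilon>; the boundedly many small
  primes contribute at most \<open>K\<close> each.\<close>

lemma card_smooth_ints_le:
  fixes \<epsilon> :: real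
  assumes "\<epsilon> > 0"
  obtains C where "C > 0"
    "\<And>D N. D \<noteq> 0 \<Longrightarrow> N \<ge> 1 \<Longrightarrow>
       real (card (smooth_ints (prime_factors D) N)) \<le> C * N powr \<epsilon> * real_of_int \<bar>D\<bar> powr \<epsilon>"
proof -
  define K where "K = 1 / (1 - 2 powr (- \<epsilon>))"
  have h: "2 powr (- \<epsilon>) < (1::real)" using assms by (intro powr_less_one) auto
  have K: "K \<ge> 1" using h by (simp add: K_def)
  \<comment> \<open>From here on x = p powr \<epsilon> is at least 2, so the Euler factor x / (x -
    1) is at most x.\<close>
  define p0 where "p0 = \<lceil>2 powr (1 / \<epsilon>)\<rceil>"
  define C where "C = K ^ nat p0"
  have C: "C \<ge> 1" using K by (simp add: C_def)
  have fac: "1 / (1 - real_of_int p powr (- \<epsilon>)) \<le> (if p < p0 then K else 1) * real_of_int p powr \<epsilon>"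
    if "prime p" for p :: int
  proof -
    have p2: "p \<ge> 2" using that by (simp add: prime_ge_2_int)
    show ?thesis
    proof (cases "p < p0")
      case True
      have "real_of_int p powr (- \<epsilon>) \<le> 2 powr (- \<epsilon>)"
        using p2 assms by (intro powr_mono2') auto
      then have "1 / (1 - real_of_int p powr (- \<epsilon>)) \<le> K * 1"
        unfolding K_def using h by (simp add: frac_le)
      also have "\<dots> \<le> K * real_of_int p powr \<epsilon>"
        using K p2 assms by (intro mult_left_mono ge_one_powr_ge_zero) auto
      finally show ?thesis using True by simp
    next
      case False
      then have "real_of_int p \<ge> 2 powr (1 / \<epsilon>)" by (simp add: p0_def not_less ceiling_le_iff)
      then have "real_of_int p powr \<epsilon> \<ge> (2 powr (1 / \<epsilon>)) powr \<epsilon>"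
        using assms by (intro powr_mono2) auto
      then have x: "real_of_int p powr \<epsilon> \<ge> 2" using assms by (simp add: powr_powr)
      have "1 / (1 - real_of_int p powr (- \<epsilon>)) = real_of_int p powr \<epsilon> / (real_of_int p powr \<epsilon> - 1)"
        using x p2 by (simp add: powr_minus field_simps)
      also have "\<dots> \<le> real_of_int p powr \<epsilon> / 1" using x by (intro divide_left_mono) auto
      finally show ?thesis using False by simp
    qed
  qed
  have "real (card (smooth_ints (prime_factors D) N)) \<le> C * N powr \<epsilon> * real_of_int \<bar>D\<bar> powr \<epsilon>"
    if D: "D \<noteq> 0" and N: "N \<ge> 1" for D N
  proof -
    define P where "P = prime_factors D"
    have finP: "finite P" and prP: "\<And>p. p \<in> P \<Longrightarrow> prime p" by (auto simp: P_def)
    have posP: "p > 0" if "p \<in> P" for p using prP[OF that] by (simp add: prime_gt_0_int)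
    have "real (card (smooth_ints P N)) = (\<Sum>n\<in>smooth_ints P N. 1)" by simp
    also have "\<dots> \<le> (\<Sum>n\<in>smooth_ints P N. N powr \<epsilon> * real_of_int n powr (- \<epsilon>))"
    proof (rule sum_mono)
      fix n assume "n \<in> smooth_ints P N"
      then have n: "n \<ge> 1" "real_of_int n \<le> N" by (auto simp: smooth_ints_def)
      have "1 = real_of_int n powr \<epsilon> * real_of_int n powr (- \<epsilon>)"
        using n by (simp add: powr_add[symmetric])
      also have "\<dots> \<le> N powr \<epsilon> * real_of_int n powr (- \<epsilon>)"
        using n assms by (intro mult_right_mono powr_mono2) auto
      finally show "1 \<le> N powr \<epsilon> * real_of_int n powr (- \<epsilon>)" .
    qed
    also have "\<dots> = N powr \<epsilon> * (\<Sum>n\<in>smooth_ints P N. real_of_int n powr (- \<epsilon>))"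
      by (simp add: sum_distrib_left)
    also have "\<dots> \<le> N powr \<epsilon> * (\<Prod>p\<in>P. 1 / (1 - real_of_int p powr (- \<epsilon>)))"
      using sum_smooth_ints_le[OF finP prP assms] by (intro mult_left_mono) auto
    also have "\<dots> \<le> N powr \<epsilon> * (\<Prod>p\<in>P. (if p < p0 then K else 1) * real_of_int p powr \<epsilon>)"
    proof (intro mult_left_mono prod_mono conjI)
      fix p assume p: "p \<in> P"
      have "real_of_int p powr (- \<epsilon>) < 1"
        using prP[OF p] assms prime_ge_2_int[of p] by (intro powr_less_one) auto
      then show "0 \<le> 1 / (1 - real_of_int p powr (- \<epsilon>))" by simp
    qed (use fac prP in auto)
    also have "(\<Prod>p\<in>P. (if p < p0 then K else 1) * real_of_int p powr \<epsilon>)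
        = (\<Prod>p\<in>P. if p < p0 then K else 1) * (\<Prod>p\<in>P. real_of_int p powr \<epsilon>)"
      by (simp add: prod.distrib)
    also have "(\<Prod>p\<in>P. real_of_int p powr \<epsilon>) = real_of_int (\<Prod>p\<in>P. p) powr \<epsilon>"
      using posP by (simp add: prod_powr_distrib less_imp_le)
    also have "N powr \<epsilon> * ((\<Prod>p\<in>P. if p < p0 then K else 1) * real_of_int (\<Prod>p\<in>P. p) powr \<epsilon>)
        \<le> N powr \<epsilon> * (C * real_of_int \<bar>D\<bar> powr \<epsilon>)"
    proof (intro mult_left_mono mult_mono)
      have "(\<Prod>p\<in>P. if p < p0 then K else 1) = (\<Prod>p\<in>{p\<in>P. p < p0}. K)"
        using finP by (simp add: prod.inter_filter[symmetric] )
      also have "\<dots> = K ^ card {p\<in>P. p < p0}" by simp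
      also have "\<dots> \<le> K ^ nat p0"
      proof (rule power_increasing[OF _ K])
        have "card {p\<in>P. p < p0} \<le> card {0..<p0}"
          using posP by (intro card_mono) (auto simp: less_imp_le)
        then show "card {p\<in>P. p < p0} \<le> nat p0" by simp
      qed
      finally show "(\<Prod>p\<in>P. if p < p0 then K else 1) \<le> C" by (simp add: C_def)
      have "(\<Prod>p\<in>P. p) \<le> \<bar>D\<bar>"
      proof -
        have "(\<Prod>p\<in>P. p) dvd (\<Prod>p\<in>P. p ^ multiplicity p D)"
          by (intro prod_dvd_prod dvd_power)
             (auto simp: P_def prime_factors_multiplicity)
        also have "(\<Prod>p\<in>P. p ^ multiplicity p D) = \<bar>D\<bar>"
          using prod_prime_factors[OF D] by (simp add: P_def)
        finally show ?thesis using D by (simp add: zdvd_imp_le)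
      qed
      then show "real_of_int (\<Prod>p\<in>P. p) powr \<epsilon> \<le> real_of_int \<bar>D\<bar> powr \<epsilon>"
        using assms posP by (intro powr_mono2) (auto simp: prod_nonneg less_imp_le simp flip: of_int_prod)
    qed (use C in auto)
    finally show ?thesis by (simp add: P_def mult_ac)
  qed
  then show ?thesis using that[of C] C by auto
qed

section \<open>Weights with a Kraft inequality\<close>

text \<open>\<open>W h p\<close> is the weight of the entry p after the prefix h. Summing over the
  last entry first leaves a factor of at most B whatever the prefix is, so the weight may depend on
  the prefix in any way.\<close>

lemma kraft_sum_le:
  fixes W :: "'a list \<Rightarrow> 'a \<Rightarrow> real"
  assumes R: "finite R" and B: "B \<ge> 0" and W: "\<And>h p. W h p \<ge> 0"
    and step: "\<And>h. set h \<subseteq> R \<Longrightarrow> length h < n \<Longrightarrow> (\<Sum>p\<in>R. W h p) \<le> B"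
  shows "(\<Sum>l\<in>{l. set l \<subseteq> R \<and> length l = n}. \<Prod>t<n. W (take t l) (l ! t)) \<le> B ^ n"
  using step
proof (induction n)
  case 0
  have "{l. set l \<subseteq> R \<and> length l = 0} = {[]}" by auto
  then show ?case by simp
next
  case (Suc n)
  let ?S = "\<lambda>n. {l. set l \<subseteq> R \<and> length l = n}"
  have fin: "finite (?S n)" for n using R by (rule finite_lists_length_eq)
  have inj: "inj_on (\<lambda>(l, p). l @ [p]) (?S n \<times> R)" by (auto simp: inj_on_def)
  have im: "?S (Suc n) = (\<lambda>(l, p). l @ [p]) ` (?S n \<times> R)"
  proof (intro equalityI subsetI)
    fix l assume l: "l \<in> ?S (Suc n)"
    then have "l \<noteq> []" by auto
    then have "l = butlast l @ [last l]" by simp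
    moreover have "butlast l \<in> ?S n" "last l \<in> R" using l \<open>l \<noteq> []\<close>
      by (auto dest: in_set_butlastD)
    ultimately show "l \<in> (\<lambda>(l, p). l @ [p]) ` (?S n \<times> R)" by force
  qed auto
  have "(\<Sum>l\<in>?S (Suc n). \<Prod>t<Suc n. W (take t l) (l ! t))
      = (\<Sum>(l, p)\<in>?S n \<times> R. \<Prod>t<Suc n. W (take t (l @ [p])) ((l @ [p]) ! t))"
    unfolding im by (subst sum.reindex[OF inj]) (simp add: case_prod_unfold)
  also have "\<dots> = (\<Sum>(l, p)\<in>?S n \<times> R. (\<Prod>t<n. W (take t l) (l ! t)) * W l p)"
    by (intro sum.cong) (auto simp: nth_append)
  also have "\<dots> = (\<Sum>l\<in>?S n. (\<Prod>t<n. W (take t l) (l ! t)) * (\<Sum>p\<in>R. W l p))"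
    by (simp add: sum.cartesian_product[symmetric] sum_distrib_left)
  also have "\<dots> \<le> (\<Sum>l\<in>?S n. (\<Prod>t<n. W (take t l) (l ! t)) * B)"
    using Suc.prems W by (intro sum_mono mult_left_mono prod_nonneg) auto
  also have "\<dots> = (\<Sum>l\<in>?S n. (\<Prod>t<n. W (take t l) (l ! t))) * B"
    by (simp add: sum_distrib_right)
  also have "\<dots> \<le> B ^ n * B"
    using Suc B by (intro mult_right_mono Suc.IH) auto
  finally show ?case by (simp add: mult.commute)
qed

lemma prod_dvd_if_pairwise_coprime:
  fixes f :: "'a \<Rightarrow> int"
  assumes "finite A" "\<And>a. a \<in> A \<Longrightarrow> f a dvd n"
    "\<And>a b. a \<in> A \<Longrightarrow> b \<in> A \<Longrightarrow> a \<noteq> b \<Longrightarrow> coprime (f a) (f b)"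
  shows "(\<Prod>a\<in>A. f a) dvd n"
  using assms
proof (induction A rule: finite_induct)
  case (insert a A)
  have "coprime (f a) (\<Prod>b\<in>A. f b)"
    using insert by (intro prod_coprime_right) auto
  then show ?case using insert by (simp add: divides_mult)
qed simp

text \<open>On either side of a the points of one residue class modulo M have distinct quotients |p
  - a| div M. Each side is therefore dominated by 1 + 1 + 1 / 2 + ... + 1 / N, where the first 1
  belongs to the quotient 0.\<close>

lemma sum_inverse_class_le:
  fixes G :: "int set" and N :: nat
  assumes "finite G" "M > 0" and a: "\<And>p. p \<in> G \<Longrightarrow> p \<noteq> a \<and> \<bar>p - a\<bar> \<le> int N"
    and cl: "\<And>p p'. p \<in> G \<Longrightarrow> p' \<in> G \<Longrightarrow> M dvd p - p'"
  shows "(\<Sum>p\<in>G. 1 / max 1 (real_of_int \<bar>p - a\<bar> / real_of_int M)) \<le> 2 * (1 + harm N)"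
proof -
  define q where "q = (\<lambda>p. nat (\<bar>p - a\<bar> div M))"
  define w where "w = (\<lambda>n::nat. if n = 0 then 1 else 1 / real n)"
  define h where "h = (\<lambda>p. 1 / max 1 (real_of_int \<bar>p - a\<bar> / real_of_int M))"
  have hw: "h p \<le> w (q p)" if "p \<in> G" for p
  proof (cases "q p = 0")
    case False
    have "real (q p) = real_of_int (\<bar>p - a\<bar> div M)" using assms by (simp add: q_def pos_imp_zdiv_nonneg_iff)
    also have "\<dots> \<le> real_of_int \<bar>p - a\<bar> / real_of_int M" by (rule real_of_int_div4)
    finally have "real (q p) \<le> max 1 (real_of_int \<bar>p - a\<bar> / real_of_int M)" by simp
    then have "1 / max 1 (real_of_int \<bar>p - a\<bar> / real_of_int M) \<le> 1 / real (q p)"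
      using False by (intro divide_left_mono) auto
    then show ?thesis using False by (simp add: h_def w_def)
  qed (simp add: h_def w_def)
  have qN: "q p \<in> {..N}" if "p \<in> G" for p
  proof -
    have "\<bar>p - a\<bar> div M \<le> \<bar>p - a\<bar>" using assms(2)
      by (smt (verit) div_by_1 zdiv_mono2)
    then have "\<bar>p - a\<bar> div M \<le> int N" using a[OF that] by linarith
    then show ?thesis by (simp add: q_def nat_le_iff)
  qed
  have side: "(\<Sum>p\<in>G'. h p) \<le> 1 + harm N"
    if G': "G' \<subseteq> G" "(\<forall>p\<in>G'. p > a) \<or> (\<forall>p\<in>G'. p < a)" for G'
  proof -
    have inj: "inj_on q G'"
    proof (rule inj_onI, rule ccontr)
      fix p p' assume p: "p \<in> G'" "p' \<in> G'" "q p = q p'" "p \<noteq> p'"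
      have "M dvd p - p'" using cl p G' by blast
      have e: "\<bar>p - a\<bar> div M = \<bar>p' - a\<bar> div M"
        using p(3) assms(2) by (simp add: q_def pos_imp_zdiv_nonneg_iff eq_nat_nat_iff)
      \<comment> \<open>Both points lie on the same side of a, so |p - a| - |p' - a| is p - p' up to
        sign and divisible by M. Equal quotients and equal remainders give equal points.\<close>
      have "\<bar>p - a\<bar> mod M = \<bar>p' - a\<bar> mod M"
      proof -
        have "M dvd \<bar>p - a\<bar> - \<bar>p' - a\<bar>"
        proof -
          have "\<bar>p - a\<bar> - \<bar>p' - a\<bar> = p - p' \<or> \<bar>p - a\<bar> - \<bar>p' - a\<bar> = - (p - p')"
          proof -
            have "(a < p \<and> a < p') \<or> (p < a \<and> p' < a)" using G'(2) p(1,2) by blast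
            then show ?thesis by linarith
          qed
          then show ?thesis using \<open>M dvd p - p'\<close> by (metis dvd_minus_iff)
        qed
        then show ?thesis by (simp add: mod_eq_dvd_iff)
      qed
      then have "\<bar>p - a\<bar> = \<bar>p' - a\<bar>" using e by (metis div_mult_mod_eq)
      moreover have "(a < p \<and> a < p') \<or> (p < a \<and> p' < a)" using G'(2) p(1,2) by blast
      ultimately show False using p(4) by linarith
    qed
    have "(\<Sum>p\<in>G'. h p) \<le> (\<Sum>p\<in>G'. w (q p))" using hw G' by (intro sum_mono) auto
    also have "\<dots> = (\<Sum>n\<in>q ` G'. w n)" using inj by (simp add: sum.reindex)
    also have "\<dots> \<le> (\<Sum>n\<in>{..N}. w n)" using qN G' by (intro sum_mono2) (auto simp: w_def)
    also have "{..N} = insert 0 {1..N}" by auto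
    also have "(\<Sum>n\<in>insert 0 {1..N}. w n) = 1 + harm N"
      by (simp add: w_def harm_def inverse_eq_divide)
    finally show ?thesis .
  qed
  define G1 where "G1 = {p\<in>G. p > a}"
  define G2 where "G2 = {p\<in>G. p < a}"
  have "G = G1 \<union> G2" using a by (force simp: G1_def G2_def)
  moreover have "(\<Sum>p\<in>G1 \<union> G2. h p) = (\<Sum>p\<in>G1. h p) + (\<Sum>p\<in>G2. h p)"
    using assms(1) by (intro sum.union_disjoint) (auto simp: G1_def G2_def)
  ultimately have "(\<Sum>p\<in>G. h p) = (\<Sum>p\<in>G1. h p) + (\<Sum>p\<in>G2. h p)" by simp
  also have "\<dots> \<le> (1 + harm N) + (1 + harm N)"
    by (intro add_mono side) (auto simp: G1_def G2_def)
  finally show ?thesis by (simp add: h_def)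
qed

text \<open>By the Chinese remainder theorem the points sharing the same \<open>K\<close>-smooth parts
  lie in one residue class, whose modulus is the product of these parts.\<close>

lemma sum_crt_cost_le:
  fixes A :: "int set" and N :: nat
  assumes finA: "finite A" and a0: "a0 \<in> A" and A: "A \<subseteq> {1..int N}"
    and Q0: "Q0 \<subseteq> K"
    and diff: "\<And>a b. a \<in> A \<Longrightarrow> b \<in> A \<Longrightarrow> a \<noteq> b \<Longrightarrow> prime_factors (a - b) \<subseteq> Q0"
  shows "(\<Sum>p\<in>{1..int N} - A. 1 / max 1 (real_of_int (prime_part (- Q0) (p - a0)) /
            (\<Prod>a\<in>A. real_of_int (prime_part (K - Q0) (p - a)))))
       \<le> real (card (smooth_ints K N)) ^ (card A + 1) * (2 * (1 + harm N))"
proof -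
  define S where "S = smooth_ints K N"
  define R where "R = {1..int N} - A"
  \<comment> \<open>The pattern of smooth parts: the \<open>Q0\<close>-part seen from
    \<open>a0\<close> alone, and the part from \<open>K - Q0\<close> seen from every a. Each entry
    is a smooth integer up to N, whence the exponent card A + 1.\<close>
  define g where "g = (\<lambda>p. (prime_part Q0 (p - a0), \<lambda>a\<in>A. prime_part (K - Q0) (p - a)))"
  define h where "h = (\<lambda>p. 1 / max 1 (real_of_int (prime_part (- Q0) (p - a0)) /
            (\<Prod>a\<in>A. real_of_int (prime_part (K - Q0) (p - a)))))"
  define T where "T = S \<times> (A \<rightarrow>\<^sub>E S)"
  have nz: "p - a \<noteq> 0" if "p \<in> R" "a \<in> A" for p a using that by (auto simp: R_def)
  have le: "\<bar>p - a\<bar> \<le> int N" if "p \<in> R" "a \<in> A" for p a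
  proof -
    have "1 \<le> a" "a \<le> int N" "1 \<le> p" "p \<le> int N" using that A by (auto simp: R_def)
    then show ?thesis by linarith
  qed
  have inS: "prime_part Q (p - a) \<in> S" if "p \<in> R" "a \<in> A" "Q \<subseteq> K" for p a Q
    using prime_part_le[OF nz[OF that(1,2)], of Q] le[OF that(1,2)] prime_part_ge_1[of Q "p - a"] that(3)
    by (auto simp: S_def smooth_ints_def prime_factors_prime_part)
  have gT: "g ` R \<subseteq> T" using inS a0 Q0 by (auto simp: g_def T_def)
  have finT: "finite T" using finA by (simp add: T_def S_def finite_PiE)
  have fib: "(\<Sum>p\<in>{p\<in>R. g p = z}. h p) \<le> 2 * (1 + harm N)" for z
  proof (cases "{p\<in>R. g p = z} = {}")
    case True
    show ?thesis unfolding True using harm_nonneg[of N, where ?'a = real] by simp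
  next
    case False
    then obtain p0 where p0: "p0 \<in> R" "g p0 = z" by auto
    define \<delta> where "\<delta> = prime_part Q0 (p0 - a0)"
    define \<kappa> where "\<kappa> = (\<lambda>a. prime_part (K - Q0) (p0 - a))"
    define M where "M = \<delta> * (\<Prod>a\<in>A. \<kappa> a)"
    have M: "M > 0" unfolding M_def \<delta>_def \<kappa>_def by (intro mult_pos_pos prod_pos) auto
    have gz: "prime_part Q0 (p - a0) = \<delta>" "\<And>a. a \<in> A \<Longrightarrow> prime_part (K - Q0) (p - a) = \<kappa> a"
      if "g p = z" for p
    proof -
      have "g p = g p0" using that p0 by simp
      then show "prime_part Q0 (p - a0) = \<delta>" by (simp add: g_def \<delta>_def)
      fix a assume "a \<in> A"
      from \<open>g p = g p0\<close> have "(\<lambda>a\<in>A. prime_part (K - Q0) (p - a)) a = (\<lambda>a\<in>A. prime_part (K - Q0) (p0 - a)) a"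
        by (simp add: g_def)
      then show "prime_part (K - Q0) (p - a) = \<kappa> a" using \<open>a \<in> A\<close> by (simp add: \<kappa>_def)
    qed
    \<comment> \<open>A prime outside \<open>Q0\<close> cannot divide both p0 - a and p0 - b,
      because it would divide a - b.\<close>
    have cop: "coprime (\<kappa> a) (\<kappa> b)" if ab: "a \<in> A" "b \<in> A" "a \<noteq> b" for a b
    proof (rule coprime_if_disjoint_prime_factors)
      show "prime_factors (\<kappa> a) \<inter> prime_factors (\<kappa> b) = {}"
      proof (rule ccontr)
        assume "prime_factors (\<kappa> a) \<inter> prime_factors (\<kappa> b) \<noteq> {}"
        then obtain q where q: "q \<in> prime_factors (p0 - a)" "q \<in> prime_factors (p0 - b)" "q \<notin> Q0"
          by (auto simp: \<kappa>_def prime_factors_prime_part)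
        then have "q dvd p0 - b" "q dvd p0 - a" by (simp_all add: in_prime_factors_iff)
        then have "q dvd (p0 - b) - (p0 - a)" by (rule dvd_diff)
        then have "q \<in> prime_factors (a - b)" using q ab by (auto simp: in_prime_factors_iff)
        then show False using diff[OF ab] q by auto
      qed
    qed (auto simp: \<kappa>_def)
    have cop2: "coprime \<delta> (\<Prod>a\<in>A. \<kappa> a)"
    proof (rule prod_coprime_right, rule coprime_if_disjoint_prime_factors)
      fix a show "prime_factors \<delta> \<inter> prime_factors (\<kappa> a) = {}"
        by (auto simp: \<delta>_def \<kappa>_def prime_factors_prime_part)
    qed (auto simp: \<delta>_def \<kappa>_def)
    have cl: "M dvd p - p'" if p: "p \<in> R" "g p = z" "p' \<in> R" "g p' = z" for p p'
    proof -
      have d: "x dvd p - p'" if "x dvd p - a" "x dvd p' - a" for x a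
      proof -
        have "x dvd (p - a) - (p' - a)" using that by (rule dvd_diff)
        then show ?thesis by simp
      qed
      have "\<delta> dvd p - p'"
        using gz[OF p(2)] gz[OF p(4)] prime_part_dvd[OF nz[OF p(1) a0], of Q0]
          prime_part_dvd[OF nz[OF p(3) a0], of Q0] by (intro d[of _ a0]) simp_all
      moreover have "(\<Prod>a\<in>A. \<kappa> a) dvd p - p'"
      proof (rule prod_dvd_if_pairwise_coprime[OF finA _ cop])
        fix a assume a: "a \<in> A"
        show "\<kappa> a dvd p - p'"
          using gz(2)[OF p(2) a] gz(2)[OF p(4) a] prime_part_dvd[OF nz[OF p(1) a], of "K - Q0"]
            prime_part_dvd[OF nz[OF p(3) a], of "K - Q0"] by (intro d[of _ a]) simp_all
      qed
      ultimately show ?thesis unfolding M_def using cop2 by (rule divides_mult)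
    qed
    \<comment> \<open>|p - a0| is \<delta> times its \<open>Q0\<close>-free part and \<delta> is
      also a factor of M, so it cancels and the weight becomes that of
      \<open>sum_inverse_class_le\<close>.\<close>
    have heq: "h p = 1 / max 1 (real_of_int \<bar>p - a0\<bar> / real_of_int M)" if p: "p \<in> R" "g p = z" for p
    proof -
      have "\<bar>p - a0\<bar> = \<delta> * prime_part (- Q0) (p - a0)"
        using prime_part_Compl[OF nz[OF p(1) a0], of Q0] gz(1)[OF p(2)] by simp
      moreover have "\<delta> > 0" by (simp add: \<delta>_def)
      ultimately have "real_of_int \<bar>p - a0\<bar> / real_of_int M
          = real_of_int (prime_part (- Q0) (p - a0)) / (\<Prod>a\<in>A. real_of_int (\<kappa> a))"
        by (simp add: M_def)
      moreover have "(\<Prod>a\<in>A. real_of_int (prime_part (K - Q0) (p - a))) = (\<Prod>a\<in>A. real_of_int (\<kappa> a))"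
        by (intro prod.cong refl) (simp add: gz(2)[OF p(2)])
      ultimately show ?thesis by (simp add: h_def)
    qed
    have "(\<Sum>p\<in>{p\<in>R. g p = z}. h p) = (\<Sum>p\<in>{p\<in>R. g p = z}. 1 / max 1 (real_of_int \<bar>p - a0\<bar> / real_of_int M))"
      by (intro sum.cong) (auto simp: heq)
    also have "\<dots> \<le> 2 * (1 + harm N)"
    proof (rule sum_inverse_class_le[OF _ M])
      show "finite {p\<in>R. g p = z}" by (rule finite_subset[of _ R]) (auto simp: R_def)
    qed (use nz le a0 cl in auto)
    finally show ?thesis .
  qed
  have "(\<Sum>p\<in>R. h p) = (\<Sum>z\<in>T. \<Sum>p\<in>{p\<in>R. g p = z}. h p)"
    using sum.group[OF _ finT gT, of h] by (simp add: R_def)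
  also have "\<dots> \<le> (\<Sum>z\<in>T. 2 * (1 + harm N))" by (intro sum_mono fib)
  also have "\<dots> = real (card S) ^ (card A + 1) * (2 * (1 + harm N))"
    using finA by (simp add: T_def card_cartesian_product card_PiE)
  finally show ?thesis by (simp add: R_def h_def S_def)
qed

section \<open>Power sums agreeing in all degrees but one\<close>

definition root_poly :: "int multiset \<Rightarrow> int poly" where
  "root_poly M = (\<Prod>a\<in>#M. [:- a, 1:])"

definition power_sum :: "nat \<Rightarrow> int multiset \<Rightarrow> int" where
  "power_sum j M = (\<Sum>a\<in>#M. a ^ j)"

text \<open>The elementary symmetric polynomial of degree m with the sign (-1)^m. With this sign it
  is a coefficient of \<open>root_poly\<close> itself, and Newton's identities have no alternating
  signs.\<close>

definition esym :: "int multiset \<Rightarrow> nat \<Rightarrow> int" where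
  "esym M m = coeff (\<Prod>a\<in>#M. [:1, - a:]) m"

lemma root_poly_empty [simp]: "root_poly {#} = 1" by (simp add: root_poly_def)

lemma root_poly_add [simp]: "root_poly (add_mset a M) = [:- a, 1:] * root_poly M"
  by (simp add: root_poly_def)

lemma root_poly_nonzero [simp]: "root_poly M \<noteq> 0"
  by (induction M) (simp_all del: mult_pCons_left)

lemma poly_root_poly: "poly (root_poly M) t = (\<Prod>a\<in>#M. t - a)"
  by (induction M) (simp_all del: mult_pCons_left)

lemma degree_root_poly [simp]: "degree (root_poly M) = size M"
  by (induction M) (simp_all add: degree_mult_eq del: mult_pCons_left)

lemma proots_root_poly: "proots (root_poly M) = M"
  by (induction M) (simp_all add: proots_mult del: mult_pCons_left)

lemma root_poly_inject: "root_poly M = root_poly N \<longleftrightarrow> M = N"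
  by (metis proots_root_poly)

lemma poly_root_poly_eq_0_iff: "poly (root_poly M) t = 0 \<longleftrightarrow> t \<in># M"
  by (auto simp: poly_root_poly prod_mset_zero_iff)

lemma reflect_root_poly: "reflect_poly (root_poly M) = (\<Prod>a\<in>#M. [:1, - a:])"
proof (induction M)
  case (add a M)
  have "reflect_poly [:- a, 1:] = [:1, - a:]" 
    by (rule poly_eqI) (auto simp: coeff_reflect_poly coeff_pCons split: nat.splits)
  then show ?case using add by (simp add: reflect_poly_mult del: mult_pCons_left)
qed simp

lemma esym_eq: "esym M m = (if m \<le> size M then coeff (root_poly M) (size M - m) else 0)"
proof -
  have "esym M m = coeff (reflect_poly (root_poly M)) m" by (simp add: esym_def reflect_root_poly)
  then show ?thesis by (auto simp: coeff_reflect_poly)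
qed

lemma esym_0 [simp]: "esym M 0 = 1"
  by (induction M) (simp_all add: esym_def)

lemma coeff_root_poly: "j \<le> size M \<Longrightarrow> coeff (root_poly M) j = esym M (size M - j)"
  by (simp add: esym_eq)

text \<open>Induction on the multiset. A new root a subtracts a * esym (m - 1) from
  \<open>esym\<close> and adds a^i to the power sums; the terms that involve powers of a collapse by
  G (m + 1) = a * esym m + a * G m.\<close>

lemma newton_identity:
  "int m * esym M m = - (\<Sum>i=1..m. esym M (m - i) * power_sum i M)"
proof (induction M arbitrary: m)
  case empty
  then show ?case by (cases m) (simp_all add: esym_def power_sum_def)
next
  case (add a M)
  have e: "esym (add_mset a M) n = esym M n - (if n = 0 then 0 else a * esym M (n - 1))" for n
    by (cases n) (simp_all add: esym_def)
  show ?case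
  proof (cases m)
    case 0 then show ?thesis by simp
  next
    case (Suc m')
    define N where "N = (\<lambda>n. \<Sum>i=1..n. esym M (n - i) * power_sum i M)"
    define G where "G = (\<lambda>n. \<Sum>i=1..n. esym M (n - i) * a ^ i)"
    have G: "G (Suc m') = a * esym M m' + a * G m'"
    proof -
      have "G (Suc m') = (\<Sum>i=0..m'. esym M (m' - i) * a ^ Suc i)"
        unfolding G_def One_nat_def sum.shift_bounds_cl_Suc_ivl by simp
      also have "\<dots> = a * esym M m' + (\<Sum>i=1..m'. esym M (m' - i) * a ^ Suc i)"
        by (subst sum.atLeast_Suc_atMost) auto
      also have "(\<Sum>i=1..m'. esym M (m' - i) * a ^ Suc i) = a * G m'"
        by (simp add: G_def sum_distrib_left mult_ac)
      finally show ?thesis .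
    qed
    have "(\<Sum>i=1..m. esym (add_mset a M) (m - i) * power_sum i (add_mset a M))
        = (\<Sum>i=1..Suc m'. (esym M (Suc m' - i) - (if i = Suc m' then 0 else a * esym M (m' - i))) * (power_sum i M + a ^ i))"
      unfolding Suc by (intro sum.cong refl) (auto simp: e power_sum_def Suc_diff_le)
    also have "\<dots> = (\<Sum>i=1..Suc m'. esym M (Suc m' - i) * (power_sum i M + a ^ i))
        - (\<Sum>i=1..m'. a * esym M (m' - i) * (power_sum i M + a ^ i))"
      by (simp add: left_diff_distrib sum_subtractf sum.If_cases)
    also have "\<dots> = N (Suc m') + G (Suc m') - a * N m' - a * G m'"
      by (simp add: N_def G_def sum.distrib algebra_simps sum_distrib_left)
    also have "\<dots> = N (Suc m') - a * N m' + a * esym M m'" by (simp add: G)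
    finally have s: "(\<Sum>i=1..m. esym (add_mset a M) (m - i) * power_sum i (add_mset a M))
       = N (Suc m') - a * N m' + a * esym M m'" .
    have "int m * esym (add_mset a M) m = int (Suc m') * esym M (Suc m') - a * (int m' * esym M m') - a * esym M m'"
      by (simp add: Suc e algebra_simps)
    also have "\<dots> = - N (Suc m') + a * N m' - a * esym M m'"
      using add.IH[of "Suc m'"] add.IH[of m'] by (simp add: N_def)
    finally show ?thesis using s by simp
  qed
qed

definition psum_sys :: "nat \<Rightarrow> nat \<Rightarrow> int multiset \<Rightarrow> int multiset \<Rightarrow> bool" where
  "psum_sys k d Mx My \<longleftrightarrow> size Mx = k \<and> size My = k \<and>
     (\<forall>j\<in>{1..k}. j \<noteq> k - d \<longrightarrow> power_sum j Mx = power_sum j My)"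

lemma psum_sys_sym: "psum_sys k d Mx My \<Longrightarrow> psum_sys k d My Mx"
  by (auto simp: psum_sys_def)

lemma esym_eq_below:
  assumes "\<And>j. j \<in> {1..m} \<Longrightarrow> power_sum j Mx = power_sum j My"
  shows "esym Mx m = esym My m"
  using assms
proof (induction m rule: less_induct)
  case (less m)
  have "int m * esym Mx m = int m * esym My m"
  proof -
    have "(\<Sum>i=1..m. esym Mx (m - i) * power_sum i Mx) = (\<Sum>i=1..m. esym My (m - i) * power_sum i My)"
      using less by (intro sum.cong) (auto intro!: arg_cong2[where f = "(*)"])
    then show ?thesis by (simp only: newton_identity)
  qed
  then show ?case by (cases "m = 0") auto
qed

lemma psum_sys_esym_low:
  assumes "psum_sys k d Mx My" "m < k - d"
  shows "esym Mx m = esym My m"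
  using assms by (intro esym_eq_below) (auto simp: psum_sys_def)

text \<open>Subtract Newton's identities of the two sides at index n + s with n = k - d. Only the
  power sum of index n differs, by \<eta> = - n \<Delta> n, and the \<open>esym\<close> multiplying
  it agree because s <= d < n. With the induction hypothesis the remaining terms form Newton's
  identity for \<open>My\<close> at s, so that both contributions add up to (n + s) \<Delta> n esym
  My s.\<close>

lemma psum_sys_esym_high:
  assumes sys: "psum_sys k d Mx My" and dk: "2 * d < k" and s: "s \<le> d"
  shows "esym Mx (k - d + s) - esym My (k - d + s) = (esym Mx (k - d) - esym My (k - d)) * esym My s"
  using s
proof (induction s rule: less_induct)
  case (less s)
  define n where "n = k - d"
  define \<Delta> where "\<Delta> = (\<lambda>m. esym Mx m - esym My m)"
  define \<eta> where "\<eta> = power_sum n Mx - power_sum n My"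
  have n: "n > d" "n > 0" using dk by (auto simp: n_def)
  have low: "\<Delta> m = 0" if "m < n" for m
    using psum_sys_esym_low[OF sys] that by (simp add: \<Delta>_def n_def)
  have ps: "power_sum i Mx = power_sum i My" if "1 \<le> i" "i \<le> n + s" "i \<noteq> n" for i
    using sys that less.prems dk by (auto simp: psum_sys_def n_def)
  have key: "int (n + t) * \<Delta> (n + t) = - (\<Sum>i=1..t. \<Delta> (n + t - i) * power_sum i My) - esym My t * \<eta>"
    if t: "t \<le> s" for t
  proof -
    have t_d: "t \<le> d" using t less.prems by simp
    have ee: "esym Mx t = esym My t" using low[of t] t_d n by (simp add: \<Delta>_def)
    have "int (n + t) * \<Delta> (n + t) = - (\<Sum>i=1..n+t. esym Mx (n + t - i) * power_sum i Mx - esym My (n + t - i) * power_sum i My)"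
      unfolding \<Delta>_def right_diff_distrib newton_identity by (simp add: sum_subtractf)
    also have "(\<Sum>i=1..n+t. esym Mx (n + t - i) * power_sum i Mx - esym My (n + t - i) * power_sum i My)
       = (\<Sum>i=1..n+t. (if i = n then esym My t * \<eta> else 0) + \<Delta> (n + t - i) * power_sum i My)"
    proof (rule sum.cong[OF refl])
      fix i assume i: "i \<in> {1..n+t}"
      show "esym Mx (n + t - i) * power_sum i Mx - esym My (n + t - i) * power_sum i My
         = (if i = n then esym My t * \<eta> else 0) + \<Delta> (n + t - i) * power_sum i My"
      proof (cases "i = n")
        case True
        then show ?thesis using ee by (simp add: \<Delta>_def \<eta>_def algebra_simps)
      next
        case False
        then show ?thesis using ps[of i] i t by (simp add: \<Delta>_def algebra_simps)
      qed
    qed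
    also have "\<dots> = esym My t * \<eta> + (\<Sum>i=1..n+t. \<Delta> (n + t - i) * power_sum i My)"
      using n by (simp add: sum.distrib)
    also have "(\<Sum>i=1..n+t. \<Delta> (n + t - i) * power_sum i My) = (\<Sum>i=1..t. \<Delta> (n + t - i) * power_sum i My)"
      using low n by (intro sum.mono_neutral_right) auto
    finally show ?thesis by simp
  qed
  have k0: "int n * \<Delta> n = - \<eta>" using key[of 0] by simp
  have "int (n + s) * \<Delta> (n + s) = - (\<Sum>i=1..s. \<Delta> n * esym My (s - i) * power_sum i My) - esym My s * \<eta>"
  proof -
    have "(\<Sum>i=1..s. \<Delta> (n + s - i) * power_sum i My) = (\<Sum>i=1..s. \<Delta> n * esym My (s - i) * power_sum i My)"
    proof (rule sum.cong[OF refl])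
      fix i assume i: "i \<in> {1..s}"
      have "\<Delta> (n + (s - i)) = \<Delta> n * esym My (s - i)"
        using less.IH[of "s - i"] less.prems i by (simp add: \<Delta>_def n_def)
      then show "\<Delta> (n + s - i) * power_sum i My = \<Delta> n * esym My (s - i) * power_sum i My"
        using i by simp
    qed
    then show ?thesis using key[of s] by simp
  qed
  also have "\<dots> = \<Delta> n * (- (\<Sum>i=1..s. esym My (s - i) * power_sum i My)) + esym My s * (int n * \<Delta> n)"
    by (simp add: k0 sum_distrib_left mult_ac)
  also have "\<dots> = \<Delta> n * (int s * esym My s) + esym My s * (int n * \<Delta> n)"
    by (simp only: newton_identity[of s My])
  also have "\<dots> = int (n + s) * (\<Delta> n * esym My s)" by (simp add: algebra_simps)
  finally have "\<Delta> (n + s) = \<Delta> n * esym My s" using n by simp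
  then show ?case by (simp add: \<Delta>_def n_def)
qed

text \<open>For size M >= d this is the polynomial quotient of \<open>root_poly M\<close> by z^(size
  M - d): it keeps the d + 1 leading coefficients. In a solution with 2 d < k these have index below
  k - d and are common to both sides.\<close>

definition tau_poly :: "nat \<Rightarrow> int multiset \<Rightarrow> int poly" where
  "tau_poly d M = (\<Sum>j\<le>d. monom (esym M j) (d - j))"

lemma coeff_tau_poly: "coeff (tau_poly d M) i = (if i \<le> d then esym M (d - i) else 0)"
proof -
  have "coeff (tau_poly d M) i = (\<Sum>j\<le>d. if d - j = i then esym M j else 0)"
    by (simp add: tau_poly_def coeff_sum)
  also have "\<dots> = (if i \<le> d then esym M (d - i) else 0)"
  proof (cases "i \<le> d")
    case True
    have "(\<Sum>j\<le>d. if d - j = i then esym M j else 0) = (\<Sum>j\<in>{d - i}. if d - j = i then esym M j else 0)"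
      by (rule sum.mono_neutral_right) auto
    then show ?thesis using True by simp
  next
    case False
    then show ?thesis by (auto intro!: sum.neutral)
  qed
  finally show ?thesis .
qed

lemma tau_poly_eq:
  assumes "psum_sys k d Mx My" "2 * d < k"
  shows "tau_poly d Mx = tau_poly d My"
  using assms by (intro poly_eqI) (auto simp: coeff_tau_poly intro!: psum_sys_esym_low[OF assms(1)])

definition jump :: "nat \<Rightarrow> nat \<Rightarrow> int multiset \<Rightarrow> int multiset \<Rightarrow> int" where
  "jump k d Mx My = esym Mx (k - d) - esym My (k - d)"

text \<open>Coefficients of degree i > d vanish by \<open>psum_sys_esym_low\<close>; those of degree
  i <= d are given by \<open>psum_sys_esym_high\<close> with s = d - i. \<open>jump\<close> is the H
  of the factorisation.\<close>

theorem psum_sys_factor: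
  assumes sys: "psum_sys k d Mx My" and dk: "2 * d < k"
  shows "root_poly Mx - root_poly My = smult (jump k d Mx My) (tau_poly d My)"
proof (rule poly_eqI)
  fix i
  have sz: "size Mx = k" "size My = k" using sys by (auto simp: psum_sys_def)
  show "coeff (root_poly Mx - root_poly My) i = coeff (smult (jump k d Mx My) (tau_poly d My)) i"
  proof (cases "i \<le> k")
    case False
    then show ?thesis using sz dk by (simp add: coeff_eq_0 coeff_tau_poly)
  next
    case True
    then have c: "coeff (root_poly Mx - root_poly My) i = esym Mx (k - i) - esym My (k - i)"
      using sz by (simp add: coeff_root_poly)
    show ?thesis
    proof (cases "i \<le> d")
      case True
      have "k - i = k - d + (d - i)" using True dk by simp
      then show ?thesis using c psum_sys_esym_high[OF sys dk, of "d - i"] True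
        by (simp add: coeff_tau_poly jump_def)
    next
      case False
      then show ?thesis using c psum_sys_esym_low[OF sys, of "k - i"] \<open>i \<le> k\<close>
        by (simp add: coeff_tau_poly)
    qed
  qed
qed

lemma jump_nonzero:
  assumes "psum_sys k d Mx My" "2 * d < k" "Mx \<noteq> My"
  shows "jump k d Mx My \<noteq> 0"
proof
  assume "jump k d Mx My = 0"
  then have "root_poly Mx - root_poly My = 0" using psum_sys_factor[OF assms(1,2)] by simp
  then show False using assms(3) by (simp add: root_poly_inject)
qed

section \<open>Known and unknown primes of a solution\<close>

text \<open>All that the arguments on primes need from a solution. The situation is symmetric, with
  H negated (\<open>swap\<close>); the second phase uses the same lemmas with x and y
  exchanged.\<close>

locale split_system =
  fixes Mx My :: "int multiset" and H :: int and \<tau> :: "int poly"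
  assumes factor: "root_poly Mx - root_poly My = smult H \<tau>"
    and H0: "H \<noteq> 0"
    and disj: "set_mset Mx \<inter> set_mset My = {}"
begin

lemma swap: "split_system My Mx (- H) \<tau>"
proof
  have "root_poly My - root_poly Mx = - (root_poly Mx - root_poly My)" by simp
  then show "root_poly My - root_poly Mx = smult (- H) \<tau>" by (simp only: factor smult_minus_left)
qed (use H0 disj in auto)

lemma value_right: "y \<in># My \<Longrightarrow> (\<Prod>x\<in>#Mx. y - x) = H * poly \<tau> y"
proof -
  assume "y \<in># My"
  then have "poly (root_poly My) y = 0" by (simp add: poly_root_poly_eq_0_iff)
  moreover have "poly (root_poly Mx) y - poly (root_poly My) y = H * poly \<tau> y"
    using arg_cong[OF factor, of "\<lambda>p. poly p y"] by simp
  ultimately have "poly (root_poly Mx) y = H * poly \<tau> y" by simp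
  then show ?thesis by (simp only: poly_root_poly)
qed

lemma value_left: "x \<in># Mx \<Longrightarrow> (\<Prod>y\<in>#My. x - y) = - H * poly \<tau> x"
  using split_system.value_right[OF swap] .

lemma tau_nonzero_right: "y \<in># My \<Longrightarrow> poly \<tau> y \<noteq> 0"
proof
  assume y: "y \<in># My" "poly \<tau> y = 0"
  then have "(\<Prod>x\<in>#Mx. y - x) = 0" using value_right by simp
  then have "y \<in># Mx" by (auto simp: prod_mset_zero_iff)
  then show False using y disj by auto
qed

lemma tau_nonzero_left: "x \<in># Mx \<Longrightarrow> poly \<tau> x \<noteq> 0"
  using split_system.tau_nonzero_right[OF swap] .

text \<open>A prime outside \<open>K\<close> dividing \<open>w - b\<close> cannot divide \<open>\<tau> w\<close>, because \<open>\<tau> w \<equiv> \<tau> b\<close>; so it has to divide \<open>H\<close>.\<close>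

lemma new_part_dvd:
  assumes w: "w \<in># Mx" and B: "B \<subseteq># My"
    and K: "\<And>b. b \<in># B \<Longrightarrow> prime_factors (poly \<tau> b) \<subseteq> K"
  shows "(\<Prod>b\<in>#B. prime_part (- K) (w - b)) dvd H"
proof -
  define E where "E = (\<Prod>b\<in>#B. prime_part (- K) (w - b))"
  have nz: "w - b \<noteq> 0" if "b \<in># B" for b
    using that w disj mset_subset_eqD[OF B] by auto
  have "E dvd (\<Prod>b\<in>#B. w - b)"
    unfolding E_def using nz by (induction B) (auto intro!: mult_dvd_mono prime_part_dvd)
  also have "\<dots> dvd (\<Prod>y\<in>#My. w - y)"
    by (intro prod_mset_subset_imp_dvd image_mset_subseteq_mono B)
  also have "\<dots> = - H * poly \<tau> w" using value_left[OF w] .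
  finally have "E dvd H * poly \<tau> w" by simp
  moreover have "coprime E (poly \<tau> w)"
  proof (rule coprime_if_disjoint_prime_factors)
    show "E \<noteq> 0" unfolding E_def by (auto simp: prod_mset_zero_iff)
    show "poly \<tau> w \<noteq> 0" using tau_nonzero_left[OF w] .
    show "prime_factors E \<inter> prime_factors (poly \<tau> w) = {}"
    proof (rule ccontr)
      assume "prime_factors E \<inter> prime_factors (poly \<tau> w) \<noteq> {}"
      then obtain q where q: "prime q" "q dvd E" "q dvd poly \<tau> w"
        by (auto simp: in_prime_factors_iff)
      from q(1,2) obtain b where b: "b \<in># B" "q dvd prime_part (- K) (w - b)"
        unfolding E_def by (auto simp: prime_dvd_prod_mset_iff)
      then have "q \<in> prime_factors (prime_part (- K) (w - b))" using q(1) by (auto simp: in_prime_factors_iff)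
      then have qb: "q dvd w - b" "q \<notin> K" by (auto simp: prime_factors_prime_part in_prime_factors_iff)
      have "w - b dvd poly \<tau> w - poly \<tau> b"
      proof -
        have "[:- b, 1:] dvd \<tau> - [:poly \<tau> b:]" by (simp add: poly_eq_0_iff_dvd[symmetric])
        then obtain s where "\<tau> - [:poly \<tau> b:] = [:- b, 1:] * s" by (elim dvdE)
        from arg_cong[OF this, of "\<lambda>p. poly p w"]
        have "poly \<tau> w - poly \<tau> b = (w - b) * poly s w" by (simp add: algebra_simps)
        then show ?thesis by simp
      qed
      then have "q dvd poly \<tau> w - poly \<tau> b" using qb(1) dvd_trans by blast
      then have "q dvd poly \<tau> b" using q(3) by (metis dvd_diff_right_iff)
      then have "q \<in> prime_factors (poly \<tau> b)"
        using q(1) tau_nonzero_right[OF mset_subset_eqD[OF B b(1)]] by (auto simp: in_prime_factors_iff)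
      then show False using K[OF b(1)] qb by auto
    qed
  qed
  ultimately show ?thesis unfolding E_def by (simp add: coprime_dvd_mult_left_iff)
qed

text \<open>The product consists of primes in \<open>K' - K\<close> and divides H, so it divides the
  part of H that becomes known when K grows to K'. The unknown part of H therefore shrinks by at
  least this product.\<close>

lemma new_part_le:
  assumes w: "w \<in># Mx" and B: "B \<subseteq># My"
    and K: "\<And>b. b \<in># B \<Longrightarrow> prime_factors (poly \<tau> b) \<subseteq> K"
    and K': "K \<subseteq> K'" "\<And>b. b \<in># B \<Longrightarrow> prime_factors (w - b) \<subseteq> K'"
  shows "prime_part (- K') H * (\<Prod>b\<in>#B. prime_part (- K) (w - b)) \<le> prime_part (- K) H"
proof -
  define E where "E = (\<Prod>b\<in>#B. prime_part (- K) (w - b))"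
  have pf: "prime_factors E \<subseteq> K' - K"
  proof
    fix q assume "q \<in> prime_factors E"
    then have q: "prime q" "q dvd E" by (auto simp: in_prime_factors_iff)
    then obtain b where b: "b \<in># B" "q dvd prime_part (- K) (w - b)"
      unfolding E_def by (auto simp: prime_dvd_prod_mset_iff)
    then have "q \<in> prime_factors (prime_part (- K) (w - b))" using q(1) by (auto simp: in_prime_factors_iff)
    then show "q \<in> K' - K" using K'(2)[OF b(1)] by (auto simp: prime_factors_prime_part)
  qed
  have "E dvd prime_part (K' - K) H"
    using dvd_prime_part[OF new_part_dvd[OF w B K] H0] pf by (simp add: E_def)
  then have "E \<le> prime_part (K' - K) H" by (simp add: zdvd_imp_le)
  then have "prime_part (- K') H * E \<le> prime_part (- K') H * prime_part (K' - K) H"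
    by (simp add: less_imp_le)
  moreover have "prime_part (- K) H = prime_part (- K') H * prime_part (K' - K) H"
  proof -
    have "- K = - K' \<union> (K' - K)" using K'(1) by auto
    then show ?thesis using prime_part_Un[of "- K'" "K' - K" H] by auto
  qed
  ultimately show ?thesis by (simp add: E_def)
qed

end

text \<open>The primes in \<open>pair_primes A us\<close> are known once \<open>us\<close> is. Among the primes of \<open>x - a\<close> outside \<open>Q\<close>, those that are
  known (the hit part) confine \<open>x\<close> to a residue class; the cost of \<open>x\<close> is what remains to be paid.\<close>

definition pair_primes :: "int set \<Rightarrow> int list \<Rightarrow> int set" where
  "pair_primes A us = (\<Union>u\<in>set us. \<Union>a\<in>A. prime_factors (u - a))"

definition hit_log :: "int set \<Rightarrow> int set \<Rightarrow> int list \<Rightarrow> int \<Rightarrow> real" where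
  "hit_log A Q us x = (\<Sum>a\<in>A. ln (prime_part (pair_primes A us - Q) (x - a)))"

definition free_log :: "int set \<Rightarrow> int set \<Rightarrow> int \<Rightarrow> real" where
  "free_log A Q x = (\<Sum>a\<in>A. ln (prime_part (- Q) (x - a)))"

text \<open>The smooth parts fix x modulo (Q-part of x - a) * P, where P is the product of the hit
  parts. The quotient is |x - a| divided by this modulus, roughly the number of members of the class
  between a and x. The cheapest base point may be used, whence the minimum; a cost is never below
  1.\<close>

definition crt_cost :: "int set \<Rightarrow> int set \<Rightarrow> int list \<Rightarrow> int \<Rightarrow> real" where
  "crt_cost A Q us x = Min ((\<lambda>a. max 1 (real_of_int (prime_part (- Q) (x - a)) /
       (\<Prod>c\<in>A. real_of_int (prime_part (pair_primes A us - Q) (x - c))))) ` A)"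

lemma ln_prime_part_nonneg [simp]: "0 \<le> ln (real_of_int (prime_part Q m))"
  using prime_part_ge_1[of Q m] by (intro ln_ge_zero) linarith

lemma hit_log_nonneg: "0 \<le> hit_log A Q us x"
  unfolding hit_log_def by (intro sum_nonneg) simp

lemma hit_free_eq:
  "free_log A Q x = hit_log A Q us x + (\<Sum>a\<in>A. ln (prime_part (- (Q \<union> pair_primes A us)) (x - a)))"
proof -
  have "prime_part (- Q) m = prime_part (pair_primes A us - Q) m * prime_part (- (Q \<union> pair_primes A us)) m" for m
  proof -
    have "- Q = (pair_primes A us - Q) \<union> (- (Q \<union> pair_primes A us))" by auto
    then show ?thesis
      using prime_part_Un[of "pair_primes A us - Q" "- (Q \<union> pair_primes A us)" m] by auto
  qed
  then show ?thesis
    unfolding free_log_def hit_log_def sum.distrib[symmetric]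
    by (intro sum.cong refl) (simp add: ln_mult_pos)
qed

lemma hit_le_free: "hit_log A Q us x \<le> free_log A Q x"
  unfolding hit_free_eq[of A Q x us] by (simp add: sum_nonneg)

lemma crt_cost_ge_1: "finite A \<Longrightarrow> A \<noteq> {} \<Longrightarrow> crt_cost A Q us x \<ge> 1"
  by (simp add: crt_cost_def)

text \<open>A cost above 1 is bounded by the quotient for every a, so ln cost + hit is at most the
  logarithm of each Q-free part. One a gives the bound ln X, summation over A gives the other. For
  cost 1 neither follows, which is the origin of the alternative in
  \<open>cost_profile\<close>.\<close>

lemma crt_cost_cases:
  assumes A: "finite A" "A \<noteq> {}" and X: "\<And>a. a \<in> A \<Longrightarrow> x \<noteq> a \<and> real_of_int \<bar>x - a\<bar> \<le> X"
  shows "crt_cost A Q us x = 1 \<or>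
     (ln (crt_cost A Q us x) + hit_log A Q us x \<le> ln X \<and>
      card A * (ln (crt_cost A Q us x) + hit_log A Q us x) \<le> free_log A Q x)"
proof -
  define P where "P = (\<Prod>c\<in>A. real_of_int (prime_part (pair_primes A us - Q) (x - c)))"
  define f where "f = (\<lambda>a. max 1 (real_of_int (prime_part (- Q) (x - a)) / P))"
  have P: "P > 0" unfolding P_def by (intro prod_pos) auto
  have lnP: "ln P = hit_log A Q us x" unfolding P_def hit_log_def using A by (intro ln_prod) auto
  have c: "crt_cost A Q us x = Min (f ` A)" by (simp add: crt_cost_def f_def P_def)
  have le: "crt_cost A Q us x \<le> f a" if "a \<in> A" for a unfolding c using A that by simp
  show ?thesis
  proof (cases "crt_cost A Q us x = 1")
    case False
    then have c1: "crt_cost A Q us x > 1" using crt_cost_ge_1[OF A, of Q us x] by simp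
    have b: "ln (crt_cost A Q us x) + hit_log A Q us x \<le> ln (prime_part (- Q) (x - a))" if "a \<in> A" for a
    proof -
      have "crt_cost A Q us x \<le> real_of_int (prime_part (- Q) (x - a)) / P"
        using le[OF that] c1 by (simp add: f_def split: if_splits)
      then have "ln (crt_cost A Q us x) \<le> ln (real_of_int (prime_part (- Q) (x - a)) / P)"
        using c1 by (subst ln_le_cancel_iff) auto
      also have "\<dots> = ln (prime_part (- Q) (x - a)) - ln P"
        using P by (simp add: ln_div)
      finally show ?thesis using lnP by simp
    qed
    obtain a where a: "a \<in> A" using A by auto
    have "ln (real_of_int (prime_part (- Q) (x - a))) \<le> ln X"
    proof -
      have "real_of_int (prime_part (- Q) (x - a)) \<le> real_of_int \<bar>x - a\<bar>"
        using prime_part_le[of "x - a" "- Q"] X[OF a] by linarith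
      then have "real_of_int (prime_part (- Q) (x - a)) \<le> X" using X[OF a] by linarith
      then show ?thesis by (subst ln_le_cancel_iff) (auto intro: less_le_trans[OF _ \<open>_ \<le> X\<close>])
    qed
    moreover have "card A * (ln (crt_cost A Q us x) + hit_log A Q us x) \<le> free_log A Q x"
      unfolding free_log_def using sum_mono[of A "\<lambda>_. ln (crt_cost A Q us x) + hit_log A Q us x"
          "\<lambda>a. ln (prime_part (- Q) (x - a))"] b by simp
    ultimately show ?thesis using b[OF a] by auto
  qed simp
qed

lemma free_log_le:
  assumes X: "\<And>a. a \<in> A \<Longrightarrow> x \<noteq> a \<and> real_of_int \<bar>x - a\<bar> \<le> X"
  shows "free_log A Q x \<le> card A * ln X"
proof -
  have "ln (real_of_int (prime_part (- Q) (x - a))) \<le> ln X" if a: "a \<in> A" for a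
  proof -
    have "real_of_int (prime_part (- Q) (x - a)) \<le> real_of_int \<bar>x - a\<bar>"
      using prime_part_le[of "x - a" "- Q"] X[OF a] by linarith
    then have "real_of_int (prime_part (- Q) (x - a)) \<le> X" using X[OF a] by linarith
    then show ?thesis by (subst ln_le_cancel_iff) (auto intro: less_le_trans[OF _ \<open>_ \<le> X\<close>])
  qed
  then have "free_log A Q x \<le> (\<Sum>a\<in>A. ln X)" unfolding free_log_def by (rule sum_mono)
  then show ?thesis by simp
qed

lemma prod_mset_pos_real: "(\<And>x. x \<in># M \<Longrightarrow> f x > (0::real)) \<Longrightarrow> (\<Prod>x\<in>#M. f x) > 0"
  by (induction M) auto

lemma ln_prod_mset:
  "(\<And>x. x \<in># M \<Longrightarrow> f x > (0::real)) \<Longrightarrow> ln (\<Prod>x\<in>#M. f x) = (\<Sum>x\<in>#M. ln (f x))"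
proof (induction M)
  case (add x M)
  then have "(\<Prod>x\<in>#M. f x) > 0" by (intro prod_mset_pos_real) auto
  then show ?case using add by (simp add: ln_mult_pos)
qed simp

lemma of_int_prod_mset: "real_of_int (\<Prod>x\<in>#M. f x) = (\<Prod>x\<in>#M. real_of_int (f x))"
  by (induction M) auto

context split_system
begin

context
  fixes A Q :: "int set"
  assumes A: "finite A" "A \<noteq> {}" "A \<subseteq> set_mset My"
    and tauQ: "\<And>a. a \<in> A \<Longrightarrow> prime_factors (poly \<tau> a) \<subseteq> Q"
begin

definition known_log :: "int list \<Rightarrow> real" where
  "known_log us = ln (prime_part (pair_primes A us - Q) H)"

text \<open>For a base point a the product of a - x over all x is H \<tau>(a), and \<tau>(a) has no
  primes outside Q. So the known parts seen from a multiply to the known part of H, and summing over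
  A gives card A times \<open>known_log\<close>. The listed u, whose Q-free parts are known
  entirely, are subtracted; what remains is shared by the points still to come.\<close>

lemma hit_log_sum:
  assumes V: "mset us + V = Mx"
  shows "(\<Sum>x\<in>#V. hit_log A Q us x) = card A * known_log us - (\<Sum>u\<leftarrow>us. free_log A Q u)"
proof -
  define P where "P = pair_primes A us - Q"
  have nz: "x - a \<noteq> 0" if "x \<in># Mx" "a \<in> A" for x a using that A disj by auto
  have col: "(\<Sum>x\<in>#Mx. ln (prime_part P (x - a))) = known_log us" if a: "a \<in> A" for a
  proof -
    have aM: "a \<in># My" using a A by auto
    have pm: "prime_part P (x - a) = prime_part P (a - x)" for x
      unfolding prime_part_def
      by (intro arg_cong[where f = "\<lambda>M. prod_mset (filter_mset (\<lambda>p. p \<in> P) M)"] prime_factorization_cong)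
        (simp add: abs_minus_commute)
    have "(\<Sum>x\<in>#Mx. ln (real_of_int (prime_part P (x - a)))) = ln (real_of_int (\<Prod>x\<in>#Mx. prime_part P (a - x)))"
      by (simp add: of_int_prod_mset ln_prod_mset pm)
    also have "(\<Prod>x\<in>#Mx. prime_part P (a - x)) = prime_part P (\<Prod>x\<in>#Mx. a - x)"
      by (rule prime_part_prod_mset[symmetric]) (use nz a in force)
    also have "\<dots> = prime_part P H * prime_part P (poly \<tau> a)"
      unfolding value_right[OF aM] using H0 tau_nonzero_right[OF aM] by (rule prime_part_mult)
    also have "prime_part P (poly \<tau> a) = 1"
      using tauQ[OF a] by (intro prime_part_eq_1) (auto simp: P_def)
    finally show ?thesis by (simp add: known_log_def P_def)
  qed
  have own: "hit_log A Q us u = free_log A Q u" if u: "u \<in> set us" for u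
    unfolding hit_log_def free_log_def
  proof (intro sum.cong refl arg_cong[where f = ln] arg_cong[where f = real_of_int] prime_part_cong)
    fix a p assume "a \<in> A" "p \<in> prime_factors (u - a)"
    then show "(p \<in> pair_primes A us - Q) = (p \<in> - Q)" using u by (auto simp: pair_primes_def)
  qed
  have "(\<Sum>x\<in>#Mx. hit_log A Q us x) = (\<Sum>a\<in>A. \<Sum>x\<in>#Mx. ln (prime_part P (x - a)))"
    unfolding hit_log_def P_def by (induction Mx) (simp_all add: sum.distrib)
  also have "\<dots> = card A * known_log us" using col by simp
  finally have "(\<Sum>x\<in>#Mx. hit_log A Q us x) = card A * known_log us" .
  moreover have "(\<Sum>x\<in>#Mx. hit_log A Q us x) = (\<Sum>u\<leftarrow>us. hit_log A Q us u) + (\<Sum>x\<in>#V. hit_log A Q us x)"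
    unfolding V[symmetric] by (simp add: sum_mset_sum_list[symmetric])
  moreover have "(\<Sum>u\<leftarrow>us. hit_log A Q us u) = (\<Sum>u\<leftarrow>us. free_log A Q u)"
    using own by (intro arg_cong[where f = sum_list] map_cong) auto
  ultimately show ?thesis by simp
qed

text \<open>The primes of the x - a that were unknown before divide H with full multiplicity
  (\<open>new_part_le\<close>), so they are added to the known part.\<close>

lemma known_log_step:
  assumes x: "x \<in># Mx"
  shows "known_log (us @ [x]) \<ge> known_log us + (free_log A Q x - hit_log A Q us x)"
proof -
  define K where "K = Q \<union> pair_primes A us"
  define K' where "K' = Q \<union> pair_primes A (us @ [x])"
  define E where "E = (\<Prod>b\<in>#mset_set A. prime_part (- K) (x - b))"
  have "prime_part (- K') H * E \<le> prime_part (- K) H"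
    unfolding E_def
  proof (rule new_part_le[OF x])
    have "mset_set A \<subseteq># mset_set (set_mset My)" using A by (intro subset_imp_msubset_mset_set) auto
    also have "\<dots> \<subseteq># My" by (rule mset_set_set_mset_msubset)
    finally show "mset_set A \<subseteq># My" .
  qed (use A tauQ in \<open>auto simp: K_def K'_def pair_primes_def\<close>)
  then have "real_of_int (prime_part (- K') H * E) \<le> real_of_int (prime_part (- K) H)" by (simp only: of_int_le_iff)
  moreover have Epos: "E > 0" unfolding E_def by (rule prod_mset_pos_int) auto
  ultimately have "ln (real_of_int (prime_part (- K') H * E)) \<le> ln (real_of_int (prime_part (- K) H))"
    by (subst ln_le_cancel_iff) (auto simp: )
  then have 1: "ln (real_of_int (prime_part (- K') H)) + ln (real_of_int E) \<le> ln (real_of_int (prime_part (- K) H))"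
    using Epos by (simp add: ln_mult_pos)
  have lnE: "ln (real_of_int E) = free_log A Q x - hit_log A Q us x"
  proof -
    have "ln (real_of_int E) = (\<Sum>b\<in>#mset_set A. ln (prime_part (- K) (x - b)))"
      unfolding E_def of_int_prod_mset by (rule ln_prod_mset) auto
    also have "\<dots> = (\<Sum>b\<in>A. ln (prime_part (- K) (x - b)))" by (simp add: sum_unfold_sum_mset)
    finally show ?thesis unfolding hit_free_eq[of A Q x us] by (simp add: K_def)
  qed
  have sp: "ln (real_of_int (prime_part (- Q) H)) = known_log vs + ln (real_of_int (prime_part (- (Q \<union> pair_primes A vs)) H))" for vs
  proof -
    have "- Q = (pair_primes A vs - Q) \<union> (- (Q \<union> pair_primes A vs))" by auto
    moreover have "prime_part ((pair_primes A vs - Q) \<union> (- (Q \<union> pair_primes A vs))) H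
       = prime_part (pair_primes A vs - Q) H * prime_part (- (Q \<union> pair_primes A vs)) H"
      by (rule prime_part_Un) auto
    ultimately have "prime_part (- Q) H = prime_part (pair_primes A vs - Q) H * prime_part (- (Q \<union> pair_primes A vs)) H"
      by simp
    then show ?thesis by (simp add: known_log_def ln_mult_pos)
  qed
  show ?thesis using 1 lnE sp[of us] sp[of "us @ [x]"] by (simp add: K_def K'_def)
qed

lemma known_log_rest:
  "ln (real_of_int (prime_part (- Q) H)) = known_log vs + ln (real_of_int (prime_part (- (Q \<union> pair_primes A vs)) H))"
proof -
  have "- Q = (pair_primes A vs - Q) \<union> (- (Q \<union> pair_primes A vs))" by auto
  moreover have "prime_part ((pair_primes A vs - Q) \<union> (- (Q \<union> pair_primes A vs))) H
     = prime_part (pair_primes A vs - Q) H * prime_part (- (Q \<union> pair_primes A vs)) H"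
    by (rule prime_part_Un) auto
  ultimately have "prime_part (- Q) H = prime_part (pair_primes A vs - Q) H * prime_part (- (Q \<union> pair_primes A vs)) H"
    by simp
  then show ?thesis by (simp add: known_log_def ln_mult_pos)
qed

text \<open>Taking next a point with the largest hit part makes it at least the average.\<close>

lemma exists_greedy_prefix:
  assumes "n \<le> size Mx"
  shows "\<exists>us V. length us = n \<and> mset us + V = Mx \<and>
    (\<forall>t<n. real (size Mx - t) * hit_log A Q (take t us) (us ! t)
       \<ge> card A * known_log (take t us) - (\<Sum>u\<leftarrow>take t us. free_log A Q u))"
  using assms
proof (induction n)
  case 0
  show ?case by (intro exI[of _ "[]"] exI[of _ Mx]) auto
next
  case (Suc n)
  then obtain us V where us: "length us = n" "mset us + V = Mx"
    and pr: "\<forall>t<n. real (size Mx - t) * hit_log A Q (take t us) (us ! t)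
       \<ge> card A * known_log (take t us) - (\<Sum>u\<leftarrow>take t us. free_log A Q u)" by auto
  have sz: "size V = size Mx - n" using us by (metis add_diff_cancel_left' size_mset size_union)
  then have "V \<noteq> {#}" using Suc.prems by auto
  define s where "s = Max (hit_log A Q us ` set_mset V)"
  have fin: "finite (hit_log A Q us ` set_mset V)" "hit_log A Q us ` set_mset V \<noteq> {}" using \<open>V \<noteq> {#}\<close> by auto
  have "s \<in> hit_log A Q us ` set_mset V" unfolding s_def using fin by (rule Max_in)
  then obtain x where x: "x \<in># V" "hit_log A Q us x = s" by auto
  have "(\<Sum>x\<in>#V. hit_log A Q us x) \<le> (\<Sum>x\<in>#V. s)"
    unfolding s_def using fin by (intro sum_mset_mono) auto
  then have avg: "card A * known_log us - (\<Sum>u\<leftarrow>us. free_log A Q u) \<le> real (size Mx - n) * s"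
    using hit_log_sum[OF us(2)] sz by simp
  show ?case
  proof (intro exI[of _ "us @ [x]"] exI[of _ "V - {#x#}"] conjI allI impI)
    have "mset (us @ [x]) + (V - {#x#}) = mset us + add_mset x (V - {#x#})" by simp
    also have "add_mset x (V - {#x#}) = V" using x(1) by simp
    finally show "mset (us @ [x]) + (V - {#x#}) = Mx" using us by simp
    fix t assume "t < Suc n"
    then show "real (size Mx - t) * hit_log A Q (take t (us @ [x])) ((us @ [x]) ! t)
       \<ge> card A * known_log (take t (us @ [x])) - (\<Sum>u\<leftarrow>take t (us @ [x]). free_log A Q u)"
      using pr avg us x by (cases "t = n") (auto simp: nth_append)
  qed (use us in auto)
qed

end

end

section \<open>The cost of the remaining y\<close>

lemma prime_part_minus [simp]: "prime_part Q (- m) = prime_part Q m"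
  unfolding prime_part_def
  by (intro arg_cong[where f = "\<lambda>M. prod_mset (filter_mset (\<lambda>p. p \<in> Q) M)"] prime_factorization_cong) simp

text \<open>The counterpart of \<open>crt_cost\<close> for a y seen from the listed x. There is no
  hit part to divide by: y is located by the K-part of a single difference y - u, and the rest of
  that difference is the cost.\<close>

definition row_cost :: "int set \<Rightarrow> int list \<Rightarrow> int \<Rightarrow> real" where
  "row_cost K us y = Min ((\<lambda>u. real_of_int (prime_part (- K) (y - u))) ` set us)"

lemma row_cost_ge_1: "us \<noteq> [] \<Longrightarrow> row_cost K us y \<ge> 1"
  using prime_part_ge_1 by (auto simp: row_cost_def)

context split_system
begin

text \<open>Each y is charged the least of \<open>length us\<close> unknown parts, hence at most the
  average of their logarithms. By \<open>new_part_le\<close> for the swapped system the sum of these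
  logarithms is at most the drop of the unknown part of H. The drops telescope, so the total does
  not depend on the number of y.\<close>

lemma row_cost_sum_le:
  assumes us: "mset us \<subseteq># Mx" "us \<noteq> []" and ws: "mset ws \<subseteq># My"
    and K: "\<And>u. u \<in> set us \<Longrightarrow> prime_factors (poly \<tau> u) \<subseteq> K"
  shows "(\<Sum>t<length ws. ln (row_cost (K \<union> pair_primes (set us) (take t ws)) us (ws ! t)))
      \<le> ln (prime_part (- K) H) / length us"
proof -
  define b where "b = length us"
  have b: "b > 0" using us by (simp add: b_def)
  define Kt where "Kt = (\<lambda>t. K \<union> pair_primes (set us) (take t ws))"
  define h where "h = (\<lambda>t. ln (real_of_int (prime_part (- Kt t) H)))"
  have step: "ln (row_cost (Kt t) us (ws ! t)) \<le> (h t - h (Suc t)) / b" if t: "t < length ws" for t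
  proof -
    have y: "ws ! t \<in># My" using t ws by (metis mset_subset_eqD nth_mem_mset)
    define E where "E = (\<Prod>u\<in>#mset us. prime_part (- Kt t) (ws ! t - u))"
    have "prime_part (- Kt (Suc t)) (- H) * E \<le> prime_part (- Kt t) (- H)"
      unfolding E_def
    proof (rule split_system.new_part_le[OF swap y us(1)])
      show "Kt t \<subseteq> Kt (Suc t)" using t by (auto simp: Kt_def pair_primes_def take_Suc_conv_app_nth)
      show "prime_factors (ws ! t - b) \<subseteq> Kt (Suc t)" if "b \<in># mset us" for b
        using that t by (auto simp: Kt_def pair_primes_def take_Suc_conv_app_nth)
      show "prime_factors (poly \<tau> b) \<subseteq> Kt t" if "b \<in># mset us" for b
        using K that by (auto simp: Kt_def)
    qed
    then have le: "real_of_int (prime_part (- Kt (Suc t)) H * E) \<le> real_of_int (prime_part (- Kt t) H)"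
      by (simp only: prime_part_minus of_int_le_iff)
    have Epos: "E > 0" unfolding E_def by (rule prod_mset_pos_int) auto
    then have "ln (real_of_int (prime_part (- Kt (Suc t)) H * E)) \<le> h t"
      unfolding h_def using le by (subst ln_le_cancel_iff) auto
    then have 1: "h (Suc t) + ln (real_of_int E) \<le> h t" using Epos by (simp add: h_def ln_mult_pos)
    have c1: "row_cost (Kt t) us (ws ! t) > 0" using row_cost_ge_1[OF us(2), of "Kt t" "ws ! t"] by linarith
    have "real b * ln (row_cost (Kt t) us (ws ! t)) = (\<Sum>u\<in>#mset us. ln (row_cost (Kt t) us (ws ! t)))"
      by (simp add: b_def)
    also have "\<dots> \<le> (\<Sum>u\<in>#mset us. ln (real_of_int (prime_part (- Kt t) (ws ! t - u))))"
    proof (rule sum_mset_mono)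
      fix u assume "u \<in># mset us"
      then have "row_cost (Kt t) us (ws ! t) \<le> real_of_int (prime_part (- Kt t) (ws ! t - u))"
        unfolding row_cost_def by (intro Min_le) auto
      then show "ln (row_cost (Kt t) us (ws ! t)) \<le> ln (real_of_int (prime_part (- Kt t) (ws ! t - u)))"
        using c1 by (subst ln_le_cancel_iff) auto
    qed
    also have "\<dots> = ln (real_of_int E)"
      unfolding E_def of_int_prod_mset by (rule ln_prod_mset[symmetric]) auto
    finally show ?thesis using 1 b by (simp add: field_simps)
  qed
  have "(\<Sum>t<length ws. ln (row_cost (Kt t) us (ws ! t))) \<le> (\<Sum>t<length ws. (h t - h (Suc t)) / b)"
    using step by (intro sum_mono) auto
  also have "\<dots> = (h 0 - h (length ws)) / b"
    by (simp add: sum_divide_distrib[symmetric] sum_lessThan_telescope')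
  also have "\<dots> \<le> h 0 / b" using b by (intro divide_right_mono) (auto simp: h_def)
  finally show ?thesis by (simp add: h_def Kt_def b_def pair_primes_def)
qed

end

section \<open>The sum of the weights over one entry\<close>

lemma inverse_Min_le:
  fixes f :: "'a \<Rightarrow> real"
  assumes "finite A" "A \<noteq> {}" "\<And>a. a \<in> A \<Longrightarrow> f a > 0"
  shows "1 / Min (f ` A) \<le> (\<Sum>a\<in>A. 1 / f a)"
proof -
  have "Min (f ` A) \<in> f ` A" using assms by (intro Min_in) auto
  then obtain a where a: "a \<in> A" "Min (f ` A) = f a" by auto
  have "1 / f a \<le> (\<Sum>a\<in>A. 1 / f a)"
    using assms a by (intro member_le_sum) (auto intro: less_imp_le)
  then show ?thesis using a by simp
qed

lemma sum_inverse_crt_cost_le: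
  assumes A: "finite A" "A \<noteq> {}" "A \<subseteq> {1..int N}"
    and diff: "\<And>a b. a \<in> A \<Longrightarrow> b \<in> A \<Longrightarrow> a \<noteq> b \<Longrightarrow> prime_factors (a - b) \<subseteq> Q"
  shows "(\<Sum>p\<in>{1..int N} - A. 1 / crt_cost A Q us p)
     \<le> card A * (real (card (smooth_ints (Q \<union> pair_primes A us) N)) ^ (card A + 1) * (2 * (1 + harm N)))"
proof -
  define K where "K = Q \<union> pair_primes A us"
  have KQ: "pair_primes A us - Q = K - Q" by (auto simp: K_def)
  have "(\<Sum>p\<in>{1..int N} - A. 1 / crt_cost A Q us p)
     \<le> (\<Sum>p\<in>{1..int N} - A. \<Sum>a\<in>A. 1 / max 1 (real_of_int (prime_part (- Q) (p - a)) /
       (\<Prod>c\<in>A. real_of_int (prime_part (K - Q) (p - c)))))"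
    unfolding crt_cost_def KQ using A by (intro sum_mono inverse_Min_le) auto
  also have "\<dots> = (\<Sum>a\<in>A. \<Sum>p\<in>{1..int N} - A. 1 / max 1 (real_of_int (prime_part (- Q) (p - a)) /
       (\<Prod>c\<in>A. real_of_int (prime_part (K - Q) (p - c)))))"
    by (rule sum.swap)
  also have "\<dots> \<le> (\<Sum>a\<in>A. real (card (smooth_ints K N)) ^ (card A + 1) * (2 * (1 + harm N)))"
    using A diff by (intro sum_mono sum_crt_cost_le) (auto simp: K_def)
  finally show ?thesis by (simp add: K_def)
qed

lemma sum_inverse_row_cost_le:
  assumes us: "us \<noteq> []" "set us \<subseteq> {1..int N}"
  shows "(\<Sum>p\<in>{1..int N} - set us. 1 / row_cost K us p)
     \<le> length us * (real (card (smooth_ints K N)) ^ 2 * (2 * (1 + harm N)))"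
proof -
  define h where "h = (\<lambda>u p. 1 / real_of_int (prime_part (- K) (p - u)))"
  have one: "(\<Sum>p\<in>{1..int N} - set us. h u p) \<le> real (card (smooth_ints K N)) ^ 2 * (2 * (1 + harm N))"
    if u: "u \<in> set us" for u
  proof -
    have mx: "max 1 (real_of_int (prime_part (- K) m)) = real_of_int (prime_part (- K) m)" for m
      using prime_part_ge_1[of "- K" m] by (simp add: max_def)
    have e: "prime_part {} m = 1" for m by (simp add: prime_part_def)
    have "(\<Sum>p\<in>{1..int N} - set us. h u p) \<le> (\<Sum>p\<in>{1..int N} - {u}. h u p)"
      using u by (intro sum_mono2) (auto simp: h_def less_imp_le)
    also have "\<dots> \<le> real (card (smooth_ints K N)) ^ (card {u} + 1) * (2 * (1 + harm N))"
      using sum_crt_cost_le[of "{u}" u N K K] us u by (auto simp: h_def mx e)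
    finally show ?thesis by (simp add: power2_eq_square)
  qed
  have "(\<Sum>p\<in>{1..int N} - set us. 1 / row_cost K us p) \<le> (\<Sum>p\<in>{1..int N} - set us. \<Sum>u\<in>set us. h u p)"
    unfolding row_cost_def h_def using us by (intro sum_mono inverse_Min_le) auto
  also have "\<dots> = (\<Sum>u\<in>set us. \<Sum>p\<in>{1..int N} - set us. h u p)" by (rule sum.swap)
  also have "\<dots> \<le> (\<Sum>u\<in>set us. real (card (smooth_ints K N)) ^ 2 * (2 * (1 + harm N)))"
    by (intro sum_mono one)
  also have "\<dots> = card (set us) * (real (card (smooth_ints K N)) ^ 2 * (2 * (1 + harm N)))" by simp
  also have "\<dots> \<le> length us * (real (card (smooth_ints K N)) ^ 2 * (2 * (1 + harm N)))"
    using card_length[of us] harm_nonneg[of N, where ?'a = real] by (intro mult_right_mono) auto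
  finally show ?thesis .
qed

lemma harm_le_powr:
  assumes "\<epsilon> > 0"
  obtains C where "C > 0" "\<And>N. N \<ge> 1 \<Longrightarrow> 2 * (1 + harm N) \<le> C * real N powr \<epsilon>"
proof -
  define C where "C = 4 + 2 / \<epsilon>"
  have C: "C > 0" using assms by (auto simp: C_def intro: add_pos_pos)
  have "2 * (1 + harm N) \<le> C * real N powr \<epsilon>" if N: "N \<ge> 1" for N
  proof -
    have "harm N \<le> ln (real N) + 1"
    proof -
      have "harm (Suc n) \<le> ln (real (Suc n)) + 1" for n
      proof (induction n)
        case (Suc n)
        have "ln (real (Suc n) / real (Suc (Suc n))) \<le> real (Suc n) / real (Suc (Suc n)) - 1"
          by (intro ln_le_minus_one) simp
        then have "inverse (real (Suc (Suc n))) \<le> ln (real (Suc (Suc n))) - ln (real (Suc n))"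
          by (simp add: ln_div field_simps)
        then show ?case using Suc by (simp add: harm_Suc[of "Suc n"])
      qed (simp add: harm_expand)
      from this[of "N - 1"] show ?thesis using N by simp
    qed
    moreover have "ln (real N) \<le> real N powr \<epsilon> / \<epsilon>"
      using ln_powr_bound[of "real N" \<epsilon>] N assms by simp
    moreover have "real N powr \<epsilon> \<ge> 1" using N assms by (intro ge_one_powr_ge_zero) auto
    ultimately show ?thesis by (simp add: C_def algebra_simps)
  qed
  then show ?thesis using that C by blast
qed

text \<open>Presents the known primes as the prime divisors of a single nonzero integer, the form in
  which \<open>card_smooth_ints_le\<close> applies.\<close>

lemma prime_factors_pair_primes:
  assumes "finite A" "D \<noteq> 0" "\<And>u a. u \<in> set us \<Longrightarrow> a \<in> A \<Longrightarrow> u \<noteq> a"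
  shows "prime_factors D \<union> pair_primes A us = prime_factors (D * (\<Prod>u\<leftarrow>us. \<Prod>a\<in>A. u - a))"
    and "D * (\<Prod>u\<leftarrow>us. \<Prod>a\<in>A. u - a) \<noteq> 0"
proof -
  have A: "prime_factors (\<Prod>a\<in>A. u - a) = (\<Union>a\<in>A. prime_factors (u - a)) \<and> (\<Prod>a\<in>A. u - a) \<noteq> 0"
    if "\<And>a. a \<in> A \<Longrightarrow> u \<noteq> a" for u
    using assms(1) that by (induction A rule: finite_induct) (auto simp: prime_factors_product)
  have "prime_factors (\<Prod>u\<leftarrow>us. \<Prod>a\<in>A. u - a) = pair_primes A us \<and> (\<Prod>u\<leftarrow>us. \<Prod>a\<in>A. u - a) \<noteq> 0"
    using assms(3)
  proof (induction us)
    case (Cons u us)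
    then show ?case using A[of u] by (auto simp: prime_factors_product pair_primes_def)
  qed (simp add: pair_primes_def)
  then show "prime_factors D \<union> pair_primes A us = prime_factors (D * (\<Prod>u\<leftarrow>us. \<Prod>a\<in>A. u - a))"
    and "D * (\<Prod>u\<leftarrow>us. \<Prod>a\<in>A. u - a) \<noteq> 0"
    using assms(2) by (auto simp: prime_factors_product)
qed

lemma abs_pair_prod_le:
  assumes "finite A" "A \<subseteq> {1..int N}" "set us \<subseteq> {1..int N}" "N \<ge> 1"
  shows "\<bar>\<Prod>u\<leftarrow>us. \<Prod>a\<in>A. u - a\<bar> \<le> int N ^ (card A * length us)"
  using assms(3)
proof (induction us)
  case (Cons u us)
  have "\<bar>\<Prod>a\<in>A. u - a\<bar> = (\<Prod>a\<in>A. \<bar>u - a\<bar>)" by (rule abs_prod)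
  also have "\<dots> \<le> (\<Prod>a\<in>A. int N)"
  proof (rule prod_mono)
    fix a assume "a \<in> A"
    then have "1 \<le> a" "a \<le> int N" "1 \<le> u" "u \<le> int N" using assms Cons.prems by auto
    then show "0 \<le> \<bar>u - a\<bar> \<and> \<bar>u - a\<bar> \<le> int N" by linarith
  qed
  finally have 1: "\<bar>\<Prod>a\<in>A. u - a\<bar> \<le> int N ^ card A" by simp
  have "\<bar>\<Prod>a\<in>A. u - a\<bar> * \<bar>\<Prod>u\<leftarrow>us. \<Prod>a\<in>A. u - a\<bar> \<le> int N ^ card A * int N ^ (card A * length us)"
    using 1 Cons by (intro mult_mono) auto
  then show ?case by (simp add: abs_mult power_add)
qed simp

text \<open>The integer whose primes are allowed is at most c N^(2 c) in absolute value, so a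
  \<delta>-th power of it is absorbed by N powr \<epsilon>; together with the factor N powr \<delta>
  this needs (2 c + 1) \<delta> = \<epsilon>. The constant depends on c and \<epsilon> only.\<close>

lemma smooth_pair_bound:
  fixes c :: nat
  assumes "\<epsilon> > 0"
  obtains C where "C \<ge> 1"
    "\<And>N A D us. N \<ge> 1 \<Longrightarrow> finite A \<Longrightarrow> A \<subseteq> {1..int N} \<Longrightarrow> D \<noteq> 0 \<Longrightarrow> real_of_int \<bar>D\<bar> \<le> real c * real N ^ c \<Longrightarrow>
       card A * length us \<le> c \<Longrightarrow> set us \<subseteq> {1..int N} - A \<Longrightarrow>
       real (card (smooth_ints (prime_factors D \<union> pair_primes A us) N)) \<le> C * real N powr \<epsilon>"
proof -
  define \<delta> where "\<delta> = \<epsilon> / (2 * c + 1)"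
  have \<delta>: "\<delta> > 0" using assms by (simp add: \<delta>_def)
  obtain C0 where C0: "C0 > 0" and sm: "\<And>D N. D \<noteq> 0 \<Longrightarrow> N \<ge> 1 \<Longrightarrow>
       real (card (smooth_ints (prime_factors D) N)) \<le> C0 * N powr \<delta> * real_of_int \<bar>D\<bar> powr \<delta>"
    using card_smooth_ints_le[OF \<delta>] by metis
  define C where "C = max 1 (C0 * real c powr \<delta>)"
  have "real (card (smooth_ints (prime_factors D \<union> pair_primes A us) N)) \<le> C * real N powr \<epsilon>"
    if N: "N \<ge> 1" and A: "finite A" "A \<subseteq> {1..int N}" and D: "D \<noteq> 0" "real_of_int \<bar>D\<bar> \<le> real c * real N ^ c"
      and l: "card A * length us \<le> c" and us: "set us \<subseteq> {1..int N} - A" for N A D us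
  proof -
    define E where "E = D * (\<Prod>u\<leftarrow>us. \<Prod>a\<in>A. u - a)"
    have E: "prime_factors D \<union> pair_primes A us = prime_factors E" "E \<noteq> 0"
      unfolding E_def using us by (intro prime_factors_pair_primes[OF A(1) D(1)]; blast)+
    have "\<bar>\<Prod>u\<leftarrow>us. \<Prod>a\<in>A. u - a\<bar> \<le> int N ^ (card A * length us)"
      using us N by (intro abs_pair_prod_le A) auto
    then have "real_of_int \<bar>\<Prod>u\<leftarrow>us. \<Prod>a\<in>A. u - a\<bar> \<le> real N ^ (card A * length us)"
      by (metis of_int_le_iff of_int_of_nat_eq of_int_power)
    also have "\<dots> \<le> real N ^ c" using l N by (intro power_increasing) auto
    finally have "real_of_int \<bar>E\<bar> \<le> (real c * real N ^ c) * real N ^ c"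
      unfolding E_def abs_mult of_int_mult using D by (intro mult_mono) auto
    then have Eb: "real_of_int \<bar>E\<bar> \<le> real c * real N powr (2 * c)"
      using N by (simp add: powr_realpow[symmetric] powr_add[symmetric] mult.assoc flip: mult_2)
    have "real (card (smooth_ints (prime_factors E) N)) \<le> C0 * real N powr \<delta> * real_of_int \<bar>E\<bar> powr \<delta>"
      using sm[OF E(2), of "real N"] N by simp
    also have "\<dots> \<le> C0 * real N powr \<delta> * (real c * real N powr (2 * c)) powr \<delta>"
      using Eb C0 \<delta> by (intro mult_left_mono powr_mono2) auto
    also have "\<dots> = (C0 * real c powr \<delta>) * (real N powr \<delta> * real N powr (2 * c * \<delta>))"
      by (simp add: powr_mult powr_powr mult_ac)
    also have "real N powr \<delta> * real N powr (2 * c * \<delta>) = real N powr \<epsilon>"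
    proof -
      have "1 + 2 * real c \<noteq> 0" by linarith
      then have "\<delta> * (1 + 2 * real c) = \<epsilon>" by (simp add: \<delta>_def add.commute)
      then have "\<delta> + 2 * real c * \<delta> = \<epsilon>" by (simp add: algebra_simps)
      then show ?thesis by (simp add: powr_add[symmetric])
    qed
    also have "(C0 * real c powr \<delta>) * real N powr \<epsilon> \<le> C * real N powr \<epsilon>"
      by (intro mult_right_mono) (auto simp: C_def)
    finally show ?thesis by (simp add: E)
  qed
  then show ?thesis using that[of C] by (simp add: C_def)
qed

lemma crt_step_bound:
  fixes c :: nat
  assumes "\<epsilon> > 0"
  obtains C where "C \<ge> 1"
    "\<And>N A D us. N \<ge> 1 \<Longrightarrow> finite A \<Longrightarrow> A \<noteq> {} \<Longrightarrow> A \<subseteq> {1..int N} \<Longrightarrow> D \<noteq> 0 \<Longrightarrow> real_of_int \<bar>D\<bar> \<le> real c * real N ^ c \<Longrightarrow>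
       card A \<le> c \<Longrightarrow> card A * length us \<le> c \<Longrightarrow> set us \<subseteq> {1..int N} - A \<Longrightarrow>
       (\<And>a b. a \<in> A \<Longrightarrow> b \<in> A \<Longrightarrow> a \<noteq> b \<Longrightarrow> prime_factors (a - b) \<subseteq> prime_factors D) \<Longrightarrow>
       (\<Sum>p\<in>{1..int N} - A. 1 / crt_cost A (prime_factors D) us p) \<le> C * real N powr \<epsilon>"
proof -
  \<comment> \<open>At most c + 1 factors for the smooth parts and one for the harmonic sum.\<close>
  define \<delta> where "\<delta> = \<epsilon> / (c + 2)"
  have \<delta>: "\<delta> > 0" using assms by (simp add: \<delta>_def)
  obtain C1 where C1: "C1 \<ge> 1" and b1: "\<And>N A D us. N \<ge> 1 \<Longrightarrow> finite A \<Longrightarrow> A \<subseteq> {1..int N} \<Longrightarrow> D \<noteq> 0 \<Longrightarrow> real_of_int \<bar>D\<bar> \<le> real c * real N ^ c \<Longrightarrow>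
       card A * length us \<le> c \<Longrightarrow> set us \<subseteq> {1..int N} - A \<Longrightarrow>
       real (card (smooth_ints (prime_factors D \<union> pair_primes A us) N)) \<le> C1 * real N powr \<delta>"
    using smooth_pair_bound[OF \<delta>, of c] by metis
  obtain C2 where C2: "C2 > 0" and b2: "\<And>N. N \<ge> 1 \<Longrightarrow> 2 * (1 + harm N) \<le> C2 * real N powr \<delta>"
    using harm_le_powr[OF \<delta>] by metis
  define C where "C = max 1 (c * (C1 ^ (c + 1) * C2))"
  have "(\<Sum>p\<in>{1..int N} - A. 1 / crt_cost A (prime_factors D) us p) \<le> C * real N powr \<epsilon>"
    if N: "N \<ge> 1" and A: "finite A" "A \<noteq> {}" "A \<subseteq> {1..int N}" and D: "D \<noteq> 0" "real_of_int \<bar>D\<bar> \<le> real c * real N ^ c"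
      and l: "card A \<le> c" "card A * length us \<le> c" and us: "set us \<subseteq> {1..int N} - A"
      and df: "\<And>a b. a \<in> A \<Longrightarrow> b \<in> A \<Longrightarrow> a \<noteq> b \<Longrightarrow> prime_factors (a - b) \<subseteq> prime_factors D" for N A D us
  proof -
    define s where "s = real (card (smooth_ints (prime_factors D \<union> pair_primes A us) N))"
    have N1: "real N powr \<delta> \<ge> 1" using N \<delta> by (intro ge_one_powr_ge_zero) auto
    have s: "0 \<le> s" "s \<le> C1 * real N powr \<delta>" using b1[OF N A(1,3) D l(2) us] by (auto simp: s_def)
    define u where "u = 2 * (1 + harm N :: real)"
    have u: "0 \<le> u" "u \<le> C2 * real N powr \<delta>"
      using b2[OF N] harm_nonneg[of N, where ?'a = real] by (auto simp: u_def)
    have CN: "1 \<le> C1 * real N powr \<delta>" using mult_mono[OF C1 N1] C1 by simp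
    have "(\<Sum>p\<in>{1..int N} - A. 1 / crt_cost A (prime_factors D) us p) \<le> card A * (s ^ (card A + 1) * u)"
      unfolding s_def u_def by (rule sum_inverse_crt_cost_le[OF A df])
    also have "\<dots> \<le> c * ((C1 * real N powr \<delta>) ^ (c + 1) * (C2 * real N powr \<delta>))"
    proof (intro mult_mono)
      have "s ^ (card A + 1) \<le> (C1 * real N powr \<delta>) ^ (card A + 1)" using s by (intro power_mono) auto
      also have "\<dots> \<le> (C1 * real N powr \<delta>) ^ (c + 1)" using CN l by (intro power_increasing) auto
      finally show "s ^ (card A + 1) \<le> (C1 * real N powr \<delta>) ^ (c + 1)" .
    qed (use l s C1 C2 u in auto)
    also have "\<dots> = (c * (C1 ^ (c + 1) * C2)) * (real N powr \<delta>) ^ (c + 2)"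
      by (simp add: power_mult_distrib)
    also have "(real N powr \<delta>) ^ (c + 2) = real N powr \<epsilon>"
    proof -
      have "real c + 2 \<noteq> 0" by linarith
      then have "\<delta> * real (c + 2) = \<epsilon>" by (simp add: \<delta>_def)
      moreover have "(real N powr \<delta>) ^ (c + 2) = real N powr (\<delta> * real (c + 2))"
        using N by (subst powr_realpow[symmetric]) (auto simp: powr_powr)
      ultimately show ?thesis by simp
    qed
    also have "(c * (C1 ^ (c + 1) * C2)) * real N powr \<epsilon> \<le> C * real N powr \<epsilon>"
      by (intro mult_right_mono) (auto simp: C_def)
    finally show ?thesis .
  qed
  then show ?thesis using that[of C] by (simp add: C_def)
qed

lemma row_step_bound:
  fixes c :: nat
  assumes "\<epsilon> > 0"
  obtains C where "C \<ge> 1"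
    "\<And>N D us vs. N \<ge> 1 \<Longrightarrow> us \<noteq> [] \<Longrightarrow> set us \<subseteq> {1..int N} \<Longrightarrow> D \<noteq> 0 \<Longrightarrow> real_of_int \<bar>D\<bar> \<le> real c * real N ^ c \<Longrightarrow>
       length us \<le> c \<Longrightarrow> length us * length vs \<le> c \<Longrightarrow> set vs \<subseteq> {1..int N} - set us \<Longrightarrow>
       (\<Sum>p\<in>{1..int N} - set us. 1 / row_cost (prime_factors D \<union> pair_primes (set us) vs) us p) \<le> C * real N powr \<epsilon>"
proof -
  \<comment> \<open>Two factors for the smooth parts, since a single base point is used, and one for
    the harmonic sum.\<close>
  define \<delta> where "\<delta> = \<epsilon> / 3"
  have \<delta>: "\<delta> > 0" using assms by (simp add: \<delta>_def)
  obtain C1 where C1: "C1 \<ge> 1" and b1: "\<And>N A D us. N \<ge> 1 \<Longrightarrow> finite A \<Longrightarrow> A \<subseteq> {1..int N} \<Longrightarrow> D \<noteq> 0 \<Longrightarrow> real_of_int \<bar>D\<bar> \<le> real c * real N ^ c \<Longrightarrow>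
       card A * length us \<le> c \<Longrightarrow> set us \<subseteq> {1..int N} - A \<Longrightarrow>
       real (card (smooth_ints (prime_factors D \<union> pair_primes A us) N)) \<le> C1 * real N powr \<delta>"
    using smooth_pair_bound[OF \<delta>, of c] by metis
  obtain C2 where C2: "C2 > 0" and b2: "\<And>N. N \<ge> 1 \<Longrightarrow> 2 * (1 + harm N) \<le> C2 * real N powr \<delta>"
    using harm_le_powr[OF \<delta>] by metis
  define C where "C = max 1 (c * (C1 ^ 2 * C2))"
  have "(\<Sum>p\<in>{1..int N} - set us. 1 / row_cost (prime_factors D \<union> pair_primes (set us) vs) us p) \<le> C * real N powr \<epsilon>"
    if N: "N \<ge> 1" and us: "us \<noteq> []" "set us \<subseteq> {1..int N}" and D: "D \<noteq> 0" "real_of_int \<bar>D\<bar> \<le> real c * real N ^ c"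
      and l: "length us \<le> c" "length us * length vs \<le> c" and vs: "set vs \<subseteq> {1..int N} - set us" for N D us vs
  proof -
    define s where "s = real (card (smooth_ints (prime_factors D \<union> pair_primes (set us) vs) N))"
    have "card (set us) * length vs \<le> length us * length vs" by (intro mult_right_mono card_length) auto
    then have "card (set us) * length vs \<le> c" using l by linarith
    then have s: "0 \<le> s" "s \<le> C1 * real N powr \<delta>" using b1[OF N _ us(2) D _ vs] by (auto simp: s_def)
    define u where "u = 2 * (1 + harm N :: real)"
    have u: "0 \<le> u" "u \<le> C2 * real N powr \<delta>"
      using b2[OF N] harm_nonneg[of N, where ?'a = real] by (auto simp: u_def)
    have "(\<Sum>p\<in>{1..int N} - set us. 1 / row_cost (prime_factors D \<union> pair_primes (set us) vs) us p)
        \<le> length us * (s ^ 2 * u)"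
      unfolding s_def u_def by (rule sum_inverse_row_cost_le[OF us])
    also have "\<dots> \<le> c * ((C1 * real N powr \<delta>) ^ 2 * (C2 * real N powr \<delta>))"
      using l s C1 C2 u by (intro mult_mono power_mono) auto
    also have "\<dots> = (c * (C1 ^ 2 * C2)) * (real N powr \<delta>) ^ 3"
      by (simp add: power_mult_distrib power2_eq_square power3_eq_cube)
    also have "(real N powr \<delta>) ^ 3 = real N powr \<epsilon>"
      using N by (simp add: powr_realpow[symmetric] powr_powr \<delta>_def)
    also have "(c * (C1 ^ 2 * C2)) * real N powr \<epsilon> \<le> C * real N powr \<epsilon>"
      by (intro mult_right_mono) (auto simp: C_def)
    finally show ?thesis .
  qed
  then show ?thesis using that[of C] by (simp add: C_def)
qed

section \<open>Lists recording a solution\<close>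

text \<open>Newton's form D0 + (z - a0) (D1 + (z - a1) (... + q)). The values at the base points do
  not depend on q, so they can be recovered from the differences even when \<tau> cannot. If there
  are at least d base points, the last quotient of a monic polynomial of degree d is a known
  constant and the differences determine the polynomial.\<close>

fun newton_poly :: "int poly \<Rightarrow> int list \<Rightarrow> int list \<Rightarrow> int poly" where
  "newton_poly q (a # as) (D # Ds) = [:D:] + [:- a, 1:] * newton_poly q as Ds"
| "newton_poly q _ _ = q"

fun div_diffs :: "int poly \<Rightarrow> int list \<Rightarrow> int list" where
  "div_diffs p [] = []"
| "div_diffs p (a # as) = poly p a # div_diffs (synthetic_div p a) as"

fun div_quot :: "int poly \<Rightarrow> int list \<Rightarrow> int poly" where
  "div_quot p [] = p"
| "div_quot p (a # as) = div_quot (synthetic_div p a) as"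

lemma length_div_diffs [simp]: "length (div_diffs p as) = length as"
  by (induction as arbitrary: p) auto

lemma newton_poly_div_diffs: "newton_poly (div_quot p as) as (div_diffs p as) = p"
proof (induction as arbitrary: p)
  case (Cons a as)
  have "newton_poly (div_quot p (a # as)) (a # as) (div_diffs p (a # as))
     = [:poly p a:] + [:- a, 1:] * synthetic_div p a"
    using Cons.IH[of "synthetic_div p a"] by (simp del: mult_pCons_left)
  also have "\<dots> = p" using synthetic_div_correct'[of a p] by (simp add: add.commute del: mult_pCons_left)
  finally show ?case .
qed simp

lemma poly_newton_poly_base:
  "length Ds = length as \<Longrightarrow> a \<in> set as \<Longrightarrow> poly (newton_poly q as Ds) a = poly (newton_poly q' as Ds) a"
  by (induction q as Ds rule: newton_poly.induct) auto

lemma poly_newton_poly_div_diffs: "a \<in> set as \<Longrightarrow> poly (newton_poly q as (div_diffs p as)) a = poly p a"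
  using poly_newton_poly_base[of "div_diffs p as" as a q "div_quot p as"] by (simp add: newton_poly_div_diffs)

lemma degree_div_quot: "degree (div_quot p as) = degree p - length as"
  by (induction as arbitrary: p) (auto simp: degree_synthetic_div)

lemma div_quot_monic: "lead_coeff p = 1 \<Longrightarrow> length as \<le> degree p \<Longrightarrow> lead_coeff (div_quot p as) = 1"
proof (induction as arbitrary: p)
  case (Cons a as)
  have "degree p \<noteq> 0" using Cons.prems by simp
  have "p = [:poly p a:] + [:- a, 1:] * synthetic_div p a"
    using synthetic_div_correct'[of a p] by (simp add: add.commute del: mult_pCons_left)
  then have "lead_coeff p = lead_coeff ([:poly p a:] + [:- a, 1:] * synthetic_div p a)" by simp
  also have "\<dots> = lead_coeff ([:- a, 1:] * synthetic_div p a)"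
  proof (rule lead_coeff_add_le)
    have "synthetic_div p a \<noteq> 0" using \<open>degree p \<noteq> 0\<close> by (simp add: synthetic_div_eq_0_iff)
    then show "degree [:poly p a:] < degree ([:- a, 1:] * synthetic_div p a)"
      by (subst degree_mult_eq) auto
  qed
  also have "\<dots> = lead_coeff (synthetic_div p a)" by (subst lead_coeff_mult) simp
  finally show ?case using Cons by (simp add: degree_synthetic_div)
qed simp

lemma div_quot_const:
  assumes "degree p = d" "lead_coeff p = 1" "d \<le> length as"
  shows "div_quot p as = (if length as = d then 1 else 0)"
proof (cases "length as = d")
  case True
  then have "degree (div_quot p as) = 0" and "lead_coeff (div_quot p as) = 1"
    using assms div_quot_monic[of p as] by (auto simp: degree_div_quot)
  then show ?thesis using True by (metis degree_0_id of_int_1 pCons_one lead_coeff_pCons(2) degree_eq_zeroE one_pCons coeff_pCons_0)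
next
  case False
  then show ?thesis using assms
  proof (induction as arbitrary: p d)
    case (Cons a as)
    show ?case
    proof (cases "d = 0")
      case True
      then have "synthetic_div p a = 0" using Cons.prems by (simp add: synthetic_div_eq_0_iff)
      moreover have "div_quot 0 xs = 0" for xs by (induction xs) auto
      ultimately show ?thesis using Cons.prems by simp
    next
      case False
      have "lead_coeff (synthetic_div p a) = 1"
        using div_quot_monic[of p "[a]"] Cons.prems False by simp
      then show ?thesis using Cons.IH[of "d - 1" "synthetic_div p a"] Cons.prems False
        by (auto simp: degree_synthetic_div)
    qed
  qed auto
qed

text \<open>p is bounded like a form of degree e in z and N. Every synthetic division at a point of
  size at most N lowers the weight by one; this bounds the l-th difference of \<tau> by O(N^(d - l))
  and is the origin of the terms max (d - l) 0 in the exponent.\<close>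

definition weighted_bound :: "nat \<Rightarrow> nat \<Rightarrow> nat \<Rightarrow> int poly \<Rightarrow> bool" where
  "weighted_bound e M N p \<longleftrightarrow> (\<forall>j. \<bar>coeff p j\<bar> \<le> (if j \<le> e then int M * int N ^ (e - j) else 0))"

lemma weighted_bound_synthetic_div:
  assumes "weighted_bound e M N p" "\<bar>c\<bar> \<le> int N" "N \<ge> 1"
  shows "weighted_bound (e - 1) ((e + 1) * M) N (synthetic_div p c) \<and>
         \<bar>poly p c\<bar> \<le> int ((e + 1) * M) * int N ^ e"
  using assms(1)
proof (induction p arbitrary: e)
  case 0
  then show ?case by (auto simp: weighted_bound_def)
next
  case (pCons a p)
  have co: "\<bar>coeff (pCons a p) j\<bar> \<le> (if j \<le> e then int M * int N ^ (e - j) else 0)" for j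
    using pCons.prems by (auto simp: weighted_bound_def)
  show ?case
  proof (cases e)
    case 0
    have "coeff p j = 0" for j using co[of "Suc j"] 0 by simp
    then have "p = 0" by (simp add: poly_eq_iff)
    then show ?thesis using co[of 0] 0 by (auto simp: weighted_bound_def)
  next
    case (Suc e')
    have wb: "weighted_bound e' M N p"
      unfolding weighted_bound_def
    proof
      fix j show "\<bar>coeff p j\<bar> \<le> (if j \<le> e' then int M * int N ^ (e' - j) else 0)"
        using co[of "Suc j"] unfolding Suc by (auto split: if_splits)
    qed
    note IH = pCons.IH[OF wb]
    have mono: "int ((e' + 1) * M) * int N ^ i \<le> int ((e + 1) * M) * int N ^ i" for i
      using Suc by (intro mult_right_mono) auto
    have "weighted_bound e' ((e + 1) * M) N (pCons (poly p c) (synthetic_div p c))"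
      unfolding weighted_bound_def
    proof
      fix j
      show "\<bar>coeff (pCons (poly p c) (synthetic_div p c)) j\<bar>
          \<le> (if j \<le> e' then int ((e + 1) * M) * int N ^ (e' - j) else 0)"
      proof (cases j)
        case 0
        then show ?thesis using IH mono[of e'] by auto
      next
        case (Suc i)
        show ?thesis
        \<comment> \<open>Here e' - 1 is truncated to 0, so the induction hypothesis would permit a
          nonzero constant; instead p is constant and its quotient is 0.\<close>
        proof (cases "e' = 0")
          case True
          have "coeff p j = 0" if "j > 0" for j
            using wb[unfolded weighted_bound_def, rule_format, of j] that True by simp
          then have "degree p = 0" by (intro le_antisym degree_le) auto
          then have "synthetic_div p c = 0" by (simp add: synthetic_div_eq_0_iff)
          then show ?thesis using Suc by simp
        next
          case False
          have "\<bar>coeff (synthetic_div p c) i\<bar> \<le> (if i \<le> e' - 1 then int ((e' + 1) * M) * int N ^ (e' - 1 - i) else 0)"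
            using IH[THEN conjunct1, unfolded weighted_bound_def, rule_format, of i] .
          also have "\<dots> \<le> (if j \<le> e' then int ((e + 1) * M) * int N ^ (e' - j) else 0)"
            using False Suc mono[of "e' - 1 - i"] by auto
          finally show ?thesis using Suc by simp
        qed
      qed
    qed
    moreover have "\<bar>poly (pCons a p) c\<bar> \<le> int ((e + 1) * M) * int N ^ e"
    proof -
      have "\<bar>poly (pCons a p) c\<bar> \<le> \<bar>a\<bar> + \<bar>c\<bar> * \<bar>poly p c\<bar>"
        by (simp add: abs_mult[symmetric])
      also have "\<dots> \<le> int M * int N ^ e + int N * (int ((e' + 1) * M) * int N ^ e')"
        using co[of 0] assms(2) IH by (intro add_mono mult_mono) auto
      also have "\<dots> = int ((e + 1) * M) * int N ^ e" using Suc by (simp add: algebra_simps)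
      finally show ?thesis .
    qed
    ultimately show ?thesis using Suc by simp
  qed
qed

lemma div_diffs_bound:
  assumes "weighted_bound e M N p" "\<forall>a\<in>set as. \<bar>a\<bar> \<le> int N" "N \<ge> 1" "l < length as"
  shows "\<bar>div_diffs p as ! l\<bar> \<le> int (M * (e + 1) ^ length as * N ^ (e - l))"
  using assms(1,2,4)
proof (induction as arbitrary: p e M l)
  case (Cons a as)
  have a: "\<bar>a\<bar> \<le> int N" using Cons.prems by simp
  note s = weighted_bound_synthetic_div[OF Cons.prems(1) a assms(3)]
  show ?case
  proof (cases l)
    case 0
    have "\<bar>poly p a\<bar> \<le> int ((e + 1) * M) * int N ^ e" using s by simp
    also have "\<dots> = int (M * (e + 1) ^ 1 * N ^ e)" by simp
    also have "\<dots> \<le> int (M * (e + 1) ^ length (a # as) * N ^ e)"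
      unfolding of_nat_le_iff by (intro mult_right_mono mult_left_mono power_increasing) auto
    finally show ?thesis using 0 by simp
  next
    case (Suc l')
    have "\<bar>div_diffs (synthetic_div p a) as ! l'\<bar> \<le> int ((e + 1) * M * (e - 1 + 1) ^ length as * N ^ (e - 1 - l'))"
      using s Cons.prems Suc by (intro Cons.IH) auto
    also have "\<dots> \<le> int ((e + 1) * M * (e + 1) ^ length as * N ^ (e - 1 - l'))"
      unfolding of_nat_le_iff by (intro mult_mono power_mono) auto
    finally show ?thesis using Suc by (simp add: algebra_simps)
  qed
qed simp

lemma abs_esym_le:
  assumes "\<forall>a\<in>#M. \<bar>a\<bar> \<le> int N"
  shows "\<bar>esym M m\<bar> \<le> 2 ^ size M * int N ^ m"
  using assms
proof (induction M arbitrary: m)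
  case empty
  then show ?case by (cases m) (auto simp: esym_def)
next
  case (add a M)
  have e: "esym (add_mset a M) n = esym M n - (if n = 0 then 0 else a * esym M (n - 1))" for n
    by (cases n) (simp_all add: esym_def)
  show ?case
  proof (cases m)
    case 0
    then show ?thesis using one_le_power[of "2::int" "Suc (size M)"] by simp
  next
    case (Suc m')
    have "\<bar>esym (add_mset a M) m\<bar> \<le> \<bar>esym M m\<bar> + \<bar>a\<bar> * \<bar>esym M m'\<bar>"
      using Suc by (simp add: e abs_mult[symmetric])
    also have "\<dots> \<le> 2 ^ size M * int N ^ m + int N * (2 ^ size M * int N ^ m')"
      using add by (intro add_mono mult_mono) auto
    also have "\<dots> = 2 ^ size (add_mset a M) * int N ^ m" using Suc by simp
    finally show ?thesis .
  qed
qed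

lemma weighted_bound_tau:
  assumes "\<forall>a\<in>#M. \<bar>a\<bar> \<le> int N"
  shows "weighted_bound d (2 ^ size M) N (tau_poly d M)"
  using abs_esym_le[OF assms] by (auto simp: weighted_bound_def coeff_tau_poly)

lemma degree_tau_poly: "degree (tau_poly d M) = d" "lead_coeff (tau_poly d M) = 1"
proof -
  have "coeff (tau_poly d M) d = 1" by (simp add: coeff_tau_poly)
  moreover have "degree (tau_poly d M) \<le> d" by (intro degree_le) (auto simp: coeff_tau_poly)
  ultimately show "degree (tau_poly d M) = d" by (metis le_antisym le_degree zero_neq_one)
  then show "lead_coeff (tau_poly d M) = 1" by (simp add: coeff_tau_poly)
qed

section \<open>Candidate lists and their weights\<close>

definition base_int :: "int list \<Rightarrow> int poly \<Rightarrow> int" where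
  "base_int as p = (\<Prod>a\<in>set as. \<Prod>b\<in>set as - {a}. a - b) * (\<Prod>a\<in>set as. poly p a)"

text \<open>The prime factors of the two integers are the primes disregarded in the two phases.
  \<open>base_int\<close> collects those of a - b, which makes the residue classes for different
  base points coprime, and those of \<tau>(a), as demanded by \<open>new_part_dvd\<close>.
  \<open>row_int\<close> adds those of \<tau>(u), which the swapped system demands, and those
  already known from u - a.\<close>

definition row_int :: "int list \<Rightarrow> int poly \<Rightarrow> int list \<Rightarrow> int" where
  "row_int as p us = base_int as p * (\<Prod>u\<in>set us. poly p u) * (\<Prod>u\<in>set us. \<Prod>a\<in>set as. u - a)"

text \<open>The first difference is \<open>\<tau>\<close> at the first base point; the weight \<open>1 / \<bar>D\<bar>\<close> keeps track of its size.\<close>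

definition diff_weight :: "nat \<Rightarrow> nat \<Rightarrow> nat \<Rightarrow> int list \<Rightarrow> int \<Rightarrow> real" where
  "diff_weight d M N h D = (if h = [] then (if D = 0 then 0 else 1 / \<bar>real_of_int D\<bar>)
     else if \<bar>D\<bar> \<le> int (M * N ^ (d - length h)) then 1 / real (2 * M * N ^ (d - length h) + 1) else 0)"

text \<open>\<tau> occurs only through the polynomial rebuilt from the recorded differences, so
  every factor depends on its own entry and on earlier ones, as \<open>kraft_sum_le\<close>
  requires.\<close>

definition tuple_weight ::
  "nat \<Rightarrow> nat \<Rightarrow> nat \<Rightarrow> int poly \<Rightarrow> int list \<times> int list \<times> int list \<times> int list \<Rightarrow> real" where
  "tuple_weight d M N q = (\<lambda>(as, Ds, us, ws).
     (1 / real N ^ length as) * ((\<Prod>t<length Ds. diff_weight d M N (take t Ds) (Ds ! t)) *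
     ((\<Prod>t<length us. 1 / crt_cost (set as) (prime_factors (base_int as (newton_poly q as Ds))) (take t us) (us ! t)) *
     (\<Prod>t<length ws. 1 / row_cost (prime_factors (row_int as (newton_poly q as Ds) us) \<union> pair_primes (set us) (take t ws)) us (ws ! t)))))"

text \<open>The integers \<open>base_int\<close> and, for m > 0, \<open>row_int\<close> are required
  to be nonzero and polynomially bounded. This keeps the number of smooth integers at O(N powr
  \<epsilon>) for all lists, also for those that come from no solution.\<close>

definition tuples :: "nat \<Rightarrow> nat \<Rightarrow> nat \<Rightarrow> nat \<Rightarrow> nat \<Rightarrow> int poly \<Rightarrow> nat \<Rightarrow> nat \<Rightarrow> nat \<Rightarrow>
    (int list \<times> int list \<times> int list \<times> int list) set" where
  "tuples d M c N r q b m R =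
    (SIGMA as:{as. set as \<subseteq> {1..int N} \<and> length as = r}.
     SIGMA Ds:{Ds. set Ds \<subseteq> {- int R..int R} \<and> length Ds = r \<and> base_int as (newton_poly q as Ds) \<noteq> 0 \<and>
        real_of_int \<bar>base_int as (newton_poly q as Ds)\<bar> \<le> real c * real N ^ c}.
     SIGMA us:{us. set us \<subseteq> {1..int N} - set as \<and> length us = b \<and> (m > 0 \<longrightarrow>
        row_int as (newton_poly q as Ds) us \<noteq> 0 \<and> real_of_int \<bar>row_int as (newton_poly q as Ds) us\<bar> \<le> real c * real N ^ c)}.
     {ws. set ws \<subseteq> {1..int N} - set us \<and> length ws = m})"

lemma sum_diff_weight_le:
  assumes "R = M * N ^ d" "N \<ge> 1"
  shows "(\<Sum>D\<in>{- int R..int R}. diff_weight d M N h D) \<le> 2 * (1 + harm R)"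
proof (cases "h = []")
  case True
  have sp: "{- int R..int R} = {-int R..-1} \<union> {0} \<union> {1..int R}" by auto
  have p: "(\<Sum>D\<in>{1..int R}. diff_weight d M N h D) = harm R"
  proof -
    have "{1..int R} = int ` {1..R}" by (simp add: image_int_atLeastAtMost)
    then have "(\<Sum>D\<in>{1..int R}. diff_weight d M N h D) = (\<Sum>n\<in>{1..R}. diff_weight d M N h (int n))"
      by (simp add: sum.reindex)
    also have "\<dots> = harm R" unfolding harm_def using True
      by (intro sum.cong) (auto simp: diff_weight_def inverse_eq_divide)
    finally show ?thesis .
  qed
  have n: "(\<Sum>D\<in>{- int R..-1}. diff_weight d M N h D) = harm R"
  proof -
    have "{- int R..-1} = uminus ` {1..int R}" by (simp add: image_uminus_atLeastAtMost)
    then have "(\<Sum>D\<in>{- int R..-1}. diff_weight d M N h D) = (\<Sum>D\<in>uminus ` {1..int R}. diff_weight d M N h D)"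
      by simp
    also have "\<dots> = (\<Sum>D\<in>{1..int R}. diff_weight d M N h (- D))"
      by (subst sum.reindex) auto
    also have "\<dots> = (\<Sum>D\<in>{1..int R}. diff_weight d M N h D)" using True by (simp add: diff_weight_def)
    finally show ?thesis by (simp only: p)
  qed
  have "(\<Sum>D\<in>{- int R..-1} \<union> {0} \<union> {1..int R}. diff_weight d M N h D)
     = (\<Sum>D\<in>{- int R..-1} \<union> {0}. diff_weight d M N h D) + (\<Sum>D\<in>{1..int R}. diff_weight d M N h D)"
    by (rule sum.union_disjoint) auto
  also have "(\<Sum>D\<in>{- int R..-1} \<union> {0}. diff_weight d M N h D)
     = (\<Sum>D\<in>{- int R..-1}. diff_weight d M N h D) + (\<Sum>D\<in>{0}. diff_weight d M N h D)"
    by (rule sum.union_disjoint) auto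
  also have "(\<Sum>D\<in>{0}. diff_weight d M N h D) = 0" using True by (simp add: diff_weight_def)
  finally have "(\<Sum>D\<in>{- int R..int R}. diff_weight d M N h D) = harm R + 0 + harm R"
    using p n sp by simp
  then show ?thesis by simp
next
  case False
  define s where "s = M * N ^ (d - length h)"
  have "(\<Sum>D\<in>{- int R..int R}. diff_weight d M N h D)
     = (\<Sum>D\<in>{- int R..int R}. if \<bar>D\<bar> \<le> int s then 1 / real (2 * s + 1) else 0)"
    using False by (intro sum.cong) (simp_all add: diff_weight_def s_def mult.assoc)
  also have "\<dots> = (\<Sum>D\<in>{D\<in>{- int R..int R}. \<bar>D\<bar> \<le> int s}. 1 / real (2 * s + 1))"
    by (rule sum.inter_filter[symmetric]) simp
  also have "\<dots> \<le> (\<Sum>D\<in>{- int s..int s}. 1 / real (2 * s + 1))" by (intro sum_mono2) auto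
  also have "\<dots> = 1" by simp
  also have "\<dots> \<le> 2 * (1 + harm R)" using harm_nonneg[of R, where ?'a = real] by simp
  finally show ?thesis .
qed

lemma prime_factors_base_int:
  assumes "base_int as p \<noteq> 0" "a \<in> set as"
  shows "prime_factors (poly p a) \<subseteq> prime_factors (base_int as p)"
    and "b \<in> set as \<Longrightarrow> a \<noteq> b \<Longrightarrow> prime_factors (a - b) \<subseteq> prime_factors (base_int as p)"
proof -
  have "poly p a dvd (\<Prod>a\<in>set as. poly p a)" using assms by (intro dvd_prodI) auto
  then have "poly p a dvd base_int as p" unfolding base_int_def by (rule dvd_mult)
  then show "prime_factors (poly p a) \<subseteq> prime_factors (base_int as p)"
    using assms(1) by (rule dvd_prime_factors[rotated])
  assume b: "b \<in> set as" "a \<noteq> b"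
  have "a - b dvd (\<Prod>b\<in>set as - {a}. a - b)" using b by (intro dvd_prodI) auto
  also have "\<dots> dvd (\<Prod>a\<in>set as. \<Prod>b\<in>set as - {a}. a - b)"
    using assms(2) by (intro dvd_prodI[where f = "\<lambda>a. \<Prod>b\<in>set as - {a}. a - b"]) auto
  also have "\<dots> dvd base_int as p" unfolding base_int_def by (rule dvd_triv_left)
  finally show "prime_factors (a - b) \<subseteq> prime_factors (base_int as p)"
    using assms(1) by (rule dvd_prime_factors[rotated])
qed

text \<open>The sums are carried out from the inside: over the y, the x, the differences, and
  finally the N^r choices of base points, which the factor 1 / N^r cancels.\<close>

lemma sum_tuple_weight_le:
  fixes \<epsilon> :: real
  assumes "\<epsilon> > 0" and r: "r \<ge> 1" "r \<le> c" "r * b \<le> c" and b: "b \<ge> 1" "b \<le> c" "b * m \<le> c"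
  obtains C where "C \<ge> 1"
    "\<And>N. N \<ge> 1 \<Longrightarrow> (\<Sum>z\<in>tuples d M c N r q b m (M * N ^ d). tuple_weight d M N q z) \<le> C * real N powr \<epsilon>"
proof -
  define n where "n = 2 * r + b + m + d + 1"
  \<comment> \<open>Shares of \<epsilon>: d for each of the r differences, whose range extends to M
    N^d, and one for each of the b + m later entries. The remaining r shares are slack.\<close>
  define \<delta> where "\<delta> = \<epsilon> / (r * (d + 1) + b + m)"
  have den: "real (r * (d + 1) + b + m) > 0" using r by (subst of_nat_0_less_iff) simp
  have \<delta>: "\<delta> > 0" using assms(1) den unfolding \<delta>_def by (rule divide_pos_pos)
  obtain C1 where C1: "C1 > 0" and b1: "\<And>N. N \<ge> 1 \<Longrightarrow> 2 * (1 + harm N) \<le> C1 * real N powr \<delta>"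
    using harm_le_powr[OF \<delta>] by metis
  obtain C2 where C2: "C2 \<ge> 1" and b2: "\<And>N A D us. N \<ge> 1 \<Longrightarrow> finite A \<Longrightarrow> A \<noteq> {} \<Longrightarrow> A \<subseteq> {1..int N} \<Longrightarrow> D \<noteq> 0 \<Longrightarrow> real_of_int \<bar>D\<bar> \<le> real c * real N ^ c \<Longrightarrow>
       card A \<le> c \<Longrightarrow> card A * length us \<le> c \<Longrightarrow> set us \<subseteq> {1..int N} - A \<Longrightarrow>
       (\<And>a b. a \<in> A \<Longrightarrow> b \<in> A \<Longrightarrow> a \<noteq> b \<Longrightarrow> prime_factors (a - b) \<subseteq> prime_factors D) \<Longrightarrow>
       (\<Sum>p\<in>{1..int N} - A. 1 / crt_cost A (prime_factors D) us p) \<le> C2 * real N powr \<delta>"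
    using crt_step_bound[OF \<delta>, of c] by metis
  obtain C3 where C3: "C3 \<ge> 1" and b3: "\<And>N D us vs. N \<ge> 1 \<Longrightarrow> us \<noteq> [] \<Longrightarrow> set us \<subseteq> {1..int N} \<Longrightarrow> D \<noteq> 0 \<Longrightarrow> real_of_int \<bar>D\<bar> \<le> real c * real N ^ c \<Longrightarrow>
       length us \<le> c \<Longrightarrow> length us * length vs \<le> c \<Longrightarrow> set vs \<subseteq> {1..int N} - set us \<Longrightarrow>
       (\<Sum>p\<in>{1..int N} - set us. 1 / row_cost (prime_factors D \<union> pair_primes (set us) vs) us p) \<le> C3 * real N powr \<delta>"
    using row_step_bound[OF \<delta>, of c] by metis
  define M' where "M' = max 1 M"
  define CD where "CD = C1 * real M' powr \<delta>"
  define C where "C = max 1 (CD ^ r * (C2 ^ b * C3 ^ m))"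
  have "(\<Sum>z\<in>tuples d M c N r q b m (M * N ^ d). tuple_weight d M N q z) \<le> C * real N powr \<epsilon>"
    if N: "N \<ge> 1" for N
  proof -
    define R where "R = M * N ^ d"
    define BD where "BD = CD * real N powr (\<delta> * d)"
    define B2 where "B2 = C2 * real N powr \<delta>"
    define B3 where "B3 = C3 * real N powr \<delta>"
    define TA where "TA = {as. set as \<subseteq> {1..int N} \<and> length as = r}"
    define TD where "TD = (\<lambda>as. {Ds. set Ds \<subseteq> {- int R..int R} \<and> length Ds = r \<and> base_int as (newton_poly q as Ds) \<noteq> 0 \<and>
        real_of_int \<bar>base_int as (newton_poly q as Ds)\<bar> \<le> real c * real N ^ c})"
    define TU where "TU = (\<lambda>as Ds. {us. set us \<subseteq> {1..int N} - set as \<and> length us = b \<and> (m > 0 \<longrightarrow>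
        row_int as (newton_poly q as Ds) us \<noteq> 0 \<and> real_of_int \<bar>row_int as (newton_poly q as Ds) us\<bar> \<le> real c * real N ^ c)})"
    define TW where "TW = (\<lambda>us. {ws. set ws \<subseteq> {1..int N} - set us \<and> length ws = m})"
    define wD where "wD = (\<lambda>Ds. \<Prod>t<length Ds. diff_weight d M N (take t Ds) (Ds ! t))"
    define wU where "wU = (\<lambda>as Ds us. \<Prod>t<length us. 1 / crt_cost (set as) (prime_factors (base_int as (newton_poly q as Ds))) (take t us) (us ! t))"
    define wW where "wW = (\<lambda>as Ds us ws. \<Prod>t<length ws. 1 / row_cost (prime_factors (row_int as (newton_poly q as Ds) us) \<union> pair_primes (set us) (take t ws)) us (ws ! t))"
    have finI: "finite {1..int N}" by simp
    have finTA: "finite TA" unfolding TA_def by (rule finite_lists_length_eq) simp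
    have finTD: "finite (TD as)" for as
      unfolding TD_def by (rule finite_subset[OF _ finite_lists_length_eq[of "{- int R..int R}" r]]) auto
    have finTU: "finite (TU as Ds)" for as Ds
      unfolding TU_def by (rule finite_subset[OF _ finite_lists_length_eq[of "{1..int N}" b]]) auto
    have finTW: "finite (TW us)" for us
      unfolding TW_def by (rule finite_subset[OF _ finite_lists_length_eq[of "{1..int N}" m]]) auto
    have dw0: "diff_weight d M N h D \<ge> 0" for h D by (simp add: diff_weight_def)
    have wD0: "wD Ds \<ge> 0" for Ds unfolding wD_def by (intro prod_nonneg) (auto simp: dw0)
    have cc: "0 \<le> 1 / crt_cost (set as) Q us p" if "as \<noteq> []" for as Q us p
      using crt_cost_ge_1[of "set as" Q us p] that by simp
    have rc: "0 \<le> 1 / row_cost K us p" if "us \<noteq> []" for K us p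
      using row_cost_ge_1[of us K p] that by simp
    have sumW: "(\<Sum>ws\<in>TW us. wW as Ds us ws) \<le> B3 ^ m" if as: "as \<in> TA" "Ds \<in> TD as" "us \<in> TU as Ds" for as Ds us
    proof (cases "m = 0")
      case True
      then have "TW us = {[]}" by (auto simp: TW_def)
      then show ?thesis using True by (simp add: wW_def)
    next
      case False
      have us: "us \<noteq> []" "set us \<subseteq> {1..int N}" "length us = b" using as b by (auto simp: TU_def)
      have "(\<Sum>l\<in>{l. set l \<subseteq> {1..int N} - set us \<and> length l = m}.
          \<Prod>t<m. 1 / row_cost (prime_factors (row_int as (newton_poly q as Ds) us) \<union> pair_primes (set us) (take t l)) us (l ! t)) \<le> B3 ^ m"
      proof (rule kraft_sum_le)
        fix h assume h: "set h \<subseteq> {1..int N} - set us" "length h < m"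
        have "length us * length h \<le> b * m" using h us(3) by (intro mult_mono) auto
        then have "length us * length h \<le> c" using b(3) by linarith
        moreover have "row_int as (newton_poly q as Ds) us \<noteq> 0"
            "real_of_int \<bar>row_int as (newton_poly q as Ds) us\<bar> \<le> real c * real N ^ c"
          using as(3) False by (auto simp: TU_def)
        ultimately show "(\<Sum>p\<in>{1..int N} - set us. 1 / row_cost (prime_factors (row_int as (newton_poly q as Ds) us) \<union> pair_primes (set us) h) us p) \<le> B3"
          unfolding B3_def using us h(1) b(2) by (intro b3[OF N]) auto
      qed (use C3 us rc in \<open>auto simp: B3_def\<close>)
      moreover have "(\<Sum>ws\<in>TW us. wW as Ds us ws) = (\<Sum>l\<in>{l. set l \<subseteq> {1..int N} - set us \<and> length l = m}.
          \<Prod>t<m. 1 / row_cost (prime_factors (row_int as (newton_poly q as Ds) us) \<union> pair_primes (set us) (take t l)) us (l ! t))"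
        unfolding TW_def wW_def by (intro sum.cong) auto
      ultimately show ?thesis by simp
    qed
    have wU0: "wU as Ds us \<ge> 0" if "as \<in> TA" for as Ds us
    proof -
      have "as \<noteq> []" using that r by (auto simp: TA_def)
      then show ?thesis unfolding wU_def using cc by (intro prod_nonneg) auto
    qed
    have sumU: "(\<Sum>us\<in>TU as Ds. wU as Ds us) \<le> B2 ^ b" if as: "as \<in> TA" "Ds \<in> TD as" for as Ds
    proof -
      define D where "D = base_int as (newton_poly q as Ds)"
      have D: "D \<noteq> 0" "real_of_int \<bar>D\<bar> \<le> real c * real N ^ c" using as by (auto simp: TD_def D_def)
      have asl: "as \<noteq> []" "length as = r" "set as \<subseteq> {1..int N}" using as r by (auto simp: TA_def)
      have ca: "card (set as) \<le> r" using asl card_length[of as] by simp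
      have "(\<Sum>us\<in>TU as Ds. wU as Ds us) \<le> (\<Sum>l\<in>{l. set l \<subseteq> {1..int N} - set as \<and> length l = b}. wU as Ds l)"
        using wU0[OF as(1)] by (intro sum_mono2 finite_lists_length_eq) (auto simp: TU_def)
      also have "\<dots> = (\<Sum>l\<in>{l. set l \<subseteq> {1..int N} - set as \<and> length l = b}.
          \<Prod>t<b. 1 / crt_cost (set as) (prime_factors D) (take t l) (l ! t))"
        unfolding wU_def D_def by (intro sum.cong) auto
      also have "\<dots> \<le> B2 ^ b"
      proof (rule kraft_sum_le)
        fix h assume h: "set h \<subseteq> {1..int N} - set as" "length h < b"
        have "card (set as) * length h \<le> r * b" using h ca by (intro mult_mono) auto
        then have "card (set as) * length h \<le> c" using r(3) by linarith
        then show "(\<Sum>p\<in>{1..int N} - set as. 1 / crt_cost (set as) (prime_factors D) h p) \<le> B2"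
          unfolding B2_def using asl h(1) ca r(2) D prime_factors_base_int(2)[of as "newton_poly q as Ds"]
          by (intro b2[OF N]) (auto simp: D_def)
      qed (use C2 asl cc in \<open>auto simp: B2_def\<close>)
      finally show ?thesis .
    qed
    have sumD: "(\<Sum>Ds\<in>TD as. wD Ds) \<le> BD ^ r" for as
    proof -
      have "(\<Sum>Ds\<in>TD as. wD Ds) \<le> (\<Sum>l\<in>{l. set l \<subseteq> {- int R..int R} \<and> length l = r}. wD l)"
        using wD0 by (intro sum_mono2 finite_lists_length_eq) (auto simp: TD_def)
      also have "\<dots> = (\<Sum>l\<in>{l. set l \<subseteq> {- int R..int R} \<and> length l = r}. \<Prod>t<r. diff_weight d M N (take t l) (l ! t))"
        unfolding wD_def by (intro sum.cong) auto
      also have "\<dots> \<le> BD ^ r"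
      proof (rule kraft_sum_le)
        fix h :: "int list"
        have "(\<Sum>D\<in>{- int R..int R}. diff_weight d M N h D) \<le> 2 * (1 + harm R)"
          by (rule sum_diff_weight_le[OF R_def N])
        also have "\<dots> \<le> 2 * (1 + harm (M' * N ^ d))"
          unfolding R_def M'_def by (intro mult_left_mono add_left_mono harm_mono mult_right_mono) auto
        also have "\<dots> \<le> C1 * real (M' * N ^ d) powr \<delta>" using N by (intro b1) (simp add: M'_def)
        also have "\<dots> = BD" using N
          by (simp add: BD_def CD_def powr_mult powr_powr powr_realpow[symmetric] mult_ac)
        finally show "(\<Sum>D\<in>{- int R..int R}. diff_weight d M N h D) \<le> BD" .
      qed (use C1 dw0 in \<open>auto simp: BD_def CD_def\<close>)
      finally show ?thesis .
    qed
    have B0: "B2 \<ge> 0" "B3 \<ge> 0" "BD \<ge> 0" using C1 C2 C3 by (auto simp: B2_def B3_def BD_def CD_def)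
    have "(\<Sum>z\<in>tuples d M c N r q b m R. tuple_weight d M N q z)
       = (\<Sum>as\<in>TA. \<Sum>Ds\<in>TD as. \<Sum>us\<in>TU as Ds. \<Sum>ws\<in>TW us. (1 / real N ^ r) * (wD Ds * (wU as Ds us * wW as Ds us ws)))"
    proof -
      have "tuples d M c N r q b m R = (SIGMA as:TA. SIGMA Ds:TD as. SIGMA us:TU as Ds. TW us)"
        unfolding tuples_def TA_def TD_def TU_def TW_def ..
      moreover have "(\<Sum>as\<in>TA. \<Sum>Ds\<in>TD as. \<Sum>us\<in>TU as Ds. \<Sum>ws\<in>TW us. (1 / real N ^ length as) * (wD Ds * (wU as Ds us * wW as Ds us ws)))
         = (\<Sum>(as, Ds, us, ws)\<in>(SIGMA as:TA. SIGMA Ds:TD as. SIGMA us:TU as Ds. TW us). (1 / real N ^ length as) * (wD Ds * (wU as Ds us * wW as Ds us ws)))"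
        by (simp add: sum.Sigma finTA finTD finTU finTW finite_SigmaI case_prod_unfold)
      moreover have "(\<Sum>as\<in>TA. \<Sum>Ds\<in>TD as. \<Sum>us\<in>TU as Ds. \<Sum>ws\<in>TW us. (1 / real N ^ length as) * (wD Ds * (wU as Ds us * wW as Ds us ws)))
         = (\<Sum>as\<in>TA. \<Sum>Ds\<in>TD as. \<Sum>us\<in>TU as Ds. \<Sum>ws\<in>TW us. (1 / real N ^ r) * (wD Ds * (wU as Ds us * wW as Ds us ws)))"
        by (rule sum.cong) (auto simp: TA_def)
      ultimately show ?thesis by (simp add: tuple_weight_def wD_def wU_def wW_def)
    qed
    also have "\<dots> = (\<Sum>as\<in>TA. (1 / real N ^ r) * (\<Sum>Ds\<in>TD as. wD Ds * (\<Sum>us\<in>TU as Ds. wU as Ds us * (\<Sum>ws\<in>TW us. wW as Ds us ws))))"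
      by (simp only: sum_distrib_left)
    also have "\<dots> \<le> (\<Sum>as\<in>TA. (1 / real N ^ r) * (\<Sum>Ds\<in>TD as. wD Ds * (\<Sum>us\<in>TU as Ds. wU as Ds us * B3 ^ m)))"
      by (intro sum_mono mult_left_mono sumW wU0 wD0) auto
    also have "\<dots> = (\<Sum>as\<in>TA. (1 / real N ^ r) * (\<Sum>Ds\<in>TD as. wD Ds * ((\<Sum>us\<in>TU as Ds. wU as Ds us) * B3 ^ m)))"
      by (simp only: sum_distrib_right)
    also have "\<dots> \<le> (\<Sum>as\<in>TA. (1 / real N ^ r) * (\<Sum>Ds\<in>TD as. wD Ds * (B2 ^ b * B3 ^ m)))"
      using B0 by (intro sum_mono mult_left_mono mult_right_mono sumU wD0) auto
    also have "\<dots> = (\<Sum>as\<in>TA. (1 / real N ^ r) * ((\<Sum>Ds\<in>TD as. wD Ds) * (B2 ^ b * B3 ^ m)))"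
      by (simp only: sum_distrib_right)
    also have "\<dots> \<le> (\<Sum>as\<in>TA. (1 / real N ^ r) * (BD ^ r * (B2 ^ b * B3 ^ m)))"
      using B0 by (intro sum_mono mult_left_mono mult_right_mono sumD) auto
    also have "\<dots> = BD ^ r * (B2 ^ b * B3 ^ m)"
    proof -
      have "card TA = N ^ r" unfolding TA_def using card_lists_length_eq[OF finI, of r] by simp
      then show ?thesis using N by simp
    qed
    also have "\<dots> = (CD ^ r * (C2 ^ b * C3 ^ m)) * ((real N powr (\<delta> * d)) ^ r * ((real N powr \<delta>) ^ b * (real N powr \<delta>) ^ m))"
      by (simp add: BD_def B2_def B3_def power_mult_distrib mult_ac)
    also have "\<dots> \<le> C * real N powr \<epsilon>"
    proof (rule mult_mono)
      have "(real N powr (\<delta> * d)) ^ r * ((real N powr \<delta>) ^ b * (real N powr \<delta>) ^ m) = real N powr (\<delta> * d * r + (\<delta> * b + \<delta> * m))"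
        using N by (simp add: powr_realpow[symmetric] powr_powr powr_add)
      also have "\<dots> \<le> real N powr \<epsilon>"
      proof (rule powr_mono)
        have "\<delta> * real (r * (d + 1) + b + m) = \<epsilon>" using den by (simp add: \<delta>_def)
        then have "\<delta> * d * r + (\<delta> * b + \<delta> * m) + \<delta> * r = \<epsilon>" by (simp add: algebra_simps)
        then show "\<delta> * d * r + (\<delta> * b + \<delta> * m) \<le> \<epsilon>" using \<delta> by (smt (verit) mult_nonneg_nonneg of_nat_0_le_iff)
      qed (use N in auto)
      finally show "(real N powr (\<delta> * d)) ^ r * ((real N powr \<delta>) ^ b * (real N powr \<delta>) ^ m) \<le> real N powr \<epsilon>" .
    qed (auto simp: C_def)
    finally show ?thesis by (simp add: R_def)
  qed
  then show ?thesis using that[of C] by (simp add: C_def)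
qed

lemma finite_tuples: "finite (tuples d M c N r q b m R)"
proof -
  have "tuples d M c N r q b m R \<subseteq> {as. set as \<subseteq> {1..int N} \<and> length as = r} \<times>
     {Ds. set Ds \<subseteq> {- int R..int R} \<and> length Ds = r} \<times> {us. set us \<subseteq> {1..int N} \<and> length us = b} \<times>
     {ws. set ws \<subseteq> {1..int N} \<and> length ws = m}"
    unfolding tuples_def by auto
  then show ?thesis by (rule finite_subset) (intro finite_cartesian_product finite_lists_length_eq; simp)
qed

section \<open>Counting solutions by their arrangements\<close>

definition sol_pairs :: "nat \<Rightarrow> nat \<Rightarrow> nat \<Rightarrow> (int multiset \<times> int multiset) set" where
  "sol_pairs k d N = {(Mx, My). psum_sys k d Mx My \<and> set_mset Mx \<subseteq> {1..int N} \<and>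
     set_mset My \<subseteq> {1..int N} \<and> set_mset Mx \<inter> set_mset My = {}}"

lemma sol_split:
  assumes "(Mx, My) \<in> sol_pairs k d N" "2 * d < k"
  shows "split_system Mx My (jump k d Mx My) (tau_poly d My)"
proof
  have sys: "psum_sys k d Mx My" and dj: "set_mset Mx \<inter> set_mset My = {}"
    using assms by (auto simp: sol_pairs_def)
  show "root_poly Mx - root_poly My = smult (jump k d Mx My) (tau_poly d My)"
    by (rule psum_sys_factor[OF sys assms(2)])
  have "Mx \<noteq> My"
  proof
    assume "Mx = My"
    then have "set_mset Mx = {}" using dj by simp
    then show False using sys assms(2) by (auto simp: psum_sys_def)
  qed
  then show "jump k d Mx My \<noteq> 0" by (rule jump_nonzero[OF sys assms(2)])
qed (use assms in \<open>auto simp: sol_pairs_def\<close>)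

lemma finite_multisets_size: "finite A \<Longrightarrow> finite {M. set_mset M \<subseteq> A \<and> size M = k}"
proof -
  assume "finite A"
  have "{M. set_mset M \<subseteq> A \<and> size M = k} \<subseteq> mset ` {l. set l \<subseteq> A \<and> length l = k}"
  proof
    fix M assume M: "M \<in> {M. set_mset M \<subseteq> A \<and> size M = k}"
    obtain l where "mset l = M" using ex_mset by blast
    then show "M \<in> mset ` {l. set l \<subseteq> A \<and> length l = k}" using M by (auto intro!: image_eqI[of _ _ l])
  qed
  then show ?thesis using finite_lists_length_eq[OF \<open>finite A\<close>, of k] by (meson finite_imageI finite_subset)
qed

lemma finite_sol_pairs: "finite (sol_pairs k d N)"
proof -
  have "sol_pairs k d N \<subseteq> {M. set_mset M \<subseteq> {1..int N} \<and> size M = k} \<times> {M. set_mset M \<subseteq> {1..int N} \<and> size M = k}"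
    by (auto simp: sol_pairs_def psum_sys_def)
  then show ?thesis by (rule finite_subset) (intro finite_cartesian_product finite_multisets_size; simp)
qed

lemma sol_pairs_swap: "(Mx, My) \<in> sol_pairs k d N \<Longrightarrow> (My, Mx) \<in> sol_pairs k d N"
  by (auto simp: sol_pairs_def intro: psum_sys_sym)

text \<open>\<tau> can be read off from \<open>Mx\<close> alone (\<open>tau_poly_eq\<close>). One
  root a of \<open>My\<close> then gives H, because \<tau>(a) is not 0, and R = P - H \<tau> is
  determined.\<close>

lemma sol_decode:
  assumes z: "(Mx, My) \<in> sol_pairs k d N" "(Mx, My') \<in> sol_pairs k d N" "2 * d < k"
    and a: "a \<in># My" "a \<in># My'"
  shows "My = My'"
proof -
  interpret s: split_system Mx My "jump k d Mx My" "tau_poly d My" by (rule sol_split[OF z(1,3)])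
  interpret s': split_system Mx My' "jump k d Mx My'" "tau_poly d My'" by (rule sol_split[OF z(2,3)])
  have "psum_sys k d Mx My" "psum_sys k d Mx My'" using z by (auto simp: sol_pairs_def)
  then have "tau_poly d Mx = tau_poly d My" "tau_poly d Mx = tau_poly d My'"
    using tau_poly_eq z(3) by blast+
  then have t: "tau_poly d My' = tau_poly d My" by simp
  have "jump k d Mx My * poly (tau_poly d My) a = jump k d Mx My' * poly (tau_poly d My) a"
    using s.value_right[OF a(1)] s'.value_right[OF a(2)] by (metis t)
  then have "jump k d Mx My = jump k d Mx My'" using s.tau_nonzero_right[OF a(1)] by auto
  then have "root_poly Mx - root_poly My = root_poly Mx - root_poly My'" using s.factor s'.factor t by simp
  then show ?thesis by (simp add: root_poly_inject)
qed

lemma prime_part_mono: "Q \<subseteq> R \<Longrightarrow> prime_part Q m \<le> prime_part R m"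
proof -
  assume "Q \<subseteq> R"
  then have "R = Q \<union> (R - Q)" by auto
  then have "prime_part R m = prime_part Q m * prime_part (R - Q) m"
    using prime_part_Un[of Q "R - Q" m] by (metis Diff_disjoint)
  then show ?thesis using mult_left_mono[OF prime_part_ge_1[of "R - Q" m], of "prime_part Q m"]
    by (simp add: less_imp_le)
qed

lemma poly_tau_bound:
  assumes "set_mset My \<subseteq> {1..int N}" "N \<ge> 1" "\<bar>a\<bar> \<le> int N"
  shows "\<bar>poly (tau_poly d My) a\<bar> \<le> int ((d + 1) * 2 ^ size My) * int N ^ d"
proof -
  have "\<forall>y\<in>#My. \<bar>y\<bar> \<le> int N" using assms(1) by force
  then show ?thesis
    using weighted_bound_synthetic_div[OF weighted_bound_tau assms(3,2), of My d] by simp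
qed

text \<open>The real unknowns that describe the cost of eliminating the \<open>x\<^sub>t\<close>: \<open>S\<close> and \<open>T\<close> are the logarithms
  of the hit part and of the whole \<open>Q\<close>-free part, \<open>c\<close> is the logarithm of the cost, \<open>g\<close> that
  of the known part of the jump.\<close>

definition cost_profile :: "nat \<Rightarrow> nat \<Rightarrow> real \<Rightarrow> real \<Rightarrow> (nat \<Rightarrow> real) \<Rightarrow> (nat \<Rightarrow> real) \<Rightarrow>
    (nat \<Rightarrow> real) \<Rightarrow> (nat \<Rightarrow> real) \<Rightarrow> bool" where
  "cost_profile k r L w S T c g \<longleftrightarrow> g 0 = 0 \<and> (\<forall>t\<le>k. g t \<le> w) \<and>
     (\<forall>t<k. 0 \<le> S t \<and> S t \<le> T t \<and> T t \<le> r * L \<and> 0 \<le> c t \<and>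
        (c t = 0 \<or> (c t + S t \<le> L \<and> r * (c t + S t) \<le> T t)) \<and>
        r * g t - (\<Sum>s<t. T s) \<le> real (k - t) * S t \<and> g t + (T t - S t) \<le> g (Suc t))"

text \<open>\<open>w\<close> is the logarithm of the Q-free part of H, and w - g t that of the part
  still unknown after t of the x. The inequality with \<open>hd as\<close> links the first
  difference \<tau>(a) to H: if it is large and therefore expensive, then H is small.\<close>

definition arranged :: "nat \<Rightarrow> nat \<Rightarrow> nat \<Rightarrow> nat \<Rightarrow> int multiset \<times> int multiset \<Rightarrow> int list \<Rightarrow> int list \<Rightarrow>
    real \<Rightarrow> (nat \<Rightarrow> real) \<Rightarrow> (nat \<Rightarrow> real) \<Rightarrow> (nat \<Rightarrow> real) \<Rightarrow> (nat \<Rightarrow> real) \<Rightarrow> bool" where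
  "arranged k d r N z as us w S T c g \<longleftrightarrow>
     distinct as \<and> length as = r \<and> set as \<subseteq> set_mset (snd z) \<and> mset us = fst z \<and>
     cost_profile k r (ln N) w S T c g \<and>
     w + ln \<bar>real_of_int (poly (tau_poly d (snd z)) (hd as))\<bar> \<le> k * ln N \<and>
     (\<forall>t<k. c t = ln (crt_cost (set as) (prime_factors (base_int as (tau_poly d (snd z)))) (take t us) (us ! t))) \<and>
     (\<forall>t\<le>k. w - g t = ln (prime_part (- (prime_factors (base_int as (tau_poly d (snd z))) \<union>
        pair_primes (set as) (take t us))) (jump k d (fst z) (snd z))))"

lemma base_int_nonzero: "(\<And>a. a \<in> set as \<Longrightarrow> poly p a \<noteq> 0) \<Longrightarrow> base_int as p \<noteq> 0"
  by (auto simp: base_int_def)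

lemma sum_list_map_take: "t \<le> length us \<Longrightarrow> (\<Sum>u\<leftarrow>take t us. f u) = (\<Sum>s<t. f (us ! s))"
  for f :: "'a \<Rightarrow> real"
  by (simp add: sum_list_sum_nth atLeast0LessThan)

text \<open>Any r distinct values among the y serve as base points; only the order of the x is
  special, and it is taken from \<open>exists_greedy_prefix\<close>.\<close>

lemma exists_arrangement:
  assumes z: "(Mx, My) \<in> sol_pairs k d N" and dk: "2 * d < k" and r: "1 \<le> r" "r \<le> card (set_mset My)"
    and N: "N \<ge> 1"
  shows "\<exists>as us w S T c g. arranged k d r N (Mx, My) as us w S T c g"
proof -
  define H where "H = jump k d Mx My"
  define \<tau> where "\<tau> = tau_poly d My"
  interpret split_system Mx My H \<tau> unfolding H_def \<tau>_def by (rule sol_split[OF z dk])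
  have sz: "size Mx = k" "size My = k" using z by (auto simp: sol_pairs_def psum_sys_def)
  have rg: "set_mset Mx \<subseteq> {1..int N}" "set_mset My \<subseteq> {1..int N}" using z by (auto simp: sol_pairs_def)
  obtain A where A: "A \<subseteq> set_mset My" "card A = r" using r obtain_subset_with_card_n by metis
  then have finA: "finite A" using finite_set_mset finite_subset by blast
  then obtain as where as: "set as = A" "distinct as" using finite_distinct_list by blast
  have las: "length as = r" using as A distinct_card by metis
  have Ane: "A \<noteq> {}" using A r by auto
  define Q where "Q = prime_factors (base_int as \<tau>)"
  have bnz: "base_int as \<tau> \<noteq> 0" using as A tau_nonzero_right by (intro base_int_nonzero) auto
  have tQ: "prime_factors (poly \<tau> a) \<subseteq> Q" if "a \<in> A" for a
    unfolding Q_def using prime_factors_base_int(1)[OF bnz] as that by auto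
  obtain us V where us: "length us = k" "mset us + V = Mx"
    and gr: "\<And>t. t < k \<Longrightarrow> real (k - t) * hit_log A Q (take t us) (us ! t)
       \<ge> card A * known_log A Q (take t us) - (\<Sum>u\<leftarrow>take t us. free_log A Q u)"
    using exists_greedy_prefix[OF finA Ane A(1) tQ, of k] sz by auto
  have "size V = 0" using us sz by (metis add_diff_cancel_left' cancel_comm_monoid_add_class.diff_cancel size_mset size_union)
  then have mus: "mset us = Mx" using us by simp
  define S where "S = (\<lambda>t. hit_log A Q (take t us) (us ! t))"
  define T where "T = (\<lambda>t. free_log A Q (us ! t))"
  define c where "c = (\<lambda>t. ln (crt_cost A Q (take t us) (us ! t)))"
  define g where "g = (\<lambda>t. known_log A Q (take t us))"
  define w where "w = ln (real_of_int (prime_part (- Q) H))"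
  have usx: "us ! t \<in># Mx" if "t < k" for t using that mus us by (metis nth_mem_mset)
  have X: "us ! t \<noteq> a \<and> real_of_int \<bar>us ! t - a\<bar> \<le> real N" if t: "t < k" and a: "a \<in> A" for t a
  proof -
    have "us ! t \<in> {1..int N}" "a \<in> {1..int N}" using usx[OF t] a rg A by auto
    then have "\<bar>us ! t - a\<bar> \<le> int N" by auto
    then have "real_of_int \<bar>us ! t - a\<bar> \<le> real_of_int (int N)" by (simp only: of_int_le_iff)
    moreover have "us ! t \<noteq> a" using usx[OF t] a A disj by auto
    ultimately show ?thesis by simp
  qed
  have rest: "w = g t + ln (real_of_int (prime_part (- (Q \<union> pair_primes A (take t us))) H))" for t
    unfolding w_def g_def by (rule known_log_rest[OF finA Ane A(1) tQ])
  have gw: "g t \<le> w" for t unfolding rest[of t] by simp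
  have prof: "cost_profile k r (ln N) w S T c g"
    unfolding cost_profile_def
  proof (intro conjI allI impI)
    show "g 0 = 0" by (simp add: g_def known_log_def[OF finA Ane A(1) tQ] pair_primes_def prime_part_def)
    show "g t \<le> w" for t by (rule gw)
    fix t assume t: "t < k"
    show "0 \<le> S t" unfolding S_def by (rule hit_log_nonneg)
    show "S t \<le> T t" unfolding S_def T_def by (rule hit_le_free)
    show "T t \<le> r * ln N" unfolding T_def using free_log_le[of A "us ! t" "real N" Q] X[OF t] A by simp
    show "0 \<le> c t" unfolding c_def using crt_cost_ge_1[OF finA Ane, of Q "take t us" "us ! t"] by simp
    show "c t = 0 \<or> (c t + S t \<le> ln N \<and> r * (c t + S t) \<le> T t)"
      unfolding c_def S_def T_def using crt_cost_cases[OF finA Ane, of "us ! t" "real N" Q "take t us"] X[OF t] A by auto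
    show "r * g t - (\<Sum>s<t. T s) \<le> real (k - t) * S t"
      using gr[OF t] A us t unfolding S_def T_def g_def by (simp add: sum_list_map_take)
    show "g t + (T t - S t) \<le> g (Suc t)"
      unfolding g_def T_def S_def using known_log_step[OF finA Ane A(1) tQ usx[OF t], of "take t us"] t us
      by (simp add: take_Suc_conv_app_nth)
  qed
  \<comment> \<open>|H \<tau>(a)| is the product of the k differences |a - x|, each at most
    N.\<close>
  have "w + ln \<bar>real_of_int (poly \<tau> (hd as))\<bar> \<le> k * ln N"
  proof -
    define a where "a = hd as"
    have a: "a \<in># My" using as Ane A by (metis a_def hd_in_set list.set(1) subsetD)
    have "real_of_int (prime_part (- Q) H) \<le> real_of_int \<bar>H\<bar>" using prime_part_le[OF H0, of "- Q"] by linarith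
    then have "w \<le> ln (real_of_int \<bar>H\<bar>)" unfolding w_def by (subst ln_le_cancel_iff) (use H0 in auto)
    then have "w + ln \<bar>real_of_int (poly \<tau> a)\<bar> \<le> ln (real_of_int \<bar>H\<bar>) + ln (real_of_int \<bar>poly \<tau> a\<bar>)" by simp
    also have "\<dots> = ln (real_of_int \<bar>H * poly \<tau> a\<bar>)"
      using H0 tau_nonzero_right[OF a] by (simp add: abs_mult ln_mult_pos)
    also have "\<bar>H * poly \<tau> a\<bar> = (\<Prod>x\<in>#Mx. \<bar>a - x\<bar>)"
    proof -
      have ab: "\<bar>\<Prod>x\<in>#M. a - x\<bar> = (\<Prod>x\<in>#M. \<bar>a - x\<bar>)" for M by (induction M) (auto simp: abs_mult)
      show ?thesis unfolding value_right[OF a, symmetric] by (rule ab)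
    qed
    also have "ln (real_of_int (\<Prod>x\<in>#Mx. \<bar>a - x\<bar>)) = (\<Sum>x\<in>#Mx. ln (real_of_int \<bar>a - x\<bar>))"
      unfolding of_int_prod_mset by (rule ln_prod_mset) (use a disj in auto)
    also have "\<dots> \<le> (\<Sum>x\<in>#Mx. ln (real N))"
    proof (rule sum_mset_mono)
      fix x assume x: "x \<in># Mx"
      have "x \<in> {1..int N}" "a \<in> {1..int N}" using x a rg by auto
      then have "\<bar>a - x\<bar> \<le> int N" by auto
      then have "real_of_int \<bar>a - x\<bar> \<le> real_of_int (int N)" by (simp only: of_int_le_iff)
      moreover have "a \<noteq> x" using x a disj by auto
      ultimately show "ln (real_of_int \<bar>a - x\<bar>) \<le> ln (real N)" by (subst ln_le_cancel_iff) (use N in auto)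
    qed
    also have "\<dots> = k * ln N" using sz by simp
    finally show ?thesis by (simp add: a_def)
  qed
  moreover have "w - g t = ln (real_of_int (prime_part (- (Q \<union> pair_primes A (take t us))) H))" for t
    using rest[of t] by linarith
  ultimately have "arranged k d r N (Mx, My) as us w S T c g"
    unfolding arranged_def using as las A mus prof
    by (auto simp: c_def H_def[symmetric] \<tau>_def[symmetric] Q_def[symmetric])
  then show ?thesis by blast
qed

section \<open>The weight of the list that records a solution\<close>

lemma abs_base_int_le:
  assumes "set as \<subseteq> {1..int N}" "N \<ge> 1" "\<And>a. a \<in> set as \<Longrightarrow> \<bar>poly p a\<bar> \<le> int M * int N ^ d"
    and r: "length as = r"  and M: "M \<ge> 1"
  shows "\<bar>base_int as p\<bar> \<le> int M ^ r * int N ^ (r * r + d * r)"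
proof -
  have cr: "card (set as) \<le> r" using r card_length[of as] by simp
  have "\<bar>\<Prod>a\<in>set as. \<Prod>b\<in>set as - {a}. a - b\<bar> = (\<Prod>a\<in>set as. \<Prod>b\<in>set as - {a}. \<bar>a - b\<bar>)" by (simp add: abs_prod)
  also have "\<dots> \<le> (\<Prod>a\<in>set as. int N ^ r)"
  proof (intro prod_mono conjI prod_nonneg)
    fix a assume a: "a \<in> set as"
    have "(\<Prod>b\<in>set as - {a}. \<bar>a - b\<bar>) \<le> (\<Prod>b\<in>set as - {a}. int N)"
    proof (rule prod_mono)
      fix b assume b: "b \<in> set as - {a}"
      have "a \<in> {1..int N}" "b \<in> {1..int N}" using a b assms(1) by auto
      then show "0 \<le> \<bar>a - b\<bar> \<and> \<bar>a - b\<bar> \<le> int N" by auto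
    qed
    also have "\<dots> = int N ^ card (set as - {a})" by simp
    also have "\<dots> \<le> int N ^ r"
      using assms(2) cr card_mono[of "set as" "set as - {a}"] by (intro power_increasing) auto
    finally show "(\<Prod>b\<in>set as - {a}. \<bar>a - b\<bar>) \<le> int N ^ r" .
  qed auto
  also have "\<dots> = int N ^ (r * card (set as))" by (simp add: power_mult)
  also have "\<dots> \<le> int N ^ (r * r)" using assms(2) cr by (intro power_increasing) auto
  finally have 1: "\<bar>\<Prod>a\<in>set as. \<Prod>b\<in>set as - {a}. a - b\<bar> \<le> int N ^ (r * r)" .
  have "\<bar>\<Prod>a\<in>set as. poly p a\<bar> = (\<Prod>a\<in>set as. \<bar>poly p a\<bar>)" by (simp add: abs_prod)
  also have "\<dots> \<le> (\<Prod>a\<in>set as. int M * int N ^ d)" using assms(3) by (intro prod_mono) auto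
  also have "\<dots> = (int M * int N ^ d) ^ card (set as)" by simp
  also have "\<dots> \<le> (int M * int N ^ d) ^ r"
  proof (rule power_increasing[OF cr])
    have "int (M * N ^ d) \<ge> 1" using assms(2) M by (simp add: Suc_le_eq del: of_nat_mult)
    then show "1 \<le> int M * int N ^ d" by simp
  qed
  also have "\<dots> = int M ^ r * int N ^ (d * r)" by (simp add: power_mult_distrib power_mult)
  finally have 2: "\<bar>\<Prod>a\<in>set as. poly p a\<bar> \<le> int M ^ r * int N ^ (d * r)" .
  have "\<bar>base_int as p\<bar> \<le> int N ^ (r * r) * (int M ^ r * int N ^ (d * r))"
    unfolding base_int_def abs_mult using 1 2 by (intro mult_mono) auto
  then show ?thesis by (simp add: power_add mult_ac)
qed

lemma abs_row_int_le:
  assumes "set as \<subseteq> {1..int N}" "set us \<subseteq> {1..int N}" "N \<ge> 1"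
    "\<And>a. a \<in> set as \<union> set us \<Longrightarrow> \<bar>poly p a\<bar> \<le> int M * int N ^ d"
    and r: "length as = r" "length us = b" and M: "M \<ge> 1"
  shows "\<bar>row_int as p us\<bar> \<le> int M ^ (r + b) * int N ^ (r * r + d * r + d * b + r * b)"
proof -
  have cr: "card (set as) \<le> r" "card (set us) \<le> b" using r card_length[of as] card_length[of us] by simp_all
  have 1: "\<bar>base_int as p\<bar> \<le> int M ^ r * int N ^ (r * r + d * r)"
    using assms by (intro abs_base_int_le) auto
  have "\<bar>\<Prod>u\<in>set us. poly p u\<bar> = (\<Prod>u\<in>set us. \<bar>poly p u\<bar>)" by (simp add: abs_prod)
  also have "\<dots> \<le> (\<Prod>u\<in>set us. int M * int N ^ d)" using assms(4) by (intro prod_mono) auto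
  also have "\<dots> = (int M * int N ^ d) ^ card (set us)" by simp
  also have "\<dots> \<le> (int M * int N ^ d) ^ b"
  proof (rule power_increasing[OF cr(2)])
    have "int (M * N ^ d) \<ge> 1" using assms(3) M by (simp add: Suc_le_eq del: of_nat_mult)
    then show "1 \<le> int M * int N ^ d" by simp
  qed
  also have "\<dots> = int M ^ b * int N ^ (d * b)" by (simp add: power_mult_distrib power_mult)
  finally have 2: "\<bar>\<Prod>u\<in>set us. poly p u\<bar> \<le> int M ^ b * int N ^ (d * b)" .
  have "\<bar>\<Prod>u\<in>set us. \<Prod>a\<in>set as. u - a\<bar> = (\<Prod>u\<in>set us. \<Prod>a\<in>set as. \<bar>u - a\<bar>)" by (simp add: abs_prod)
  also have "\<dots> \<le> (\<Prod>u\<in>set us. \<Prod>a\<in>set as. int N)"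
  proof (intro prod_mono conjI prod_nonneg)
    fix u a assume "u \<in> set us" "a \<in> set as"
    then have "u \<in> {1..int N}" "a \<in> {1..int N}" using assms by auto
    then show "\<bar>u - a\<bar> \<le> int N" by auto
  qed auto
  also have "\<dots> = int N ^ (card (set as) * card (set us))" by (simp add: power_mult)
  also have "\<dots> \<le> int N ^ (r * b)" using assms(3) cr by (intro power_increasing mult_mono) auto
  finally have 3: "\<bar>\<Prod>u\<in>set us. \<Prod>a\<in>set as. u - a\<bar> \<le> int N ^ (r * b)" .
  have "\<bar>row_int as p us\<bar> \<le> (int M ^ r * int N ^ (r * r + d * r)) * (int M ^ b * int N ^ (d * b)) * int N ^ (r * b)"
    unfolding row_int_def abs_mult using 1 2 3 by (intro mult_mono) auto
  then show ?thesis by (simp add: power_add mult_ac)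
qed

lemma ln_tuple_weight:
  assumes len: "length as = r" "length Ds = r" "r \<ge> 1" and N: "N \<ge> 1" and M: "M \<ge> 1"
    and D0: "Ds ! 0 \<noteq> 0" and D: "\<And>l. l < r \<Longrightarrow> \<bar>Ds ! l\<bar> \<le> int (M * N ^ (d - l))"
    and us: "us \<noteq> []"
  shows "tuple_weight d M N q (as, Ds, us, ws) > 0"
    and "- ln (tuple_weight d M N q (as, Ds, us, ws)) \<le> real r * ln (real N) + ln \<bar>real_of_int (Ds ! 0)\<bar>
       + ((\<Sum>l=1..<r. real (d - l)) * ln (real N) + real r * ln (real (3 * M)))
       + (\<Sum>t<length us. ln (crt_cost (set as) (prime_factors (base_int as (newton_poly q as Ds))) (take t us) (us ! t)))
       + (\<Sum>t<length ws. ln (row_cost (prime_factors (row_int as (newton_poly q as Ds) us) \<union> pair_primes (set us) (take t ws)) us (ws ! t)))"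
proof -
  define cU where "cU = (\<lambda>t. crt_cost (set as) (prime_factors (base_int as (newton_poly q as Ds))) (take t us) (us ! t))"
  define cW where "cW = (\<lambda>t. row_cost (prime_factors (row_int as (newton_poly q as Ds) us) \<union> pair_primes (set us) (take t ws)) us (ws ! t))"
  define cD where "cD = (\<lambda>t. if t = 0 then \<bar>real_of_int (Ds ! 0)\<bar> else real (2 * M * N ^ (d - t) + 1))"
  have "as \<noteq> []" using len by auto
  then have cU: "cU t > 0" for t unfolding cU_def using crt_cost_ge_1[of "set as"] by (smt (verit) List.finite_set set_empty)
  have cW: "cW t > 0" for t unfolding cW_def using row_cost_ge_1[OF us] by (smt (verit))
  have cD: "cD t > 0" for t using D0 by (auto simp: cD_def simp flip: of_nat_mult of_nat_power)
  have dw: "diff_weight d M N (take t Ds) (Ds ! t) = 1 / cD t" if "t < r" for t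
    using D[OF that] D0 that len by (auto simp: diff_weight_def cD_def min_def)
  have w: "tuple_weight d M N q (as, Ds, us, ws) =
      (1 / real N ^ r) * ((\<Prod>t<r. 1 / cD t) * ((\<Prod>t<length us. 1 / cU t) * (\<Prod>t<length ws. 1 / cW t)))"
    using len by (simp add: tuple_weight_def cU_def cW_def dw)
  have pos: "(\<Prod>t<r. 1 / cD t) > 0" "(\<Prod>t<length us. 1 / cU t) > 0" "(\<Prod>t<length ws. 1 / cW t) > 0" "real N ^ r > 0"
    using cU cW cD N by (auto intro!: prod_pos)
  then show "tuple_weight d M N q (as, Ds, us, ws) > 0" unfolding w by (intro mult_pos_pos) auto
  have lnp: "ln (\<Prod>t<n. 1 / f t) = - (\<Sum>t<n. ln (f t))" if "\<And>t. f t > 0" for n and f :: "nat \<Rightarrow> real"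
  proof (induction n)
    case (Suc n)
    have "(\<Prod>t<n. 1 / f t) > 0" using that by (intro prod_pos) auto
    moreover have "ln (1 / f n) = - ln (f n)" using that[of n] by (simp add: ln_div)
    moreover have "ln (\<Prod>t<Suc n. 1 / f t) = ln (\<Prod>t<n. 1 / f t) + ln (1 / f n)"
      unfolding prod.lessThan_Suc using calculation(1) that[of n] by (intro ln_mult_pos) auto
    ultimately show ?case using Suc by simp
  qed simp
  have "ln (tuple_weight d M N q (as, Ds, us, ws)) = - (r * ln (real N)) - (\<Sum>t<r. ln (cD t)) - (\<Sum>t<length us. ln (cU t)) - (\<Sum>t<length ws. ln (cW t))"
  proof -
    have nz: "cD t \<noteq> 0" "cU t \<noteq> 0" "cW t \<noteq> 0" for t using cU cW cD by (metis less_irrefl)+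
    show ?thesis
      unfolding w using pos N by (simp add: nz ln_mult_pos ln_div ln_realpow lnp[OF cU] lnp[OF cD] lnp[OF cW])
  qed
  moreover have "(\<Sum>t<r. ln (cD t)) \<le> ln \<bar>real_of_int (Ds ! 0)\<bar> + ((\<Sum>l=1..<r. real (d - l)) * ln (real N) + real r * ln (real (3 * M)))"
  proof -
    have "{..<r} = insert 0 {1..<r}" using len(3) by auto
    then have "(\<Sum>t<r. ln (cD t)) = ln (cD 0) + (\<Sum>t=1..<r. ln (cD t))" by simp
    also have "(\<Sum>t=1..<r. ln (cD t)) \<le> (\<Sum>t=1..<r. real (d - t) * ln (real N) + ln (real (3 * M)))"
    proof (rule sum_mono)
      fix t assume t: "t \<in> {1..<r}"
      have "1 \<le> M * N ^ (d - t)" using M N by (simp add: Suc_le_eq)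
      then have "real (2 * M * N ^ (d - t) + 1) \<le> real (3 * M * N ^ (d - t))" by (subst of_nat_le_iff) simp
      then have "ln (cD t) \<le> ln (real (3 * M * N ^ (d - t)))"
        using t M N by (subst ln_le_cancel_iff) (auto simp: cD_def simp flip: of_nat_mult of_nat_power)
      also have "\<dots> = real (d - t) * ln (real N) + ln (real (3 * M))" using M N by (simp add: ln_mult_pos ln_realpow)
      finally show "ln (cD t) \<le> real (d - t) * ln (real N) + ln (real (3 * M))" .
    qed
    also have "\<dots> = (\<Sum>l=1..<r. real (d - l)) * ln (real N) + real (r - 1) * ln (real (3 * M))"
      by (simp add: sum.distrib sum_distrib_right)
    also have "\<dots> \<le> (\<Sum>l=1..<r. real (d - l)) * ln (real N) + real r * ln (real (3 * M))"
      using M by (intro add_left_mono mult_right_mono) auto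
    finally show ?thesis by (simp add: cD_def)
  qed
  ultimately show "- ln (tuple_weight d M N q (as, Ds, us, ws)) \<le> real r * ln (real N) + ln \<bar>real_of_int (Ds ! 0)\<bar>
       + ((\<Sum>l=1..<r. real (d - l)) * ln (real N) + real r * ln (real (3 * M)))
       + (\<Sum>t<length us. ln (crt_cost (set as) (prime_factors (base_int as (newton_poly q as Ds))) (take t us) (us ! t)))
       + (\<Sum>t<length ws. ln (row_cost (prime_factors (row_int as (newton_poly q as Ds) us) \<union> pair_primes (set us) (take t ws)) us (ws ! t)))"
    unfolding cU_def cW_def by linarith
qed

lemma card_le_fibers:
  assumes "finite G" "\<And>y. y \<in> f ` G \<Longrightarrow> card {x\<in>G. f x = y} \<le> F"
  shows "card G \<le> F * card (f ` G)"
proof -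
  have "card G = (\<Sum>y\<in>f ` G. card {x\<in>G. f x = y})"
    using sum.group[of G "f ` G" f "\<lambda>_. 1::nat"] assms(1) by simp
  also have "\<dots> \<le> (\<Sum>y\<in>f ` G. F)" using assms(2) by (intro sum_mono) auto
  finally show ?thesis by (simp add: mult.commute)
qed

lemma base_int_cong: "(\<And>a. a \<in> set as \<Longrightarrow> poly p a = poly p' a) \<Longrightarrow> base_int as p = base_int as p'"
  unfolding base_int_def by (intro arg_cong2[where f = "(*)"] refl prod.cong) auto

lemma newton_poly_full:
  assumes "degree p = d" "lead_coeff p = 1" "d \<le> length as"
  shows "newton_poly (if length as = d then 1 else 0) as (div_diffs p as) = p"
  using newton_poly_div_diffs[of p as] div_quot_const[OF assms] by simp

text \<open>A family of solutions is counted through its arrangements: \<open>m = 0\<close> stops after \<open>b\<close> of the \<open>x\<^sub>t\<close>,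
  \<open>m = k - r\<close> continues with all the remaining \<open>y\<^sub>t\<close>.\<close>

definition arranged_count :: "nat \<Rightarrow> nat \<Rightarrow> nat \<Rightarrow> nat \<Rightarrow> nat \<Rightarrow> real \<Rightarrow> real \<Rightarrow> real \<Rightarrow> real \<Rightarrow> bool" where
  "arranged_count k d r b m e K \<epsilon> C \<longleftrightarrow> (\<forall>N\<ge>1. \<forall>G A U F. G \<subseteq> sol_pairs k d N \<longrightarrow>
      (\<forall>z\<in>G. \<exists>w S T c g. arranged k d r N z (A z) (U z) w S T c g \<and>
          ln \<bar>real_of_int (poly (tau_poly d (snd z)) (hd (A z)))\<bar> + (\<Sum>t<b. c t) + (if m = 0 then 0 else (w - g b) / b) \<le> e * ln N + K) \<longrightarrow>
      (\<forall>z\<in>G. card {z'\<in>G. A z' = A z \<and> take b (U z') = take b (U z) \<and> (m = 0 \<or> snd z' = snd z)} \<le> F) \<longrightarrow>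
      real (card G) \<le> C * real F * real N powr (real r + (\<Sum>l=1..<r. real (d - l)) + e + \<epsilon>))"

lemma arranged_countD:
  assumes "arranged_count k d r b m e K \<epsilon> C" "N \<ge> 1" "G \<subseteq> sol_pairs k d N"
    "\<And>z. z \<in> G \<Longrightarrow> \<exists>w S T c g. arranged k d r N z (A z) (U z) w S T c g \<and>
          ln \<bar>real_of_int (poly (tau_poly d (snd z)) (hd (A z)))\<bar> + (\<Sum>t<b. c t) + (if m = 0 then 0 else (w - g b) / b) \<le> e * ln N + K"
    "\<And>z. z \<in> G \<Longrightarrow> card {z'\<in>G. A z' = A z \<and> take b (U z') = take b (U z) \<and> (m = 0 \<or> snd z' = snd z)} \<le> F"
  shows "real (card G) \<le> C * real F * real N powr (real r + (\<Sum>l=1..<r. real (d - l)) + e + \<epsilon>)"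
  using assms unfolding arranged_count_def by meson

text \<open>The list of a solution has weight at least 1 / Y, where Y is a constant times N to the
  cost exponent, and all weights together are O(N powr \<epsilon>). So there are O(Y N powr
  \<epsilon>) lists, and each comes from at most F solutions. The second phase needs \<tau> at the
  listed x, hence d <= r, so that the differences determine \<tau>.\<close>

lemma card_arranged_le:
  fixes k d r b m :: nat and \<epsilon> e K :: real
  assumes eps: "\<epsilon> > 0" and dk: "2 * d < k" and r: "1 \<le> r" and b: "1 \<le> b" "b \<le> k"
    and m: "m = 0 \<or> (m = k - r \<and> d \<le> r)"
  shows "\<exists>C\<ge>0. arranged_count k d r b m e K \<epsilon> C"
proof -
  define q :: "int poly" where "q = (if r = d then 1 else 0)"
  define M0 where "M0 = (d + 1) * 2 ^ k"
  define M where "M = 2 ^ k * (d + 1) ^ r"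
  \<comment> \<open>One number dominating every size involved: the coefficient and the exponent in
    the bounds for \<open>base_int\<close> and \<open>row_int\<close>, and the lengths of the
    lists.\<close>
  define c0 where "c0 = M0 ^ (r + b) + (r * r + d * r + d * b + r * b) + r + b + b * m"
  have M0: "M0 \<ge> 1" and M1: "M \<ge> 1" by (auto simp: M0_def M_def Suc_le_eq)
  obtain C1 where C1: "C1 \<ge> 1" and sumw: "\<And>N. N \<ge> 1 \<Longrightarrow>
     (\<Sum>z\<in>tuples d M c0 N r q b m (M * N ^ d). tuple_weight d M N q z) \<le> C1 * real N powr \<epsilon>"
  proof (rule sum_tuple_weight_le[OF eps r, of c0 b m d M q])
    show "r \<le> c0" "r * b \<le> c0" "b \<le> c0" "b * m \<le> c0" by (auto simp: c0_def)
  qed (use b in auto)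
  define K' where "K' = real r * ln (real (3 * M)) + K"
  define C where "C = exp K' * C1"
  have bound: "real (card G) \<le> C * real F * real N powr (real r + (\<Sum>l=1..<r. real (d - l)) + e + \<epsilon>)"
    if N: "N \<ge> 1" and G: "G \<subseteq> sol_pairs k d N" and arr: "\<And>z. z \<in> G \<Longrightarrow> \<exists>w S T c g. arranged k d r N z (A z) (U z) w S T c g \<and>
          ln \<bar>real_of_int (poly (tau_poly d (snd z)) (hd (A z)))\<bar> + (\<Sum>t<b. c t) + (if m = 0 then 0 else (w - g b) / b) \<le> e * ln N + K"
      and F: "\<And>z. z \<in> G \<Longrightarrow> card {z'\<in>G. A z' = A z \<and> take b (U z') = take b (U z) \<and> (m = 0 \<or> snd z' = snd z)} \<le> F"
    for N G A U F
  proof -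
    have finG: "finite G" using G finite_sol_pairs finite_subset by blast
    define W where "W = (\<lambda>z. if m = 0 then [] else (SOME ws. mset ws = snd z - mset (A z)))"
    define D where "D = (\<lambda>z. div_diffs (tau_poly d (snd z)) (A z))"
    define f where "f = (\<lambda>z. (A z, D z, take b (U z), W z))"
    define E where "E = real r + (\<Sum>l=1..<r. real (d - l)) + e"
    define Y where "Y = exp K' * real N powr E"
    have main: "f z \<in> tuples d M c0 N r q b m (M * N ^ d) \<and> tuple_weight d M N q (f z) \<ge> 1 / Y
        \<and> mset (A z) \<subseteq># snd z \<and> (m \<noteq> 0 \<longrightarrow> mset (W z) = snd z - mset (A z))"
      if z: "z \<in> G" for z
    proof -
      obtain Mx My where zz: "z = (Mx, My)" by (cases z)
      define H where "H = jump k d Mx My"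
      define \<tau> where "\<tau> = tau_poly d My"
      have zs: "(Mx, My) \<in> sol_pairs k d N" using z G zz by auto
      interpret split_system Mx My H \<tau> unfolding H_def \<tau>_def by (rule sol_split[OF zs dk])
      have sz: "size Mx = k" "size My = k" and rg: "set_mset Mx \<subseteq> {1..int N}" "set_mset My \<subseteq> {1..int N}"
        using zs by (auto simp: sol_pairs_def psum_sys_def)
      define as where "as = A z"
      define us where "us = U z"
      define Ds where "Ds = div_diffs \<tau> as"
      obtain w S T c g where ar: "arranged k d r N (Mx, My) as us w S T c g"
        and cost: "ln \<bar>real_of_int (poly \<tau> (hd as))\<bar> + (\<Sum>t<b. c t) + (if m = 0 then 0 else (w - g b) / b) \<le> e * ln N + K"
        using arr[OF z] zz unfolding as_def us_def \<tau>_def by auto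
      have as: "distinct as" "length as = r" "set as \<subseteq> set_mset My" and us: "mset us = Mx"
        using ar by (auto simp: arranged_def)
      have lus: "length us = k" using us sz by (metis size_mset)
      have ct: "c t = ln (crt_cost (set as) (prime_factors (base_int as \<tau>)) (take t us) (us ! t))" if "t < k" for t
        using ar that by (auto simp: arranged_def \<tau>_def)
      have wg: "w - g t = ln (prime_part (- (prime_factors (base_int as \<tau>) \<union> pair_primes (set as) (take t us))) H)" if "t \<le> k" for t
        using ar that by (auto simp: arranged_def \<tau>_def H_def)
      define us' where "us' = take b us"
      have lus': "length us' = b" using lus b by (simp add: us'_def)
      have us'x: "set us' \<subseteq> set_mset Mx" using us by (metis set_take_subset us'_def set_mset_mset)
      have asr: "set as \<subseteq> {1..int N}" using as rg by auto
      have usr: "set us' \<subseteq> {1..int N} - set as" using us'x rg as disj by auto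
      define p where "p = newton_poly q as Ds"
      have pv: "poly p a = poly \<tau> a" if "a \<in> set as" for a
        unfolding p_def Ds_def using poly_newton_poly_div_diffs[OF that] .
      have bi: "base_int as p = base_int as \<tau>" using pv by (rule base_int_cong)
      have bnz: "base_int as \<tau> \<noteq> 0" using as tau_nonzero_right by (intro base_int_nonzero) auto
      have tb: "\<bar>poly \<tau> a\<bar> \<le> int M0 * int N ^ d" if "a \<in> {1..int N}" for a
        using poly_tau_bound[OF rg(2) N, of a d] that sz by (simp add: \<tau>_def M0_def)
      have Nle: "int N ^ i \<le> int N ^ c0" if "i \<le> c0" for i using that N by (intro power_increasing) auto
      have b1: "real_of_int \<bar>base_int as \<tau>\<bar> \<le> real c0 * real N ^ c0"
      proof -
        have "\<bar>base_int as \<tau>\<bar> \<le> int M0 ^ r * int N ^ (r * r + d * r)"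
          using asr tb as N M0 by (intro abs_base_int_le) auto
        also have "\<dots> \<le> int c0 * int N ^ c0"
        proof (intro mult_mono Nle)
          have "M0 ^ r \<le> M0 ^ (r + b)" using M0 by (intro power_increasing) auto
          then show "int M0 ^ r \<le> int c0" unfolding c0_def of_nat_power[symmetric] of_nat_le_iff by simp
        qed (auto simp: c0_def)
        finally have "real_of_int \<bar>base_int as \<tau>\<bar> \<le> real_of_int (int c0 * int N ^ c0)" by (simp only: of_int_le_iff)
        then show ?thesis by simp
      qed
      have wbd: "weighted_bound d (2 ^ k) N \<tau>"
        unfolding \<tau>_def sz(2)[symmetric] using rg by (intro weighted_bound_tau) force
      have Db: "\<bar>Ds ! l\<bar> \<le> int (M * N ^ (d - l))" if "l < r" for l
        using div_diffs_bound[OF wbd, of as l] asr N that as unfolding Ds_def M_def by force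
      have Dset: "set Ds \<subseteq> {- int (M * N ^ d)..int (M * N ^ d)}"
      proof
        fix D assume "D \<in> set Ds"
        then obtain l where l: "l < r" "D = Ds ! l" using as by (auto simp: in_set_conv_nth Ds_def)
        have "M * N ^ (d - l) \<le> M * N ^ d" using N by (intro mult_left_mono power_increasing) auto
        then have "\<bar>D\<bar> \<le> int (M * N ^ d)" using Db[OF l(1)] l(2) by (meson of_nat_le_iff order_trans)
        then show "D \<in> {- int (M * N ^ d)..int (M * N ^ d)}" by auto
      qed
      have asne: "as \<noteq> []" using as r by auto
      then obtain a as' where ca: "as = a # as'" by (cases as) auto
      have D0: "Ds ! 0 = poly \<tau> (hd as)" by (simp add: Ds_def ca)
      have D0n: "Ds ! 0 \<noteq> 0" unfolding D0 using tau_nonzero_right as ca by auto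
      have us'ne: "us' \<noteq> []" using lus' b by auto
      define ws where "ws = W z"
      have sub: "mset as \<subseteq># My"
        using as(1,3) by (metis mset_set_set mset_subset_eq_exists_conv mset_set_set_mset_msubset subset_imp_msubset_mset_set finite_set_mset subset_mset.order_trans)
      have ws: "mset ws = My - mset as" if "m \<noteq> 0"
        using that someI_ex[OF ex_mset[of "My - mset as"]] zz by (simp add: ws_def W_def as_def)
      have lws: "length ws = m"
      proof (cases "m = 0")
        case False
        have "length ws = size (My - mset as)" using ws[OF False] by (metis size_mset)
        also have "\<dots> = k - r" using sub as sz by (simp add: size_Diff_submset)
        finally show ?thesis using m False by simp
      qed (simp add: ws_def W_def)
      have wsM: "mset ws \<subseteq># My"
      proof (cases "m = 0")
        case False
        then show ?thesis using ws by simp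
      qed (simp add: ws_def W_def)
      have wsr: "set ws \<subseteq> {1..int N} - set us'"
      proof -
        have "set ws \<subseteq> set_mset My" using wsM by (metis set_mset_mono set_mset_mset)
        then show ?thesis using rg us'x disj by auto
      qed
      have pt: "p = \<tau>" if "m \<noteq> 0"
        using newton_poly_full[of \<tau> d as] as m that degree_tau_poly[of d My] unfolding p_def q_def Ds_def \<tau>_def by auto
      have rowok: "row_int as p us' \<noteq> 0 \<and> real_of_int \<bar>row_int as p us'\<bar> \<le> real c0 * real N ^ c0" if "m \<noteq> 0"
      proof
        have nz: "poly \<tau> u \<noteq> 0" if "u \<in> set us'" for u using that us'x tau_nonzero_left by auto
        then show "row_int as p us' \<noteq> 0" unfolding pt[OF that] row_int_def using bnz usr by auto
        have "\<bar>row_int as \<tau> us'\<bar> \<le> int M0 ^ (r + b) * int N ^ (r * r + d * r + d * b + r * b)"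
          using asr usr tb as N M0 lus' by (intro abs_row_int_le) auto
        also have "\<dots> \<le> int c0 * int N ^ c0"
        proof (intro mult_mono Nle)
          show "int M0 ^ (r + b) \<le> int c0" unfolding c0_def of_nat_power[symmetric] of_nat_le_iff by simp
        qed (auto simp: c0_def)
        finally have "real_of_int \<bar>row_int as \<tau> us'\<bar> \<le> real_of_int (int c0 * int N ^ c0)" by (simp only: of_int_le_iff)
        then show "real_of_int \<bar>row_int as p us'\<bar> \<le> real c0 * real N ^ c0" using pt[OF that] by simp
      qed
      have fz: "f z = (as, Ds, us', ws)" by (simp add: f_def as_def Ds_def D_def us'_def us_def ws_def \<tau>_def zz)
      have "f z \<in> tuples d M c0 N r q b m (M * N ^ d)"
        unfolding fz tuples_def using as asr Dset bnz b1 usr lus' rowok wsr lws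
        by (auto simp: p_def[symmetric] bi Ds_def[symmetric] simp del: of_nat_mult of_nat_power) (auto simp: Ds_def)
      moreover have "tuple_weight d M N q (f z) \<ge> 1 / Y"
      proof -
        have wpos: "tuple_weight d M N q (f z) > 0"
          unfolding fz by (rule ln_tuple_weight(1)[where r = r]) (use as D0n Db us'ne N M1 r in \<open>auto simp: Ds_def\<close>)
        have row: "(\<Sum>t<length ws. ln (row_cost (prime_factors (row_int as p us') \<union> pair_primes (set us') (take t ws)) us' (ws ! t)))
            \<le> (if m = 0 then 0 else (w - g b) / b)"
        proof (cases "m = 0")
          case False
          define KK where "KK = prime_factors (row_int as \<tau> us')"
          have rnz: "row_int as \<tau> us' \<noteq> 0" using rowok pt False by auto
          have d1: "base_int as \<tau> dvd row_int as \<tau> us'" unfolding row_int_def by (simp add: dvd_mult2)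
          have d2: "poly \<tau> u dvd row_int as \<tau> us'" if "u \<in> set us'" for u
          proof -
            have "poly \<tau> u dvd (\<Prod>u\<in>set us'. poly \<tau> u)" using that by (intro dvd_prodI) auto
            then show ?thesis unfolding row_int_def by (simp add: dvd_mult2 dvd_mult)
          qed
          have d3: "u - a dvd row_int as \<tau> us'" if "u \<in> set us'" "a \<in> set as" for u a
          proof -
            have "u - a dvd (\<Prod>a\<in>set as. u - a)" using that by (intro dvd_prodI) auto
            also have "\<dots> dvd (\<Prod>u\<in>set us'. \<Prod>a\<in>set as. u - a)"
              using that by (intro dvd_prodI[where f = "\<lambda>u. \<Prod>a\<in>set as. u - a"]) auto
            finally show ?thesis unfolding row_int_def by (rule dvd_mult)
          qed
          \<comment> \<open>Every prime known after the first phase divides \<open>row_int\<close>,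
            so the part of H free of these primes is at most exp (w - g b).\<close>
          have "prime_factors (base_int as \<tau>) \<union> pair_primes (set as) us' \<subseteq> KK"
            unfolding KK_def pair_primes_def using dvd_prime_factors[OF rnz] d1 d3 by blast
          then have "prime_part (- KK) H \<le> prime_part (- (prime_factors (base_int as \<tau>) \<union> pair_primes (set as) us')) H"
            by (intro prime_part_mono) auto
          then have "ln (real_of_int (prime_part (- KK) H)) \<le> w - g b"
            unfolding wg[OF b(2)] us'_def[symmetric] by (subst ln_le_cancel_iff) auto
          then have "ln (real_of_int (prime_part (- KK) H)) / length us' \<le> (w - g b) / b"
            unfolding lus' by (intro divide_right_mono) auto
          moreover have "(\<Sum>t<length ws. ln (row_cost (KK \<union> pair_primes (set us') (take t ws)) us' (ws ! t)))
              \<le> ln (prime_part (- KK) H) / length us'"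
          proof (rule row_cost_sum_le[OF _ us'ne wsM])
            have "mset (take b us) \<subseteq># mset (take b us @ drop b us)" by (simp only: mset_append mset_subset_eq_add_left)
            then show "mset us' \<subseteq># Mx" using us by (simp add: us'_def)
            show "prime_factors (poly \<tau> u) \<subseteq> KK" if "u \<in> set us'" for u
              unfolding KK_def using dvd_prime_factors[OF rnz d2[OF that]] .
          qed
          ultimately show ?thesis using False pt unfolding KK_def by auto
        qed (simp add: ws_def W_def)
        have "- ln (tuple_weight d M N q (f z)) \<le> r * ln N + ln \<bar>real_of_int (Ds ! 0)\<bar>
           + ((\<Sum>l=1..<r. real (d - l)) * ln (real N) + real r * ln (real (3 * M))) + (\<Sum>t<length us'. ln (crt_cost (set as) (prime_factors (base_int as p)) (take t us') (us' ! t)))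
           + (\<Sum>t<length ws. ln (row_cost (prime_factors (row_int as p us') \<union> pair_primes (set us') (take t ws)) us' (ws ! t)))"
          unfolding fz p_def
          by (rule ln_tuple_weight(2)[where r = r and as = as and Ds = Ds and us = us' and ws = ws and M = M and N = N])
            (use as D0n Db us'ne N M1 r in \<open>auto simp: Ds_def\<close>)
        also have "(\<Sum>t<length us'. ln (crt_cost (set as) (prime_factors (base_int as p)) (take t us') (us' ! t))) = (\<Sum>t<b. c t)"
          unfolding lus' bi using ct b by (intro sum.cong) (auto simp: us'_def min_def)
        finally have "- ln (tuple_weight d M N q (f z)) \<le> E * ln N + K'"
          using row cost D0 by (simp add: E_def K'_def algebra_simps)
        then have "ln (1 / Y) \<le> ln (tuple_weight d M N q (f z))"
          using N by (simp add: Y_def ln_div ln_mult_pos ln_powr)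
        then show ?thesis using wpos N by (subst (asm) ln_le_cancel_iff) (auto simp: Y_def)
      qed
      ultimately show ?thesis using sub ws zz by (auto simp: as_def ws_def)
    qed
    have "card G \<le> F * card (f ` G)"
    proof (rule card_le_fibers[OF finG])
      fix y assume "y \<in> f ` G"
      then obtain z where z: "z \<in> G" "y = f z" by auto
      have "{x\<in>G. f x = y} \<subseteq> {z'\<in>G. A z' = A z \<and> take b (U z') = take b (U z) \<and> (m = 0 \<or> snd z' = snd z)}"
      proof
        fix x assume "x \<in> {x\<in>G. f x = y}"
        then have x: "x \<in> G" "A x = A z" "take b (U x) = take b (U z)" "W x = W z" using z by (auto simp: f_def)
        have "snd x = snd z" if "m \<noteq> 0"
        proof -
          have "snd x - mset (A x) = snd z - mset (A z)" using main[OF x(1)] main[OF z(1)] x(4) that by simp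
          then show ?thesis using main[OF x(1)] main[OF z(1)] x(2) by (metis subset_mset.diff_add)
        qed
        then show "x \<in> {z'\<in>G. A z' = A z \<and> take b (U z') = take b (U z) \<and> (m = 0 \<or> snd z' = snd z)}" using x by auto
      qed
      then have "card {x\<in>G. f x = y} \<le> card {z'\<in>G. A z' = A z \<and> take b (U z') = take b (U z) \<and> (m = 0 \<or> snd z' = snd z)}"
        using finG by (intro card_mono) auto
      also have "\<dots> \<le> F" using F[OF z(1)] .
      finally show "card {x\<in>G. f x = y} \<le> F" .
    qed
    then have "real (card G) \<le> real F * real (card (f ` G))" by (metis of_nat_le_iff of_nat_mult)
    also have "real (card (f ` G)) \<le> Y * (C1 * real N powr \<epsilon>)"
    proof -
      have Y: "Y > 0" using N by (simp add: Y_def)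
      have "real (card (f ` G)) = (\<Sum>z\<in>f ` G. 1)" by simp
      also have "\<dots> \<le> (\<Sum>z\<in>f ` G. Y * tuple_weight d M N q z)"
      proof (rule sum_mono)
        fix z assume "z \<in> f ` G"
        then have "tuple_weight d M N q z \<ge> 1 / Y" using main by auto
        then show "1 \<le> Y * tuple_weight d M N q z" using Y by (simp add: field_simps)
      qed
      also have "\<dots> = Y * (\<Sum>z\<in>f ` G. tuple_weight d M N q z)" by (simp add: sum_distrib_left)
      also have "\<dots> \<le> Y * (\<Sum>z\<in>tuples d M c0 N r q b m (M * N ^ d). tuple_weight d M N q z)"
      proof (intro mult_left_mono sum_mono2 finite_tuples)
        show "f ` G \<subseteq> tuples d M c0 N r q b m (M * N ^ d)" using main by auto
        fix x assume "x \<in> tuples d M c0 N r q b m (M * N ^ d) - f ` G"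
        then obtain as Ds us ws where x: "x = (as, Ds, us, ws)" "length as = r" "length us = b" by (auto simp: tuples_def)
        have ne: "as \<noteq> []" "us \<noteq> []" using x r b by auto
        have cc: "0 \<le> 1 / crt_cost (set as) Q h p'" for Q h p'
          using crt_cost_ge_1[of "set as" Q h p'] ne by simp
        have rc: "0 \<le> 1 / row_cost KK us p'" for KK p' using row_cost_ge_1[OF ne(2), of KK p'] by simp
        have dw: "0 \<le> diff_weight d M N h p'" for h p' by (simp add: diff_weight_def)
        have "0 \<le> 1 / real N ^ length as" by simp
        then show "0 \<le> tuple_weight d M N q x" unfolding x tuple_weight_def prod.case
          by (intro mult_nonneg_nonneg prod_nonneg cc rc dw)
      qed (use Y in auto)
      also have "\<dots> \<le> Y * (C1 * real N powr \<epsilon>)" using sumw[OF N] Y by (intro mult_left_mono) auto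
      finally show ?thesis .
    qed
    finally have "real (card G) \<le> real F * (Y * (C1 * real N powr \<epsilon>))" by (simp add: mult_left_mono)
    also have "\<dots> = C * real F * real N powr (E + \<epsilon>)" by (simp add: C_def Y_def powr_add mult_ac)
    finally show ?thesis by (simp add: E_def)
  qed
  have C0: "C \<ge> 0" using C1 by (simp add: C_def)
  show ?thesis
    unfolding arranged_count_def
  proof (intro exI[of _ C] conjI C0 allI impI, goal_cases)
    case (1 N G A U F)
    show ?case by (rule bound[OF 1(1,2), where A = A and U = U and F = F]) (use 1(3,4) in blast)+
  qed
qed

section \<open>Exponents for solutions without common values\<close>

definition solution_bound :: "nat \<Rightarrow> nat \<Rightarrow> real \<Rightarrow> bool" where
  "solution_bound k d E \<longleftrightarrow> (\<forall>\<epsilon>>0. \<exists>C\<ge>0. \<forall>N\<ge>1. real (card (sol_pairs k d N)) \<le> C * real N powr (E + \<epsilon>))"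

text \<open>These solutions do not offer r base points. The values of the y, padded with 1 to a list
  of length r - 1, their multiplicities, and one x determine the solution by
  \<open>sol_decode\<close> with the sides exchanged.\<close>

lemma card_few_values_le:
  assumes dk: "2 * d < k" and N: "N \<ge> 1" and r: "r \<ge> 1"
  shows "card {z \<in> sol_pairs k d N. card (set_mset (snd z)) < r} \<le> (k + 1) ^ (r - 1) * N ^ r"
proof -
  define G where "G = {z \<in> sol_pairs k d N. card (set_mset (snd z)) < r}"
  define P where "P = (\<lambda>(z :: int multiset \<times> int multiset) l. set l \<subseteq> {1..int N} \<and> length l = r - 1 \<and> set_mset (snd z) \<subseteq> set l)"
  have ex: "\<exists>l. P z l" if z: "z \<in> G" for z
  proof -
    obtain l where l: "set l = set_mset (snd z)" "distinct l" using finite_distinct_list[of "set_mset (snd z)"] by auto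
    have "length l \<le> r - 1" using l z distinct_card[OF l(2)] by (auto simp: G_def)
    moreover have "set l \<subseteq> {1..int N}" using l z by (auto simp: G_def sol_pairs_def)
    ultimately have "P z (l @ replicate (r - 1 - length l) 1)" using l N by (auto simp: P_def)
    then show ?thesis by blast
  qed
  define l where "l = (\<lambda>z. SOME l. P z l)"
  have l: "P z (l z)" if "z \<in> G" for z unfolding l_def using ex[OF that] by (rule someI_ex)
  define x where "x = (\<lambda>z::int multiset \<times> int multiset. SOME x. x \<in># fst z)"
  have x: "x z \<in># fst z" if z: "z \<in> G" for z
  proof -
    have "fst z \<noteq> {#}" using z dk by (auto simp: G_def sol_pairs_def psum_sys_def)
    then show ?thesis unfolding x_def by (metis multiset_nonemptyE someI)
  qed
  define f where "f = (\<lambda>z. (l z, map (count (snd z)) (l z), x z))"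
  have inj: "inj_on f G"
  proof (rule inj_onI)
    fix z z' assume z: "z \<in> G" "z' \<in> G" "f z = f z'"
    then have e: "l z = l z'" "map (count (snd z)) (l z) = map (count (snd z')) (l z)" "x z = x z'" by (auto simp: f_def)
    have "count (snd z) a = count (snd z') a" for a
    proof (cases "a \<in> set (l z)")
      case True
      then show ?thesis using e(2) by simp
    next
      case False
      then have "a \<notin># snd z" "a \<notin># snd z'" using l[OF z(1)] l[OF z(2)] e(1) by (auto simp: P_def)
      then show ?thesis by (simp only: not_in_iff)
    qed
    then have s: "snd z = snd z'" by (simp add: multiset_eq_iff)
    have "(fst z, snd z) \<in> sol_pairs k d N" "(fst z', snd z') \<in> sol_pairs k d N" using z by (auto simp: G_def)
    then have "(snd z, fst z) \<in> sol_pairs k d N" "(snd z, fst z') \<in> sol_pairs k d N"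
      unfolding s by (auto intro: sol_pairs_swap)
    then have "fst z = fst z'" using sol_decode[OF _ _ dk] x[OF z(1)] x[OF z(2)] e(3) by metis
    then show "z = z'" using s by (rule prod_eqI)
  qed
  have "f ` G \<subseteq> {l. set l \<subseteq> {1..int N} \<and> length l = r - 1} \<times> ({l. set l \<subseteq> {0..k} \<and> length l = r - 1} \<times> {1..int N})"
  proof
    fix y assume "y \<in> f ` G"
    then obtain z where z: "z \<in> G" "y = f z" by auto
    have "count (snd z) a \<le> k" for a
      using z count_le_size[of "snd z" a] by (auto simp: G_def sol_pairs_def psum_sys_def)
    then show "y \<in> {l. set l \<subseteq> {1..int N} \<and> length l = r - 1} \<times> ({l. set l \<subseteq> {0..k} \<and> length l = r - 1} \<times> {1..int N})"
      using l[OF z(1)] x[OF z(1)] z by (auto simp: f_def P_def G_def sol_pairs_def)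
  qed
  then have "card (f ` G) \<le> card ({l. set l \<subseteq> {1..int N} \<and> length l = r - 1} \<times> ({l. set l \<subseteq> {0..k} \<and> length l = r - 1} \<times> {1..int N}))"
    by (intro card_mono finite_cartesian_product finite_lists_length_eq) auto
  also have "\<dots> = N ^ (r - 1) * ((k + 1) ^ (r - 1) * N)"
    using card_lists_length_eq[of "{1..int N}" "r - 1"] card_lists_length_eq[of "{0..k}" "r - 1"]
    by (simp add: card_cartesian_product)
  also have "\<dots> = (k + 1) ^ (r - 1) * N ^ r" using r by (cases r) (auto simp: mult_ac)
  finally show ?thesis using card_image[OF inj] by (simp add: G_def)
qed

text \<open>A multiset of size k has fewer than k + 1 distinct values, so
  \<open>card_few_values_le\<close> with r = k + 1 covers everything.\<close>

lemma solution_bound_trivial: "2 * d < k \<Longrightarrow> solution_bound k d (real k + 1)"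
  unfolding solution_bound_def
proof (intro allI impI exI conjI)
  fix \<epsilon> :: real and N :: nat assume a: "2 * d < k" "\<epsilon> > 0" "1 \<le> N"
  have "card (set_mset M) < k + 1" if "size M = k" for M :: "int multiset"
    using that size_mset_mono[OF mset_set_set_mset_msubset[of M]] by simp
  then have e: "{z \<in> sol_pairs k d N. card (set_mset (snd z)) < k + 1} = sol_pairs k d N"
    by (auto simp: sol_pairs_def psum_sys_def)
  have "real (card (sol_pairs k d N)) \<le> real ((k + 1) ^ k * N ^ (k + 1))"
    using card_few_values_le[OF a(1,3), of "k + 1"] unfolding e by (simp only: of_nat_le_iff) simp
  also have "\<dots> = real ((k + 1) ^ k) * real N powr (real k + 1)"
    using a powr_realpow[of "real N" "k + 1"] by (simp add: add.commute)
  also have "\<dots> \<le> real ((k + 1) ^ k) * real N powr (real k + 1 + \<epsilon>)"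
    using a by (intro mult_left_mono powr_mono) auto
  finally show "real (card (sol_pairs k d N)) \<le> real ((k + 1) ^ k) * real N powr (real k + 1 + \<epsilon>)" .
qed auto

text \<open>Finitely many families have to cover only the solutions with at least r distinct y. The
  others number O(N^r), whence E >= r.\<close>

lemma solution_boundI:
  fixes E :: real and r :: nat
  assumes dk: "2 * d < k" and r: "r \<ge> 1" and E: "E \<ge> r" and I: "finite I"
    and cover: "\<And>N z. N \<ge> 1 \<Longrightarrow> z \<in> sol_pairs k d N \<Longrightarrow> r \<le> card (set_mset (snd z)) \<Longrightarrow> \<exists>i\<in>I. z \<in> G i N"
    and sub: "\<And>i N. i \<in> I \<Longrightarrow> G i N \<subseteq> sol_pairs k d N"
    and bnd: "\<And>i \<epsilon>. i \<in> I \<Longrightarrow> \<epsilon> > 0 \<Longrightarrow> \<exists>C\<ge>0. \<forall>N\<ge>1. real (card (G i N)) \<le> C * real N powr (E + \<epsilon>)"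
  shows "solution_bound k d E"
  unfolding solution_bound_def
proof (intro allI impI)
  fix \<epsilon> :: real assume eps: "\<epsilon> > 0"
  obtain C where C: "\<And>i. i \<in> I \<Longrightarrow> C i \<ge> 0 \<and> (\<forall>N\<ge>1. real (card (G i N)) \<le> C i * real N powr (E + \<epsilon>))"
    using bnd[OF _ eps] by metis
  define C' where "C' = (\<Sum>i\<in>I. C i) + real ((k + 1) ^ (r - 1))"
  have C'0: "C' \<ge> 0" using C by (auto simp: C'_def intro!: add_nonneg_nonneg sum_nonneg)
  have "real (card (sol_pairs k d N)) \<le> C' * real N powr (E + \<epsilon>)" if N: "N \<ge> 1" for N
  proof -
    have fin: "finite (G i N)" if "i \<in> I" for i using sub[OF that] finite_sol_pairs finite_subset by blast
    have "sol_pairs k d N \<subseteq> (\<Union>i\<in>I. G i N) \<union> {z \<in> sol_pairs k d N. card (set_mset (snd z)) < r}"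
    proof
      fix z assume z: "z \<in> sol_pairs k d N"
      then show "z \<in> (\<Union>i\<in>I. G i N) \<union> {z \<in> sol_pairs k d N. card (set_mset (snd z)) < r}"
        using cover[OF N z] by (cases "r \<le> card (set_mset (snd z))") auto
    qed
    then have "card (sol_pairs k d N) \<le> card ((\<Union>i\<in>I. G i N) \<union> {z \<in> sol_pairs k d N. card (set_mset (snd z)) < r})"
      using I fin finite_sol_pairs by (intro card_mono) auto
    also have "\<dots> \<le> card (\<Union>i\<in>I. G i N) + card {z \<in> sol_pairs k d N. card (set_mset (snd z)) < r}" by (rule card_Un_le)
    also have "\<dots> \<le> (\<Sum>i\<in>I. card (G i N)) + (k + 1) ^ (r - 1) * N ^ r"
      by (intro add_mono card_UN_le[OF I] card_few_values_le[OF dk N r])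
    finally have "real (card (sol_pairs k d N)) \<le> (\<Sum>i\<in>I. real (card (G i N))) + real ((k + 1) ^ (r - 1)) * real N ^ r"
      by (metis of_nat_add of_nat_le_iff of_nat_mult of_nat_power of_nat_sum)
    also have "\<dots> \<le> (\<Sum>i\<in>I. C i * real N powr (E + \<epsilon>)) + real ((k + 1) ^ (r - 1)) * real N powr (E + \<epsilon>)"
    proof (intro add_mono sum_mono mult_left_mono)
      show "real N ^ r \<le> real N powr (E + \<epsilon>)"
        using N E eps powr_mono[of "real r" "E + \<epsilon>" "real N"] by (simp add: powr_realpow)
    qed (use C N in auto)
    also have "\<dots> = C' * real N powr (E + \<epsilon>)" by (simp add: C'_def sum_distrib_right distrib_right)
    finally show ?thesis .
  qed
  then show "\<exists>C\<ge>0. \<forall>N\<ge>1. real (card (sol_pairs k d N)) \<le> C * real N powr (E + \<epsilon>)" using C'0 by blast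
qed

lemma choose_arrangements:
  assumes dk: "2 * d < k" and r: "1 \<le> r"
  obtains A U :: "nat \<Rightarrow> int multiset \<times> int multiset \<Rightarrow> int list" where
    "\<And>N z. N \<ge> 1 \<Longrightarrow> z \<in> sol_pairs k d N \<Longrightarrow> r \<le> card (set_mset (snd z)) \<Longrightarrow>
       \<exists>w S T c g. arranged k d r N z (A N z) (U N z) w S T c g"
proof -
  define P where "P = (\<lambda>N z p. \<exists>w S T c g. arranged k d r N z (fst p) (snd p) w S T c g)"
  define F where "F = (\<lambda>N z. SOME p. P N z p)"
  have "P N z (F N z)" if "N \<ge> 1" "z \<in> sol_pairs k d N" "r \<le> card (set_mset (snd z))" for N z
  proof -
    have "\<exists>p. P N z p"
      using exists_arrangement[of "fst z" "snd z" k d N r] that dk r unfolding P_def by (cases z) auto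
    then show ?thesis unfolding F_def by (rule someI_ex)
  qed
  then show ?thesis using that[of "\<lambda>N z. fst (F N z)" "\<lambda>N z. snd (F N z)"] unfolding P_def by blast
qed

lemma ln_tau_bound:
  assumes z: "z \<in> sol_pairs k d N" and dk: "2 * d < k" and N: "N \<ge> 1" and a: "a \<in># snd z"
  shows "0 \<le> ln \<bar>real_of_int (poly (tau_poly d (snd z)) a)\<bar>"
    and "ln \<bar>real_of_int (poly (tau_poly d (snd z)) a)\<bar> \<le> d * ln N + ln (real ((d + 1) * 2 ^ k))"
proof -
  obtain Mx My where zz: "z = (Mx, My)" by (cases z)
  interpret split_system Mx My "jump k d Mx My" "tau_poly d My" using z dk zz by (intro sol_split) auto
  have sz: "size My = k" and rg: "set_mset My \<subseteq> {1..int N}" using z zz by (auto simp: sol_pairs_def psum_sys_def)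
  define v where "v = \<bar>poly (tau_poly d My) a\<bar>"
  have "poly (tau_poly d My) a \<noteq> 0" using a zz tau_nonzero_right by auto
  then have v: "v \<ge> 1" by (simp add: v_def)
  have "\<bar>a\<bar> \<le> int N" using a zz rg by auto
  then have "v \<le> int ((d + 1) * 2 ^ k) * int N ^ d" unfolding v_def using poly_tau_bound[OF rg N, of a d] sz by simp
  then have "real_of_int v \<le> real_of_int (int ((d + 1) * 2 ^ k) * int N ^ d)" by (simp only: of_int_le_iff)
  then have le: "real_of_int v \<le> real ((d + 1) * 2 ^ k) * real N ^ d" by simp
  have "0 < (d + 1) * 2 ^ k" by simp
  then have pos: "0 < real ((d + 1) * 2 ^ k)" "0 < real N ^ d" using N by (simp_all only: of_nat_0_less_iff) simp
  have "ln (real_of_int v) \<le> ln (real ((d + 1) * 2 ^ k) * real N ^ d)"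
    using le v pos by (subst ln_le_cancel_iff) (auto simp del: of_nat_mult)
  also have "\<dots> = d * ln N + ln (real ((d + 1) * 2 ^ k))"
    using N pos by (subst ln_mult_pos) (auto simp: ln_realpow simp del: of_nat_mult)
  finally show "ln \<bar>real_of_int (poly (tau_poly d (snd z)) a)\<bar> \<le> d * ln N + ln (real ((d + 1) * 2 ^ k))"
    by (simp add: v_def zz)
  show "0 \<le> ln \<bar>real_of_int (poly (tau_poly d (snd z)) a)\<bar>"
    using v by (intro ln_ge_zero) (auto simp: v_def zz simp flip: of_int_abs)
qed

text \<open>A cost is at most 1 / r of what its x adds to the known part of H: if it is not 0, then
  r c <= T - r S <= T - S.\<close>

lemma cost_profile_step:
  assumes p: "cost_profile k r L w S T c g" and r: "r \<ge> 1" and t: "t < k"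
  shows "real r * c t \<le> g (Suc t) - g t" and "0 \<le> c t"
proof -
  have a: "0 \<le> S t" "S t \<le> T t" "0 \<le> c t" "c t = 0 \<or> real r * (c t + S t) \<le> T t" "g t + (T t - S t) \<le> g (Suc t)"
    using p t by (auto simp: cost_profile_def)
  have "S t \<le> real r * S t" using a(1) r mult_right_mono[of 1 "real r" "S t"] by simp
  then show "real r * c t \<le> g (Suc t) - g t" using a by (auto simp: distrib_left)
  show "0 \<le> c t" by (rule a(3))
qed

lemma cost_profile_sum:
  assumes p: "cost_profile k r L w S T c g" and r: "r \<ge> 1" and b: "b \<le> k"
  shows "real r * (\<Sum>t<b. c t) \<le> g b"
  using b
proof (induction b)
  case 0
  then show ?case using p by (simp add: cost_profile_def)
next
  case (Suc b)
  then show ?case using cost_profile_step(1)[OF p r, of b] by (simp add: distrib_left)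
qed

text \<open>All x are listed (b = k, m = 0). With \<nu> = ln |\<tau>(a)| for the first base point,
  the costs total at most (k ln N - \<nu>) / r, and the first difference costs \<nu>. The sum
  increases with \<nu>, so the worst case is \<nu> = d ln N up to a constant, which gives d + (k -
  d) / r.\<close>

theorem one_phase_bound:
  assumes dk: "2 * d < k" and r: "1 \<le> r"
  shows "solution_bound k d (real r + (\<Sum>l<r. real (d - l)) + (real k - real d) / r)"
proof -
  obtain A U where AU: "\<And>N z. N \<ge> 1 \<Longrightarrow> z \<in> sol_pairs k d N \<Longrightarrow> r \<le> card (set_mset (snd z)) \<Longrightarrow>
       \<exists>w S T c g. arranged k d r N z (A N z) (U N z) w S T c g"
    using choose_arrangements[OF dk r] by metis
  define G where "G = (\<lambda>N. {z \<in> sol_pairs k d N. r \<le> card (set_mset (snd z))})"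
  have AUz: "\<exists>w S T c g. arranged k d r N z (A N z) (U N z) w S T c g" if "z \<in> G N" "N \<ge> 1" for z N
    using that AU unfolding G_def by blast
  define e where "e = real d + (real k - real d) / r"
  have split: "(\<Sum>l<r. real (d - l)) = real d + (\<Sum>l=1..<r. real (d - l))"
  proof -
    have "{..<r} = insert 0 {1..<r}" using r by auto
    then show ?thesis by simp
  qed
  define E where "E = real r + (\<Sum>l<r. real (d - l)) + (real k - real d) / r"
  have E: "E = real r + (\<Sum>l=1..<r. real (d - l)) + e" using split by (simp add: E_def e_def)
  have "solution_bound k d E"
  proof (rule solution_boundI[OF dk r, where I = "{()}" and G = "\<lambda>_. G"])
    show "real r \<le> E" using dk unfolding E_def by (auto intro!: add_nonneg_nonneg sum_nonneg divide_nonneg_nonneg)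
    fix \<epsilon> :: real assume eps: "\<epsilon> > 0"
    obtain C where C: "C \<ge> 0" and bd: "arranged_count k d r k 0 e (ln (real ((d + 1) * 2 ^ k))) \<epsilon> C"
      using card_arranged_le[OF eps dk r, of k 0 e "ln (real ((d + 1) * 2 ^ k))"] dk by auto
    have "real (card (G N)) \<le> C * real N powr (E + \<epsilon>)" if N: "N \<ge> 1" for N
    proof -
      have "real (card (G N)) \<le> C * real 1 * real N powr (real r + (\<Sum>l=1..<r. real (d - l)) + e + \<epsilon>)"
      proof (rule arranged_countD[OF bd N, where A = "A N" and U = "U N"])
        fix z assume z: "z \<in> G N"
        then obtain w S T c g where ar: "arranged k d r N z (A N z) (U N z) w S T c g"
          using AUz[OF z N] by blast
        have "A N z \<noteq> []" "set (A N z) \<subseteq> set_mset (snd z)" using ar r by (auto simp: arranged_def)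
        then have h: "hd (A N z) \<in># snd z" by auto
        define \<nu> where "\<nu> = ln \<bar>real_of_int (poly (tau_poly d (snd z)) (hd (A N z)))\<bar>"
        have nu: "0 \<le> \<nu>" "\<nu> \<le> d * ln N + ln (real ((d + 1) * 2 ^ k))"
          unfolding \<nu>_def using ln_tau_bound[OF _ dk N h] z by (auto simp: G_def)
        have pr: "cost_profile k r (ln N) w S T c g" and w: "w + \<nu> \<le> k * ln N" using ar by (auto simp: arranged_def \<nu>_def)
        have "real r * (\<Sum>t<k. c t) \<le> g k" by (rule cost_profile_sum[OF pr r]) simp
        also have "\<dots> \<le> w" using pr by (auto simp: cost_profile_def)
        finally have "real r * (\<Sum>t<k. c t) \<le> k * ln N - \<nu>" using w by simp
        then have "(\<Sum>t<k. c t) \<le> (k * ln N - \<nu>) / r" using r by (simp add: field_simps)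
        then have "\<nu> + (\<Sum>t<k. c t) \<le> \<nu> * (1 - 1 / r) + k * ln N / r" by (simp add: field_simps diff_divide_distrib)
        also have "\<dots> \<le> (d * ln N + ln (real ((d + 1) * 2 ^ k))) * (1 - 1 / r) + k * ln N / r"
          using nu r by (intro add_right_mono mult_right_mono) auto
        also have "\<dots> \<le> d * ln N * (1 - 1 / r) + ln (real ((d + 1) * 2 ^ k)) + k * ln N / r"
        proof -
          have "1 \<le> (d + 1) * 2 ^ k" by (simp add: Suc_le_eq)
          then have "1 \<le> real ((d + 1) * 2 ^ k)" by (metis of_nat_1 of_nat_le_iff)
          then have "ln (real ((d + 1) * 2 ^ k)) * (1 - 1 / r) \<le> ln (real ((d + 1) * 2 ^ k)) * 1"
            using r by (intro mult_left_mono) auto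
          then show ?thesis by (simp add: distrib_right)
        qed
        also have "\<dots> = e * ln N + ln (real ((d + 1) * 2 ^ k))" by (simp add: e_def algebra_simps diff_divide_distrib)
        finally show "\<exists>w S T c g. arranged k d r N z (A N z) (U N z) w S T c g \<and>
          ln \<bar>real_of_int (poly (tau_poly d (snd z)) (hd (A N z)))\<bar> + (\<Sum>t<k. c t) + (if (0::nat) = 0 then 0 else (w - g k) / k) \<le> e * ln N + ln (real ((d + 1) * 2 ^ k))"
          using ar unfolding \<nu>_def by (intro exI[of _ w] exI[of _ S] exI[of _ T] exI[of _ c] exI[of _ g]) simp
      next
        fix z assume z: "z \<in> G N"
        have "{z'\<in>G N. A N z' = A N z \<and> take k (U N z') = take k (U N z) \<and> ((0::nat) = 0 \<or> snd z' = snd z)} \<subseteq> {z}"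
        proof
          fix z' assume "z' \<in> {z'\<in>G N. A N z' = A N z \<and> take k (U N z') = take k (U N z) \<and> ((0::nat) = 0 \<or> snd z' = snd z)}"
          then have z': "z' \<in> G N" "A N z' = A N z" "take k (U N z') = take k (U N z)" by auto
          obtain w S T c g where ar: "arranged k d r N z (A N z) (U N z) w S T c g" using AUz[OF z N] by blast
          obtain w' S' T' c' g' where ar': "arranged k d r N z' (A N z') (U N z') w' S' T' c' g'" using AUz[OF z'(1) N] by blast
          have m: "mset (U N z) = fst z" "mset (U N z') = fst z'" using ar ar' by (auto simp: arranged_def)
          have "size (fst z) = k" "size (fst z') = k" using z z' by (auto simp: G_def sol_pairs_def psum_sys_def)
          then have "length (U N z) = k" "length (U N z') = k" using m by (metis size_mset)+
          then have "fst z' = fst z" using z'(3) m by simp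
          moreover have "A N z \<noteq> []" "set (A N z) \<subseteq> set_mset (snd z)" "set (A N z) \<subseteq> set_mset (snd z')"
            using ar ar' r z'(2) by (auto simp: arranged_def)
          then have "hd (A N z) \<in># snd z" "hd (A N z) \<in># snd z'" by (meson hd_in_set subsetD)+
          moreover have "(fst z, snd z) \<in> sol_pairs k d N" "(fst z', snd z') \<in> sol_pairs k d N"
            using z z'(1) by (simp_all add: G_def)
          ultimately have "snd z' = snd z"
            using sol_decode[of "fst z" "snd z'" k d N "snd z"] dk by metis
          then show "z' \<in> {z}" using \<open>fst z' = fst z\<close> by (simp add: prod_eq_iff)
        qed
        then show "card {z'\<in>G N. A N z' = A N z \<and> take k (U N z') = take k (U N z) \<and> ((0::nat) = 0 \<or> snd z' = snd z)} \<le> 1"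
          using card_mono[of "{z}"] by simp
      qed (auto simp: G_def)
      then show ?thesis by (simp add: E)
    qed
    then show "\<exists>C\<ge>0. \<forall>N\<ge>1. real (card (G N)) \<le> C * real N powr (E + \<epsilon>)" using C by blast
  qed (auto simp: G_def)
  then show ?thesis by (simp add: E_def)
qed

text \<open>The linear program of the two phases: the first b costs plus 1 / b of what is unknown of
  H, in the worst case over all profiles. The stopping point b may depend on the profile.
  \<open>k * L\<close> replaces w, as the effect of \<tau>(a) on w is accounted for
  separately.\<close>

definition stops_within :: "nat \<Rightarrow> nat \<Rightarrow> nat set \<Rightarrow> real \<Rightarrow> bool" where
  "stops_within k r B e \<longleftrightarrow> (\<forall>L w S T c g. L \<ge> 0 \<longrightarrow> cost_profile k r L w S T c g \<longrightarrow>
     (\<exists>b\<in>B. (\<Sum>t<b. c t) + (k * L - g b) / b \<le> e * L))"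

text \<open>Solutions are divided according to a b at which stopping is cheap enough. With \<nu> =
  ln |\<tau>(a)| the unknown part of H is at most k ln N - \<nu> - g b, so on balance the first
  difference costs \<nu> (1 - 1 / b), which is at most d (1 - 1 / bm) ln N up to a constant: the
  origin of d / bm. A list contains all y and some x, hence determines its solution.\<close>

theorem two_phase_bound:
  assumes dk: "2 * d < k" and r: "1 \<le> r" "r < k" "d \<le> r" and B: "B \<subseteq> {1..bm}" "B \<subseteq> {1..k}" and e: "stops_within k r B e" and e0: "e \<ge> d / bm"
  shows "solution_bound k d (real r + (\<Sum>l<r. real (d - l)) + e - d / bm)"
proof -
  obtain A U where AU: "\<And>N z. N \<ge> 1 \<Longrightarrow> z \<in> sol_pairs k d N \<Longrightarrow> r \<le> card (set_mset (snd z)) \<Longrightarrow>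
       \<exists>w S T c g. arranged k d r N z (A N z) (U N z) w S T c g"
    using choose_arrangements[OF dk r(1)] by metis
  define e' where "e' = real d - d / bm + e"
  define K where "K = ln (real ((d + 1) * 2 ^ k))"
  define G where "G = (\<lambda>b N. {z \<in> sol_pairs k d N. \<exists>w S T c g. arranged k d r N z (A N z) (U N z) w S T c g \<and>
          ln \<bar>real_of_int (poly (tau_poly d (snd z)) (hd (A N z)))\<bar> + (\<Sum>t<b. c t) + (w - g b) / b \<le> e' * ln N + K})"
  have split: "(\<Sum>l<r. real (d - l)) = real d + (\<Sum>l=1..<r. real (d - l))"
  proof -
    have "{..<r} = insert 0 {1..<r}" using r by auto
    then show ?thesis by simp
  qed
  define E where "E = real r + (\<Sum>l<r. real (d - l)) + e - d / bm"
  have E: "E = real r + (\<Sum>l=1..<r. real (d - l)) + e'" using split by (simp add: E_def e'_def)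
  have "solution_bound k d E"
  proof (rule solution_boundI[OF dk r(1), where I = B and G = G])
    show "real r \<le> E" using e0 unfolding E_def by (simp add: sum_nonneg)
    show "finite B" using B(1) finite_subset by blast
    show "G b N \<subseteq> sol_pairs k d N" for b N by (auto simp: G_def)
  next
    fix N z assume N: "1 \<le> N" and z: "z \<in> sol_pairs k d N" and rz: "r \<le> card (set_mset (snd z))"
    obtain w S T c g where ar: "arranged k d r N z (A N z) (U N z) w S T c g" using AU[OF N z rz] by auto
    have "A N z \<noteq> []" "set (A N z) \<subseteq> set_mset (snd z)" using ar r by (auto simp: arranged_def)
    then have h: "hd (A N z) \<in># snd z" by auto
    define \<nu> where "\<nu> = ln \<bar>real_of_int (poly (tau_poly d (snd z)) (hd (A N z)))\<bar>"
    have nu: "0 \<le> \<nu>" "\<nu> \<le> d * ln N + K"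
      unfolding \<nu>_def K_def using ln_tau_bound[OF z dk N h] by auto
    have pr: "cost_profile k r (ln N) w S T c g" and w: "w + \<nu> \<le> k * ln N" using ar by (auto simp: arranged_def \<nu>_def)
    have "ln (real N) \<ge> 0" using N by simp
    then obtain b where b: "b \<in> B" "(\<Sum>t<b. c t) + (k * ln N - g b) / b \<le> e * ln N"
      using e pr unfolding stops_within_def by blast
    have bb: "1 \<le> b" "b \<le> bm" using b B by auto
    have K0: "K \<ge> 0"
    proof -
      have "1 \<le> (d + 1) * 2 ^ k" by (simp add: Suc_le_eq)
      then have "1 \<le> real ((d + 1) * 2 ^ k)" by (metis of_nat_1 of_nat_le_iff)
      then show ?thesis unfolding K_def by (rule ln_ge_zero)
    qed
    have "\<nu> + (\<Sum>t<b. c t) + (w - g b) / b \<le> \<nu> + (\<Sum>t<b. c t) + (k * ln N - \<nu> - g b) / b"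
      using w bb by (intro add_left_mono divide_right_mono) auto
    also have "\<dots> = \<nu> * (1 - 1 / b) + ((\<Sum>t<b. c t) + (k * ln N - g b) / b)"
      using bb by (simp add: field_simps)
    also have "\<dots> \<le> \<nu> * (1 - 1 / bm) + e * ln N"
      using b(2) nu bb by (intro add_mono mult_left_mono) (auto simp: frac_le)
    also have "\<dots> \<le> (d * ln N + K) * (1 - 1 / bm) + e * ln N"
      using nu bb by (intro add_right_mono mult_right_mono) auto
    also have "\<dots> \<le> d * ln N * (1 - 1 / bm) + K + e * ln N"
    proof -
      have "K * (1 - 1 / bm) \<le> K * 1" using K0 by (intro mult_left_mono) auto
      then show ?thesis by (simp add: distrib_right)
    qed
    also have "\<dots> = e' * ln N + K" by (simp add: e'_def algebra_simps)
    finally show "\<exists>b\<in>B. z \<in> G b N" using ar b(1) z unfolding G_def \<nu>_def by blast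
  next
    fix b and \<epsilon> :: real assume b: "b \<in> B" and eps: "\<epsilon> > 0"
    have bb: "1 \<le> b" "b \<le> k" using b B by auto
    have m: "k - r \<noteq> 0" using r by simp
    obtain C where C: "C \<ge> 0" and bd: "arranged_count k d r b (k - r) e' K \<epsilon> C"
      using card_arranged_le[OF eps dk r(1) bb, of "k - r" e' K] r by blast
    have "real (card (G b N)) \<le> C * real N powr (E + \<epsilon>)" if N: "N \<ge> 1" for N
    proof -
      have "real (card (G b N)) \<le> C * real 1 * real N powr (real r + (\<Sum>l=1..<r. real (d - l)) + e' + \<epsilon>)"
      proof (rule arranged_countD[OF bd N, where A = "A N" and U = "U N"])
        fix z assume z: "z \<in> G b N"
        have "{z'\<in>G b N. A N z' = A N z \<and> take b (U N z') = take b (U N z) \<and> (k - r = 0 \<or> snd z' = snd z)} \<subseteq> {z}"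
        proof
          fix z' assume "z' \<in> {z'\<in>G b N. A N z' = A N z \<and> take b (U N z') = take b (U N z) \<and> (k - r = 0 \<or> snd z' = snd z)}"
          then have z': "z' \<in> G b N" "take b (U N z') = take b (U N z)" "snd z' = snd z" using m by auto
          have mu: "mset (U N z) = fst z" "mset (U N z') = fst z'" using z z' by (auto simp: G_def arranged_def)
          have "size (fst z) = k" "size (fst z') = k" using z z' by (auto simp: G_def sol_pairs_def psum_sys_def)
          then have l: "length (U N z) = k" "length (U N z') = k" using mu by (metis size_mset)+
          define x where "x = hd (take b (U N z))"
          have "take b (U N z) \<noteq> []" using l bb by auto
          then have "x \<in> set (take b (U N z))" unfolding x_def by (rule hd_in_set)
          then have "x \<in> set (take b (U N z))" "x \<in> set (take b (U N z'))" using z'(2) by simp_all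
          then have "x \<in># fst z" "x \<in># fst z'" using mu by (metis in_set_takeD set_mset_mset)+
          moreover have "(fst z, snd z) \<in> sol_pairs k d N" "(fst z', snd z') \<in> sol_pairs k d N"
            using z z'(1) by (simp_all add: G_def)
          then have "(fst z, snd z) \<in> sol_pairs k d N" "(fst z', snd z) \<in> sol_pairs k d N"
            unfolding z'(3) .
          then have "(snd z, fst z) \<in> sol_pairs k d N" "(snd z, fst z') \<in> sol_pairs k d N"
            by (auto intro: sol_pairs_swap)
          ultimately have "fst z' = fst z" using sol_decode[OF _ _ dk] by metis
          then show "z' \<in> {z}" using z'(3) by (simp add: prod_eq_iff)
        qed
        then show "card {z'\<in>G b N. A N z' = A N z \<and> take b (U N z') = take b (U N z) \<and> (k - r = 0 \<or> snd z' = snd z)} \<le> 1"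
          using card_mono[of "{z}"] by simp
      qed (use m in \<open>auto simp: G_def\<close>)
      then show ?thesis by (simp add: E)
    qed
    then show "\<exists>C\<ge>0. \<forall>N\<ge>1. real (card (G b N)) \<le> C * real N powr (E + \<epsilon>)" using C by blast
  qed
  then show ?thesis by (simp add: E_def)
qed

section \<open>The case d = 0 for k = 3, 4, 5\<close>

lemma card_divisors_le:
  fixes \<epsilon> :: real
  assumes "\<epsilon> > 0"
  obtains C where "C > 0" "\<And>D::int. D \<noteq> 0 \<Longrightarrow> real (card {n. n dvd D}) \<le> C * real_of_int \<bar>D\<bar> powr \<epsilon>"
proof -
  obtain C where C: "C > 0" "\<And>D N. D \<noteq> 0 \<Longrightarrow> N \<ge> 1 \<Longrightarrow>
       real (card (smooth_ints (prime_factors D) N)) \<le> C * N powr (\<epsilon> / 2) * real_of_int \<bar>D\<bar> powr (\<epsilon> / 2)"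
    using card_smooth_ints_le[of "\<epsilon> / 2"] assms by (metis half_gt_zero)
  have "real (card {n. n dvd D}) \<le> (2 * C) * real_of_int \<bar>D\<bar> powr \<epsilon>" if D: "D \<noteq> 0" for D :: int
  proof -
    define N where "N = real_of_int \<bar>D\<bar>"
    have N: "N \<ge> 1" using D by (simp add: N_def)
    define S where "S = smooth_ints (prime_factors D) N"
    have fin: "finite S" unfolding S_def smooth_ints_def using finite_int_bounded[of N] by (rule rev_finite_subset) auto
    have "{n. n dvd D} \<subseteq> S \<union> uminus ` S"
    proof
      fix n assume "n \<in> {n. n dvd D}"
      then have n: "n dvd D" by simp
      have "n \<noteq> 0" using n D by auto
      then have "1 \<le> \<bar>n\<bar>" by simp
      moreover have "\<bar>n\<bar> \<le> \<bar>D\<bar>" using n D dvd_imp_le_int by auto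
      moreover have "prime_factors \<bar>n\<bar> \<subseteq> prime_factors D" using n D by (intro dvd_prime_factors) auto
      ultimately have "\<bar>n\<bar> \<in> S" by (simp add: S_def smooth_ints_def N_def)
      then show "n \<in> S \<union> uminus ` S" by (cases "n \<ge> 0") (auto intro: image_eqI[of _ _ "- n"])
    qed
    then have "card {n. n dvd D} \<le> card (S \<union> uminus ` S)" using fin by (intro card_mono) auto
    also have "\<dots> \<le> card S + card (uminus ` S)" by (rule card_Un_le)
    also have "\<dots> \<le> 2 * card S" using card_image_le[OF fin, of uminus] by simp
    finally have "real (card {n. n dvd D}) \<le> 2 * real (card S)" by linarith
    also have "\<dots> \<le> 2 * (C * N powr (\<epsilon> / 2) * N powr (\<epsilon> / 2))"
      using C(2)[OF D N] by (simp add: S_def N_def)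
    also have "\<dots> = (2 * C) * N powr \<epsilon>" by (simp add: powr_add[symmetric] mult.assoc)
    finally show ?thesis by (simp add: N_def)
  qed
  then show ?thesis using that[of "2 * C"] C(1) by simp
qed

text \<open>The list ends after b of the x, and the solutions sharing a list are counted
  algebraically by the hypothesis \<open>fib\<close>. For d = 0 the polynomial \<tau> is 1, so the
  differences do not contribute to the exponent.\<close>

lemma first_phase_bound:
  fixes e :: real and r b k :: nat
  assumes r: "1 \<le> r" and b: "1 \<le> b" "b \<le> k"
    and sub: "\<And>N. G N \<subseteq> {z \<in> sol_pairs k 0 N. r \<le> card (set_mset (snd z))}"
    and prof: "\<And>L w S T c g. L \<ge> 0 \<Longrightarrow> cost_profile k r L w S T c g \<Longrightarrow> (\<Sum>t<b. c t) \<le> e * L"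
    and fib: "\<And>\<epsilon>. \<epsilon> > 0 \<Longrightarrow> \<exists>C\<ge>0. \<forall>N\<ge>1. \<forall>z\<in>G N. \<forall>as us. distinct as \<and> length as = r \<and> length us = b \<and>
        set as \<subseteq> set_mset (snd z) \<and> mset us \<subseteq># fst z \<longrightarrow>
        real (card {z'\<in>G N. set as \<subseteq> set_mset (snd z') \<and> mset us \<subseteq># fst z'}) \<le> C * real N powr \<epsilon>"
    and eps: "\<epsilon> > 0"
  shows "\<exists>C\<ge>0. \<forall>N\<ge>1. real (card (G N)) \<le> C * real N powr (r + e + \<epsilon>)"
proof -
  have k0: "2 * 0 < k" using b by simp
  obtain A U where AU: "\<And>N z. N \<ge> 1 \<Longrightarrow> z \<in> sol_pairs k 0 N \<Longrightarrow> r \<le> card (set_mset (snd z)) \<Longrightarrow>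
       \<exists>w S T c g. arranged k 0 r N z (A N z) (U N z) w S T c g"
    using choose_arrangements[OF k0 r] by metis
  define K where "K = ln (real ((0 + 1) * 2 ^ k))"
  obtain C where C: "C \<ge> 0" and bd: "arranged_count k 0 r b 0 e K (\<epsilon> / 2) C"
    using card_arranged_le[of "\<epsilon> / 2" 0 k r b 0 e K] eps r b by auto
  have "\<epsilon> / 2 > 0" using eps by simp
  from fib[OF this] obtain C' where C': "C' \<ge> 0" and fb: "\<forall>N\<ge>1. \<forall>z\<in>G N. \<forall>as us. distinct as \<and> length as = r \<and> length us = b \<and>
        set as \<subseteq> set_mset (snd z) \<and> mset us \<subseteq># fst z \<longrightarrow>
        real (card {z'\<in>G N. set as \<subseteq> set_mset (snd z') \<and> mset us \<subseteq># fst z'}) \<le> C' * real N powr (\<epsilon> / 2)"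
    by (elim exE conjE) (rule that)
  have "real (card (G N)) \<le> C * C' * real N powr (r + e + \<epsilon>)" if N: "N \<ge> 1" for N
  proof -
    have gz: "z \<in> sol_pairs k 0 N" "r \<le> card (set_mset (snd z))" if "z \<in> G N" for z using sub that by auto
    define F where "F = nat \<lfloor>C' * real N powr (\<epsilon> / 2)\<rfloor>"
    have F: "real F \<le> C' * real N powr (\<epsilon> / 2)" unfolding F_def using C' by simp
    have facts: "distinct (A N z) \<and> length (A N z) = r \<and> set (A N z) \<subseteq> set_mset (snd z) \<and> mset (take b (U N z)) \<subseteq># fst z \<and> length (take b (U N z)) = b"
      if z: "z \<in> G N" for z
    proof -
      obtain w S T c g where ar: "arranged k 0 r N z (A N z) (U N z) w S T c g" using AU[OF N gz[OF z]] by auto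
      have m: "mset (U N z) = fst z" using ar by (simp add: arranged_def)
      have "size (fst z) = k" using gz[OF z] by (auto simp: sol_pairs_def psum_sys_def)
      then have "length (U N z) = k" using m by (metis size_mset)
      moreover have "mset (take b (U N z)) \<subseteq># mset (take b (U N z) @ drop b (U N z))"
        by (simp only: mset_append mset_subset_eq_add_left)
      ultimately show ?thesis using ar b m by (auto simp: arranged_def)
    qed
    have "real (card (G N)) \<le> C * real F * real N powr (real r + (\<Sum>l=1..<r. real (0 - l)) + e + \<epsilon> / 2)"
    proof (rule arranged_countD[OF bd N, where A = "A N" and U = "U N"])
      show "G N \<subseteq> sol_pairs k 0 N" using sub by auto
    next
      fix z assume z: "z \<in> G N"
      obtain w S T c g where ar: "arranged k 0 r N z (A N z) (U N z) w S T c g" using AU[OF N gz[OF z]] by auto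
      have "A N z \<noteq> []" "set (A N z) \<subseteq> set_mset (snd z)" using ar r by (auto simp: arranged_def)
      then have h: "hd (A N z) \<in># snd z" by auto
      have "(\<Sum>t<b. c t) \<le> e * ln N" using prof[of "ln N" w S T c g] ar N by (simp add: arranged_def)
      moreover have "ln \<bar>real_of_int (poly (tau_poly 0 (snd z)) (hd (A N z)))\<bar> \<le> K"
        using ln_tau_bound(2)[OF gz(1)[OF z] k0 N h] by (simp add: K_def)
      ultimately show "\<exists>w S T c g. arranged k 0 r N z (A N z) (U N z) w S T c g \<and>
          ln \<bar>real_of_int (poly (tau_poly 0 (snd z)) (hd (A N z)))\<bar> + (\<Sum>t<b. c t) + (if (0::nat) = 0 then 0 else (w - g b) / b) \<le> e * ln N + K"
        using ar by (intro exI[of _ w] exI[of _ S] exI[of _ T] exI[of _ c] exI[of _ g]) simp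
    next
      fix z assume z: "z \<in> G N"
      have "finite (G N)" using sub[of N] finite_sol_pairs[of k 0 N] by (metis (no_types, lifting) finite_subset mem_Collect_eq subsetI)
      moreover have "{z'\<in>G N. A N z' = A N z \<and> take b (U N z') = take b (U N z) \<and> ((0::nat) = 0 \<or> snd z' = snd z)}
          \<subseteq> {z'\<in>G N. set (A N z) \<subseteq> set_mset (snd z') \<and> mset (take b (U N z)) \<subseteq># fst z'}"
      proof
        fix z' assume "z' \<in> {z'\<in>G N. A N z' = A N z \<and> take b (U N z') = take b (U N z) \<and> ((0::nat) = 0 \<or> snd z' = snd z)}"
        then have zz: "z' \<in> G N" "A N z' = A N z" "take b (U N z') = take b (U N z)" by auto
        show "z' \<in> {z'\<in>G N. set (A N z) \<subseteq> set_mset (snd z') \<and> mset (take b (U N z)) \<subseteq># fst z'}"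
          using facts[OF zz(1)] zz(1) unfolding zz(2,3) by simp
      qed
      ultimately have "card {z'\<in>G N. A N z' = A N z \<and> take b (U N z') = take b (U N z) \<and> ((0::nat) = 0 \<or> snd z' = snd z)}
          \<le> card {z'\<in>G N. set (A N z) \<subseteq> set_mset (snd z') \<and> mset (take b (U N z)) \<subseteq># fst z'}"
        by (intro card_mono) auto
      also have "\<dots> \<le> F" unfolding F_def
        using fb[rule_format, OF N z, of "A N z" "take b (U N z)"] facts[OF z] by (intro le_nat_floor) simp
      finally show "card {z'\<in>G N. A N z' = A N z \<and> take b (U N z') = take b (U N z) \<and> ((0::nat) = 0 \<or> snd z' = snd z)} \<le> F" .
    qed
    also have "\<dots> \<le> C * (C' * real N powr (\<epsilon> / 2)) * real N powr (real r + (\<Sum>l=1..<r. real (0 - l)) + e + \<epsilon> / 2)"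
      using C F by (intro mult_right_mono mult_left_mono) auto
    also have "\<dots> = C * C' * (real N powr (\<epsilon> / 2) * real N powr (real r + e + \<epsilon> / 2))" by simp
    also have "\<dots> = C * C' * real N powr (r + e + \<epsilon>)" by (simp add: powr_add[symmetric] add_ac)
    finally show ?thesis .
  qed
  then show ?thesis using C C' by (metis mult_nonneg_nonneg)
qed

lemma tau_poly_0: "tau_poly 0 M = 1"
  by (simp add: tau_poly_def esym_0 monom_0)

text \<open>For \<open>d = 0\<close> the products \<open>\<Prod>x. y - x\<close> agree for all \<open>y\<close>; comparing two of them is a linear
  equation for the last \<open>x\<close>.\<close>

lemma solution_bound_linear:
  fixes e :: real
  assumes k: "2 \<le> k" and e: "0 \<le> e"
    and prof: "\<And>L w S T c g. L \<ge> 0 \<Longrightarrow> cost_profile k 2 L w S T c g \<Longrightarrow> (\<Sum>t<k - 1. c t) \<le> e * L"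
  shows "solution_bound k 0 (2 + e)"
proof (rule solution_boundI[where r = 2 and I = "{()}" and G = "\<lambda>_ N. {z \<in> sol_pairs k 0 N. 2 \<le> card (set_mset (snd z))}"])
  fix \<epsilon> :: real assume eps: "\<epsilon> > 0"
  define G where "G = (\<lambda>N. {z \<in> sol_pairs k 0 N. 2 \<le> card (set_mset (snd z))})"
  have k0: "2 * 0 < k" using k by simp
  have "\<exists>C\<ge>0. \<forall>N\<ge>1. real (card (G N)) \<le> C * real N powr (real 2 + e + \<epsilon>)"
  proof (rule first_phase_bound[OF _ _ _ _ prof _ eps])
    fix \<epsilon> :: real assume "\<epsilon> > 0"
    have "real (card {z'\<in>G N. set as \<subseteq> set_mset (snd z') \<and> mset us \<subseteq># fst z'}) \<le> 1 * real N powr \<epsilon>"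
      if N: "N \<ge> 1" and as: "distinct as" "length as = 2" and us: "length us = k - 1" for N as and us :: "int list"
    proof -
      have "card {z'\<in>G N. set as \<subseteq> set_mset (snd z') \<and> mset us \<subseteq># fst z'} \<le> 1"
      proof (rule card_le_Suc0_iff_eq[THEN iffD2, unfolded One_nat_def[symmetric]], goal_cases)
        case 1
        show ?case using finite_sol_pairs[of k 0 N] by (rule rev_finite_subset) (auto simp: G_def)
      next
        case 2
        obtain y1 y2 where y: "as = [y1, y2]" "y1 \<noteq> y2" using as by (auto simp: length_Suc_conv numeral_2_eq_2)
        define p where "p = (\<lambda>y::int. \<Prod>x\<in>#mset us. y - x)"
        have key: "\<exists>x. fst z = add_mset x (mset us) \<and> (y1 - x) * p y1 = (y2 - x) * p y2 \<and> p y1 \<noteq> 0 \<and> p y2 \<noteq> 0"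
          if z: "z \<in> {z'\<in>G N. set as \<subseteq> set_mset (snd z') \<and> mset us \<subseteq># fst z'}" for z
        proof -
          obtain Mx My where zz: "z = (Mx, My)" by (cases z)
          interpret split_system Mx My "jump k 0 Mx My" "tau_poly 0 My" using z zz k0 by (intro sol_split) (auto simp: G_def)
          have "mset us \<subseteq># Mx" using z zz by auto
          then obtain V where V: "Mx = mset us + V" by (metis subset_mset.le_iff_add)
          have "size Mx = k" using z zz by (auto simp: G_def sol_pairs_def psum_sys_def)
          then have "size V = 1" using V us k by auto
          then obtain x where x: "V = {#x#}" using size_1_singleton_mset by blast
          have "(y - x) * p y = jump k 0 Mx My" if "y \<in> {y1, y2}" for y
          proof -
            have "y \<in># My" using that z zz y by auto
            then show ?thesis using value_right[of y] V x by (simp add: p_def tau_poly_0)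
          qed
          from this[of y1] this[of y2] have "(y1 - x) * p y1 = jump k 0 Mx My" "(y2 - x) * p y2 = jump k 0 Mx My" by simp_all
          moreover from this have "p y1 \<noteq> 0" "p y2 \<noteq> 0" using H0 by (metis mult_zero_right)+
          ultimately show ?thesis using V x zz by (intro exI[of _ x]) simp
        qed
        show ?case
        proof (intro ballI)
          fix z z' assume z: "z \<in> {z'\<in>G N. set as \<subseteq> set_mset (snd z') \<and> mset us \<subseteq># fst z'}"
            and z': "z' \<in> {z'\<in>G N. set as \<subseteq> set_mset (snd z') \<and> mset us \<subseteq># fst z'}"
          obtain x where x: "fst z = add_mset x (mset us)" "(y1 - x) * p y1 = (y2 - x) * p y2" "p y1 \<noteq> 0" using key[OF z] by auto
          obtain x' where x': "fst z' = add_mset x' (mset us)" "(y1 - x') * p y1 = (y2 - x') * p y2" using key[OF z'] by auto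
          \<comment> \<open>Otherwise the equation, in which p y1 is not 0, would give y1 =
            y2.\<close>
          have "p y1 \<noteq> p y2" using x y by auto
          moreover have "(x - x') * (p y1 - p y2) = 0" using x(2) x'(2) by (simp add: algebra_simps)
          ultimately have "x = x'" by simp
          then have f: "fst z = fst z'" using x x' by simp
          have "(fst z, snd z) \<in> sol_pairs k 0 N" "(fst z', snd z') \<in> sol_pairs k 0 N" using z z' by (auto simp: G_def)
          moreover have "y1 \<in># snd z" "y1 \<in># snd z'" using z z' y by auto
          ultimately have "snd z = snd z'" using sol_decode[of "fst z" "snd z" k 0 N "snd z'"] k0 unfolding f by blast
          then show "z = z'" using f by (simp add: prod_eq_iff)
        qed
      qed
      then have "real (card {z'\<in>G N. set as \<subseteq> set_mset (snd z') \<and> mset us \<subseteq># fst z'}) \<le> 1" by simp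
      also have "\<dots> \<le> 1 * real N powr \<epsilon>" using N \<open>\<epsilon> > 0\<close> by (simp add: ge_one_powr_ge_zero)
      finally show ?thesis .
    qed
    then show "\<exists>C\<ge>0. \<forall>N\<ge>1. \<forall>z\<in>G N. \<forall>as us. distinct as \<and> length as = 2 \<and> length us = k - 1 \<and>
        set as \<subseteq> set_mset (snd z) \<and> mset us \<subseteq># fst z \<longrightarrow>
        real (card {z'\<in>G N. set as \<subseteq> set_mset (snd z') \<and> mset us \<subseteq># fst z'}) \<le> C * real N powr \<epsilon>"
      by (intro exI[of _ "1::real"]) auto
  qed (use k in \<open>auto simp: G_def\<close>)
  then show "\<exists>C\<ge>0. \<forall>N\<ge>1. real (card {z \<in> sol_pairs k 0 N. 2 \<le> card (set_mset (snd z))}) \<le> C * real N powr (2 + e + \<epsilon>)"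
    by (simp add: G_def)
qed (use k e in auto)

lemma card_image_divisors_le:
  fixes D M :: int and h :: "'a \<Rightarrow> int"
  assumes "finite F" "inj_on h F" "\<And>z. z \<in> F \<Longrightarrow> h z dvd D" "D \<noteq> 0"
  shows "card F \<le> card {n. n dvd D}"
proof -
  have "card F = card (h ` F)" using assms(2) by (simp add: card_image)
  also have "\<dots> \<le> card {n. n dvd D}" using assms(3,4) by (intro card_mono finite_divisors_int) auto
  finally show ?thesis .
qed

lemma two_of_four:
  assumes "{#a, b#} \<subseteq># M" "size M = 4"
  obtains c e where "M = {#a, b, c, e#}"
proof -
  obtain V where V: "M = {#a, b#} + V" using assms(1) by (metis subset_mset.le_iff_add)
  then have "size V = 2" using assms(2) by simp
  then obtain c W where c: "V = add_mset c W" "size W = 1" by (metis Suc_1 size_eq_Suc_imp_eq_union size_Suc_Diff1 Suc_inject size_add_mset)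
  then obtain e where "W = {#e#}" using size_1_singleton_mset by blast
  then show ?thesis using that V c by simp
qed

text \<open>The solutions for which the conic in \<open>solution_bound_hyperbola\<close> may
  degenerate, for some choice of base points and first x; they are counted separately.\<close>

definition paired :: "nat \<Rightarrow> (int multiset \<times> int multiset) set" where
  "paired N = {z \<in> sol_pairs 4 0 N. \<exists>x1 x2 y1 y2. {#x1, x2#} \<subseteq># fst z \<and> {#y1, y2#} \<subseteq># snd z \<and>
     y1 \<noteq> y2 \<and> x1 + x2 = y1 + y2}"

text \<open>The linear equation gives x3 + x4 = y3 + y4 = t, and the quadratic one shows that x1 x2
  - y1 y2 = \<kappa> and x3 x4 - y3 y4 are opposite. The cubic one then forces t = x1 + x2, because
  \<kappa> is not 0 for disjoint sides.\<close>

lemma paired_structure: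
  assumes "z \<in> paired N"
  shows "\<exists>x1 x2 y1 x3 y3. let s = x1 + x2 in fst z = {#x1, x2, x3, s - x3#} \<and> snd z = {#y1, s - y1, y3, s - y3#} \<and>
     (x3 - y3) * (x3 - (s - y3)) = x1 * x2 - y1 * (s - y1) \<and> x1 * x2 - y1 * (s - y1) \<noteq> 0"
proof -
  obtain x1 x2 y1 y2 where sub: "{#x1, x2#} \<subseteq># fst z" "{#y1, y2#} \<subseteq># snd z" "x1 + x2 = y1 + y2" and zs: "z \<in> sol_pairs 4 0 N"
    using assms by (auto simp: paired_def)
  have sys: "psum_sys 4 0 (fst z) (snd z)" and dj: "set_mset (fst z) \<inter> set_mset (snd z) = {}" using zs by (auto simp: sol_pairs_def)
  have sz: "size (fst z) = 4" "size (snd z) = 4" using sys by (auto simp: psum_sys_def)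
  obtain x3 x4 where x: "fst z = {#x1, x2, x3, x4#}" using two_of_four[OF sub(1) sz(1)] .
  obtain y3 y4 where y: "snd z = {#y1, y2, y3, y4#}" using two_of_four[OF sub(2) sz(2)] .
  have ps: "x1 ^ j + x2 ^ j + x3 ^ j + x4 ^ j = y1 ^ j + y2 ^ j + y3 ^ j + y4 ^ j" if "j \<in> {1, 2, 3}" for j
  proof -
    have "power_sum j (fst z) = power_sum j (snd z)" using sys that by (auto simp: psum_sys_def)
    then show ?thesis by (simp add: x y power_sum_def add_ac)
  qed
  have s: "x1 + x2 = y1 + y2" by (rule sub(3))
  have y2: "y2 = x1 + x2 - y1" using s by simp
  define t where "t = x3 + x4"
  have 1: "x3 + x4 = y3 + y4" using ps[of 1] s by simp
  have x4: "x4 = t - x3" and y4: "y4 = t - y3" using 1 by (auto simp: t_def)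
  define \<kappa> where "\<kappa> = x1 * x2 - y1 * y2"
  define \<kappa>' where "\<kappa>' = x3 * x4 - y3 * y4"
  have "(x1 - y1) * (x1 - y2) = - \<kappa>" unfolding \<kappa>_def y2 by (simp add: algebra_simps)
  moreover have "x1 \<noteq> y1" "x1 \<noteq> y2" using dj x y by auto
  ultimately have k0: "\<kappa> \<noteq> 0" by auto
  have "2 * (\<kappa> + \<kappa>') = 0"
    using ps[of 2] unfolding \<kappa>_def \<kappa>'_def y2 x4 y4 by (simp add: power2_eq_square algebra_simps)
  then have kk: "\<kappa>' = - \<kappa>" by simp
  have "3 * (\<kappa> * (x1 + x2) + \<kappa>' * t) = 0"
    using ps[of 3] unfolding \<kappa>_def \<kappa>'_def y2 x4 y4 by (simp add: power3_eq_cube algebra_simps)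
  then have "\<kappa> * (x1 + x2 - t) = 0" unfolding kk by (simp add: algebra_simps)
  then have t: "t = x1 + x2" using k0 by simp
  have "(x3 - y3) * (x3 - (x1 + x2 - y3)) = - \<kappa>'"
    unfolding \<kappa>'_def x4 y4 t by (simp add: algebra_simps)
  then have "(x3 - y3) * (x3 - (x1 + x2 - y3)) = \<kappa>" using kk by simp
  then show ?thesis using x y k0 unfolding Let_def x4 y4 t \<kappa>_def y2 by blast
qed

text \<open>The N^3 choices of (x1, x2, y1) fix s and \<kappa>. The divisor x3 - y3 of \<kappa> and
  its cofactor x3 + y3 - s give x3 and y3.\<close>

lemma card_paired_le:
  fixes \<epsilon> :: real
  assumes eps: "\<epsilon> > 0"
  shows "\<exists>C\<ge>0. \<forall>N\<ge>1. real (card (paired N)) \<le> C * real N powr (3 + \<epsilon>)"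
proof -
  obtain C where C: "C > 0" "\<And>D::int. D \<noteq> 0 \<Longrightarrow> real (card {n. n dvd D}) \<le> C * real_of_int \<bar>D\<bar> powr (\<epsilon> / 2)"
    using card_divisors_le[of "\<epsilon> / 2"] eps by (metis half_gt_zero)
  define P where "P = (\<lambda>(z :: int multiset \<times> int multiset) (x1, x2, y1, x3, y3). let s = x1 + x2 in fst z = {#x1, x2, x3, s - x3#} \<and>
     snd z = {#y1, s - y1, y3, s - y3#} \<and>
     (x3 - y3) * (x3 - (s - y3)) = x1 * x2 - y1 * (s - y1) \<and> x1 * x2 - y1 * (s - y1) \<noteq> 0)"
  define p where "p = (\<lambda>z. SOME q. P z q)"
  have p: "P z (p z)" if "z \<in> paired N" for z N
  proof -
    have "\<exists>q. P z q" using paired_structure[OF that] unfolding P_def by (simp only: split_paired_Ex prod.case)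
    then show ?thesis unfolding p_def by (rule someI_ex)
  qed
  define f where "f = (\<lambda>z. case p z of (x1, x2, y1, x3, y3) \<Rightarrow> (x1, x2, y1))"
  define h where "h = (\<lambda>z. case p z of (x1, x2, y1, x3, y3) \<Rightarrow> x3 - y3)"
  have "real (card (paired N)) \<le> C * 2 powr (\<epsilon> / 2) * real N powr (3 + \<epsilon>)" if N: "N \<ge> 1" for N
  proof -
    have fin: "finite (paired N)" using finite_sol_pairs[of 4 0 N] by (rule rev_finite_subset) (auto simp: paired_def)
    define F where "F = C * (2 * real N ^ 2) powr (\<epsilon> / 2)"
    have fib: "card {z \<in> paired N. f z = q} \<le> nat \<lfloor>F\<rfloor>" if q: "q \<in> f ` paired N" for q
    proof -
      obtain x1 x2 y1 where q': "q = (x1, x2, y1)" by (cases q)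
      define s where "s = x1 + x2"
      define D where "D = x1 * x2 - y1 * (s - y1)"
      have st: "\<exists>x3 y3. p z = (x1, x2, y1, x3, y3) \<and> h z = x3 - y3 \<and> fst z = {#x1, x2, x3, s - x3#} \<and>
          snd z = {#y1, s - y1, y3, s - y3#} \<and> (x3 - y3) * (x3 - (s - y3)) = D \<and> D \<noteq> 0"
        if z: "z \<in> {z \<in> paired N. f z = q}" for z
      proof -
        obtain a1 a2 b1 a3 b3 where pz: "p z = (a1, a2, b1, a3, b3)" by (metis prod_cases5)
        then have "a1 = x1" "a2 = x2" "b1 = y1" using z q' by (auto simp: f_def)
        then show ?thesis using p[of z N] z pz by (auto simp: P_def h_def D_def s_def Let_def)
      qed
      obtain z where z: "z \<in> {z \<in> paired N. f z = q}" using q by auto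
      have D0: "D \<noteq> 0" using st[OF z] by auto
      have "x1 \<in># fst z" "x2 \<in># fst z" "y1 \<in># snd z" "s - y1 \<in># snd z" using st[OF z] by auto
      then have rg: "x1 \<in> {1..int N}" "x2 \<in> {1..int N}" "y1 \<in> {1..int N}" "s - y1 \<in> {1..int N}"
        using z by (auto simp: paired_def sol_pairs_def)
      have "\<bar>D\<bar> \<le> \<bar>x1 * x2\<bar> + \<bar>y1 * (s - y1)\<bar>" unfolding D_def by (rule abs_triangle_ineq4)
      also have "\<dots> \<le> int N * int N + int N * int N"
        unfolding abs_mult using rg by (intro add_mono mult_mono) auto
      finally have Db: "\<bar>D\<bar> \<le> 2 * int N ^ 2" by (simp add: power2_eq_square)
      then have "real_of_int \<bar>D\<bar> \<le> real_of_int (2 * int N ^ 2)" by (simp only: of_int_le_iff)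
      then have Db: "real_of_int \<bar>D\<bar> \<le> 2 * real N ^ 2" by simp
      have "card {z \<in> paired N. f z = q} \<le> card {n. n dvd D}"
      proof (rule card_image_divisors_le[of _ h])
        show "finite {z \<in> paired N. f z = q}" using fin by simp
        show "D \<noteq> 0" by (rule D0)
        show "h z dvd D" if "z \<in> {z \<in> paired N. f z = q}" for z using st[OF that] by auto
        show "inj_on h {z \<in> paired N. f z = q}"
        proof (rule inj_onI)
          fix z z' assume z: "z \<in> {z \<in> paired N. f z = q}" and z': "z' \<in> {z \<in> paired N. f z = q}" and h: "h z = h z'"
          obtain x3 y3 where 1: "h z = x3 - y3" "fst z = {#x1, x2, x3, s - x3#}" "snd z = {#y1, s - y1, y3, s - y3#}"
             "(x3 - y3) * (x3 - (s - y3)) = D" using st[OF z] by auto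
          obtain x3' y3' where 2: "h z' = x3' - y3'" "fst z' = {#x1, x2, x3', s - x3'#}" "snd z' = {#y1, s - y1, y3', s - y3'#}"
             "(x3' - y3') * (x3' - (s - y3')) = D" using st[OF z'] by auto
          have e: "x3 - y3 = x3' - y3'" using 1 2 h by simp
          then have "(x3 - y3) * (x3 - (s - y3)) = (x3 - y3) * (x3' - (s - y3'))" using 1(4) 2(4) by simp
          moreover have "x3 - y3 \<noteq> 0" using 1(4) D0 by auto
          ultimately have "x3 - (s - y3) = x3' - (s - y3')" by simp
          then have "x3 = x3'" "y3 = y3'" using e by linarith+
          then show "z = z'" using 1 2 by (simp add: prod_eq_iff)
        qed
      qed
      then have "real (card {z \<in> paired N. f z = q}) \<le> real (card {n. n dvd D})" by simp
      also have "\<dots> \<le> C * real_of_int \<bar>D\<bar> powr (\<epsilon> / 2)" by (rule C(2)[OF D0])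
      also have "\<dots> \<le> F" unfolding F_def using C(1) Db eps by (intro mult_left_mono powr_mono2) auto
      finally show ?thesis by (intro le_nat_floor)
    qed
    have "f ` paired N \<subseteq> {1..int N} \<times> {1..int N} \<times> {1..int N}"
    proof
      fix q assume "q \<in> f ` paired N"
      then obtain z where z: "z \<in> paired N" "q = f z" by auto
      obtain x1 x2 y1 x3 y3 where pz: "p z = (x1, x2, y1, x3, y3)" by (metis prod_cases5)
      then have "x1 \<in># fst z" "x2 \<in># fst z" "y1 \<in># snd z" using p[OF z(1)] by (auto simp: P_def Let_def)
      then show "q \<in> {1..int N} \<times> {1..int N} \<times> {1..int N}"
        using z pz by (auto simp: f_def paired_def sol_pairs_def)
    qed
    then have "card (f ` paired N) \<le> card ({1..int N} \<times> {1..int N} \<times> {1..int N})" by (intro card_mono) auto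
    then have c3: "card (f ` paired N) \<le> N ^ 3" by (simp add: card_cartesian_product power3_eq_cube mult.assoc)
    have "card (paired N) \<le> nat \<lfloor>F\<rfloor> * card (f ` paired N)" by (rule card_le_fibers[OF fin fib])
    also have "\<dots> \<le> nat \<lfloor>F\<rfloor> * N ^ 3" using c3 by simp
    finally have "real (card (paired N)) \<le> real (nat \<lfloor>F\<rfloor>) * real N ^ 3" by (metis of_nat_le_iff of_nat_mult of_nat_power)
    also have "\<dots> \<le> F * real N ^ 3"
      using C(1) by (intro mult_right_mono) (auto simp: F_def)
    also have "\<dots> = C * 2 powr (\<epsilon> / 2) * (real N powr 3 * real N powr \<epsilon>)"
      using N by (simp add: F_def powr_mult powr_powr powr_realpow[symmetric] flip: powr_numeral)
    also have "\<dots> = C * 2 powr (\<epsilon> / 2) * real N powr (3 + \<epsilon>)" by (simp add: powr_add)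
    finally show ?thesis .
  qed
  then show ?thesis using C(1) by (intro exI[of _ "C * 2 powr (\<epsilon> / 2)"]) auto
qed

text \<open>For \<open>k = 4\<close> the equation relating \<open>y\<^sub>1\<close> and \<open>y\<^sub>2\<close> is a hyperbola in the last two \<open>x\<close>, degenerate exactly
  when \<open>x\<^sub>1 + x\<^sub>2 = y\<^sub>1 + y\<^sub>2\<close>.\<close>

lemma solution_bound_hyperbola:
  fixes e :: real
  assumes e: "1 \<le> e"
    and prof: "\<And>L w S T c g. L \<ge> 0 \<Longrightarrow> cost_profile 4 2 L w S T c g \<Longrightarrow> (\<Sum>t<2. c t) \<le> e * L"
  shows "solution_bound 4 0 (2 + e)"
proof (rule solution_boundI[where r = 2 and I = "UNIV :: bool set" and
      G = "\<lambda>i N. if i then paired N else {z \<in> sol_pairs 4 0 N. 2 \<le> card (set_mset (snd z)) \<and> z \<notin> paired N}"])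
  fix \<epsilon> :: real and i :: bool assume eps: "\<epsilon> > 0"
  define G where "G = (\<lambda>N. {z \<in> sol_pairs 4 0 N. 2 \<le> card (set_mset (snd z)) \<and> z \<notin> paired N})"
  have G: "\<exists>C\<ge>0. \<forall>N\<ge>1. real (card (G N)) \<le> C * real N powr (real 2 + e + \<epsilon>)"
  proof (rule first_phase_bound[OF _ _ _ _ prof _ eps])
    fix \<epsilon> :: real assume "\<epsilon> > 0"
    then obtain C where C: "C > 0" "\<And>D::int. D \<noteq> 0 \<Longrightarrow> real (card {n. n dvd D}) \<le> C * real_of_int \<bar>D\<bar> powr (\<epsilon> / 6)"
      using card_divisors_le[of "\<epsilon> / 6"] by (metis divide_pos_pos zero_less_numeral)
    have "real (card {z'\<in>G N. set as \<subseteq> set_mset (snd z') \<and> mset us \<subseteq># fst z'}) \<le> C * real N powr \<epsilon>"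
      if N: "N \<ge> 1" and z0: "z0 \<in> G N" and as: "distinct as" "length as = 2" and us: "length us = 2"
        and in0: "set as \<subseteq> set_mset (snd z0)" "mset us \<subseteq># fst z0" for N z0 as and us :: "int list"
    proof -
      obtain y1 y2 where y: "as = [y1, y2]" "y1 \<noteq> y2" using as by (auto simp: length_Suc_conv numeral_2_eq_2)
      obtain x1 x2 where x: "us = [x1, x2]" using us by (auto simp: length_Suc_conv numeral_2_eq_2)
      define F where "F = {z'\<in>G N. set as \<subseteq> set_mset (snd z') \<and> mset us \<subseteq># fst z'}"
      define p1 where "p1 = (y1 - x1) * (y1 - x2)"
      define p2 where "p2 = (y2 - x1) * (y2 - x2)"
      define D where "D = y2 - y1"
      have ysub: "{#y1, y2#} \<subseteq># M" if "set as \<subseteq> set_mset M" for M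
        unfolding subseteq_mset_def using that y by (auto simp: Suc_le_eq)
      have "x1 + x2 \<noteq> y1 + y2" using z0 in0 ysub[OF in0(1)] x y unfolding G_def paired_def by auto
      moreover have "p1 - p2 = (y1 - y2) * (y1 + y2 - (x1 + x2))" by (simp add: p1_def p2_def algebra_simps)
      ultimately have p12: "p1 - p2 \<noteq> 0" using y by simp
      have zin: "{x1, x2} \<subseteq> set_mset (fst z0)" "{y1, y2} \<subseteq> set_mset (snd z0)" using in0 x y
        by (auto dest: set_mset_mono)
      have z0s: "z0 \<in> sol_pairs 4 0 N" using z0 by (simp add: G_def)
      have rg: "{x1, x2, y1, y2} \<subseteq> {1..int N}" using zin z0s unfolding sol_pairs_def by auto
      have "{x1, x2} \<inter> {y1, y2} = {}" using zin z0s unfolding sol_pairs_def by auto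
      then have nz: "p1 * p2 * D ^ 2 \<noteq> 0" using y by (auto simp: p1_def p2_def D_def)
      \<comment> \<open>Six differences of size at most N, hence the \<epsilon> / 6 above.\<close>
      have "\<bar>p1 * p2 * D ^ 2\<bar> = \<bar>y1 - x1\<bar> * \<bar>y1 - x2\<bar> * (\<bar>y2 - x1\<bar> * \<bar>y2 - x2\<bar>) * (\<bar>D\<bar> * \<bar>D\<bar>)"
        by (simp add: p1_def p2_def abs_mult power2_eq_square)
      also have "\<dots> \<le> int N * int N * (int N * int N) * (int N * int N)"
        using rg by (intro mult_mono) (auto simp: D_def)
      finally have "real_of_int \<bar>p1 * p2 * D ^ 2\<bar> \<le> real_of_int (int N * int N * (int N * int N) * (int N * int N))"
        by (simp only: of_int_le_iff)
      also have "\<dots> = real N powr real 6" using N by (subst powr_realpow) (simp_all add: power_numeral_reduce)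
      finally have Mb: "real_of_int \<bar>p1 * p2 * D ^ 2\<bar> \<le> real N powr real 6" .
      \<comment> \<open>Multiplying p1 u u' = p2 (u - D) (u' - D) by p1 - p2 and completing the
        product gives two factors with the fixed nonzero product p1 p2 D^2; here u = x3 - y1 and u'
        = x4 - y1.\<close>
      define P where "P = (\<lambda>(z :: int multiset \<times> int multiset) (x3, x4). fst z = {#x1, x2, x3, x4#} \<and>
          ((p1 - p2) * (x3 - y1) + p2 * D) * ((p1 - p2) * (x4 - y1) + p2 * D) = p1 * p2 * D ^ 2)"
      have ex: "\<exists>q. P z q" if z: "z \<in> F" for z
      proof -
        obtain Mx My where zz: "z = (Mx, My)" by (cases z)
        interpret split_system Mx My "jump 4 0 Mx My" "tau_poly 0 My" using z zz by (intro sol_split) (auto simp: F_def G_def)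
        have "{#x1, x2#} \<subseteq># Mx" "size Mx = 4" using z zz x by (auto simp: F_def G_def sol_pairs_def psum_sys_def)
        then obtain x3 x4 where M: "Mx = {#x1, x2, x3, x4#}" by (rule two_of_four)
        have "y1 \<in># My" "y2 \<in># My" using z zz y by (auto simp: F_def)
        then have "(\<Prod>x\<in>#Mx. y1 - x) = (\<Prod>x\<in>#Mx. y2 - x)" using value_right by (simp add: tau_poly_0)
        then have eq: "p1 * ((x3 - y1) * (x4 - y1)) = p2 * ((x3 - y1 - D) * (x4 - y1 - D))"
          by (simp add: M p1_def p2_def D_def algebra_simps)
        have "((p1 - p2) * u + p2 * D) * ((p1 - p2) * u' + p2 * D) = p1 * p2 * D ^ 2 + (p1 - p2) * (p1 * (u * u') - p2 * ((u - D) * (u' - D)))" for u u'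
          by (simp add: algebra_simps power2_eq_square)
        from this[of "x3 - y1" "x4 - y1"] show ?thesis using M zz eq by (intro exI[of _ "(x3, x4)"]) (simp add: P_def)
      qed
      define q where "q = (\<lambda>z. SOME q. P z q)"
      have q: "P z (q z)" if "z \<in> F" for z unfolding q_def using ex[OF that] by (rule someI_ex)
      have "card F \<le> card {n. n dvd p1 * p2 * D ^ 2}"
      proof (rule card_image_divisors_le[of _ "\<lambda>z. (p1 - p2) * (fst (q z) - y1) + p2 * D"])
        show "finite F" using finite_sol_pairs[of 4 0 N] by (rule rev_finite_subset) (auto simp: F_def G_def)
        show "p1 * p2 * D ^ 2 \<noteq> 0" by (rule nz)
        show "(p1 - p2) * (fst (q z) - y1) + p2 * D dvd p1 * p2 * D ^ 2" if "z \<in> F" for z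
        proof -
          obtain x3 x4 where 1: "q z = (x3, x4)" by (cases "q z")
          then have "p1 * p2 * D ^ 2 = ((p1 - p2) * (x3 - y1) + p2 * D) * ((p1 - p2) * (x4 - y1) + p2 * D)"
            using q[OF that] by (simp add: P_def)
          then show ?thesis unfolding 1 fst_conv by (rule dvdI)
        qed
        show "inj_on (\<lambda>z. (p1 - p2) * (fst (q z) - y1) + p2 * D) F"
        proof (rule inj_onI)
          fix z z' assume z: "z \<in> F" and z': "z' \<in> F" and
            e: "(p1 - p2) * (fst (q z) - y1) + p2 * D = (p1 - p2) * (fst (q z') - y1) + p2 * D"
          obtain x3 x4 where 1: "q z = (x3, x4)" by (cases "q z")
          obtain x3' x4' where 2: "q z' = (x3', x4')" by (cases "q z'")
          have x3: "x3 = x3'" using e 1 2 p12 by simp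
          have f: "((p1 - p2) * (x3 - y1) + p2 * D) * ((p1 - p2) * (x4 - y1) + p2 * D) = p1 * p2 * D ^ 2"
            "((p1 - p2) * (x3 - y1) + p2 * D) * ((p1 - p2) * (x4' - y1) + p2 * D) = p1 * p2 * D ^ 2"
            using q[OF z] q[OF z'] 1 2 x3 by (auto simp: P_def)
          then have "(p1 - p2) * (x3 - y1) + p2 * D \<noteq> 0" using nz by (metis mult_zero_left)
          then have "(p1 - p2) * (x4 - y1) + p2 * D = (p1 - p2) * (x4' - y1) + p2 * D" using f by (metis mult_cancel_left)
          then have "x4 = x4'" using p12 by simp
          then have ff: "fst z = fst z'" using q[OF z] q[OF z'] 1 2 x3 by (simp add: P_def)
          have "(fst z, snd z) \<in> sol_pairs 4 0 N" "(fst z', snd z') \<in> sol_pairs 4 0 N" using z z' by (auto simp: F_def G_def)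
          moreover have "y1 \<in># snd z" "y1 \<in># snd z'" using z z' y by (auto simp: F_def)
          ultimately have "snd z = snd z'" using sol_decode[of "fst z" "snd z" 4 0 N "snd z'"] unfolding ff by auto
          then show "z = z'" using ff by (simp add: prod_eq_iff)
        qed
      qed
      then have "real (card F) \<le> real (card {n. n dvd p1 * p2 * D ^ 2})" by simp
      also have "\<dots> \<le> C * real_of_int \<bar>p1 * p2 * D ^ 2\<bar> powr (\<epsilon> / 6)" by (rule C(2)[OF nz])
      also have "\<dots> \<le> C * (real N powr real 6) powr (\<epsilon> / 6)" using C(1) Mb \<open>\<epsilon> > 0\<close> by (intro mult_left_mono powr_mono2) auto
      also have "\<dots> = C * real N powr \<epsilon>" unfolding powr_powr by simp
      finally show ?thesis by (simp add: F_def)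
    qed
    then show "\<exists>C\<ge>0. \<forall>N\<ge>1. \<forall>z\<in>G N. \<forall>as us. distinct as \<and> length as = 2 \<and> length us = 2 \<and>
        set as \<subseteq> set_mset (snd z) \<and> mset us \<subseteq># fst z \<longrightarrow>
        real (card {z'\<in>G N. set as \<subseteq> set_mset (snd z') \<and> mset us \<subseteq># fst z'}) \<le> C * real N powr \<epsilon>"
      using C(1) by (intro exI[of _ C]) auto
  qed (auto simp: G_def)
  show "\<exists>C\<ge>0. \<forall>N\<ge>1. real (card (if i then paired N else {z \<in> sol_pairs 4 0 N. 2 \<le> card (set_mset (snd z)) \<and> z \<notin> paired N})) \<le> C * real N powr (2 + e + \<epsilon>)"
  proof (cases i)
    case True
    obtain C where C: "C \<ge> 0" "\<And>N. N \<ge> 1 \<Longrightarrow> real (card (paired N)) \<le> C * real N powr (3 + \<epsilon>)" using card_paired_le[OF eps] by auto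
    have "real (card (paired N)) \<le> C * real N powr (2 + e + \<epsilon>)" if "N \<ge> 1" for N
      using C(2)[OF that] mult_left_mono[OF powr_mono[of "3 + \<epsilon>" "2 + e + \<epsilon>" "real N"] C(1)] e that by simp
    then show ?thesis using True C(1) by auto
  qed (use G in \<open>auto simp: G_def\<close>)
qed (use e in \<open>auto simp: paired_def\<close>)

section \<open>The linear program for the costs\<close>

text \<open>The constraints of \<open>cost_profile\<close> for r = 2, written out for the first few
  indices as linear inequalities without sums and natural-number subtraction.\<close>

locale two_profile =
  fixes k :: nat and L w :: real and S T c g :: "nat \<Rightarrow> real"
  assumes L: "0 \<le> L" and profile: "cost_profile k 2 L w S T c g"
begin

lemma c: "t < k \<Longrightarrow> 0 \<le> c t"
  and S: "t < k \<Longrightarrow> 0 \<le> S t"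
  and T: "t < k \<Longrightarrow> T t \<le> 2 * L"
  and st: "t < k \<Longrightarrow> S t \<le> T t"
  and g_step: "t < k \<Longrightarrow> g t + T t - S t \<le> g (t + 1)"
  and known: "t < k \<Longrightarrow> 2 * g t \<le> (\<Sum>s<t. T s) + (real k - real t) * S t"
  using profile unfolding cost_profile_def by (auto simp: algebra_simps of_nat_diff)

lemma d: "t < k \<Longrightarrow> c t \<noteq> 0 \<Longrightarrow> c t + S t \<le> L" "t < k \<Longrightarrow> c t \<noteq> 0 \<Longrightarrow> 2 * c t + 2 * S t \<le> T t"
  using profile unfolding cost_profile_def by (auto simp: algebra_simps)

lemma h: "t < k \<Longrightarrow> 2 * c t + S t \<le> T t"
  using d(2)[of t] S[of t] st[of t] by (cases "c t = 0") auto

lemma g0: "g 0 = 0" using profile by (simp add: cost_profile_def)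

lemma g_nonneg: "t \<le> k \<Longrightarrow> 0 \<le> g t"
proof (induction t)
  case (Suc t)
  then show ?case using g_step[of t] st[of t] by simp
qed (simp add: g0)

lemma sum_upto: "(\<Sum>t<2. f t) = f 0 + f 1" "(\<Sum>t<3. f t) = f 0 + f 1 + f 2"
  "(\<Sum>t<4. f t) = f 0 + f 1 + f 2 + f 3" "(\<Sum>t<5. f t) = f 0 + f 1 + f 2 + f 3 + f 4" "(\<Sum>t<1. f t) = f 0"
  for f :: "nat \<Rightarrow> real"
  by (simp_all add: eval_nat_numeral)

lemma g1: "0 < k \<Longrightarrow> T 0 - S 0 \<le> g 1" and g2: "1 < k \<Longrightarrow> g 1 + T 1 - S 1 \<le> g 2"
  and g3: "2 < k \<Longrightarrow> g 2 + T 2 - S 2 \<le> g 3" and g4: "3 < k \<Longrightarrow> g 3 + T 3 - S 3 \<le> g 4"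
  and g5: "4 < k \<Longrightarrow> g 4 + T 4 - S 4 \<le> g 5"
  using g_step[of 0] g_step[of 1] g_step[of 2] g_step[of 3] g_step[of 4] by (simp_all add: g0 eval_nat_numeral)

lemma r1: "1 < k \<Longrightarrow> 2 * g 1 + S 1 \<le> T 0 + real k * S 1"
  and r2: "2 < k \<Longrightarrow> 2 * g 2 + 2 * S 2 \<le> T 0 + T 1 + real k * S 2"
  and r3: "3 < k \<Longrightarrow> 2 * g 3 + 3 * S 3 \<le> T 0 + T 1 + T 2 + real k * S 3"
  and r4: "4 < k \<Longrightarrow> 2 * g 4 + 4 * S 4 \<le> T 0 + T 1 + T 2 + T 3 + real k * S 4"
  using known[of 1] known[of 2] known[of 3] known[of 4] unfolding sum_upto left_diff_distrib of_nat_numeral of_nat_1 by linarith+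

end

lemma stops_withinI:
  assumes "\<And>L w S T c g. 0 \<le> L \<Longrightarrow> cost_profile k r L w S T c g \<Longrightarrow>
    (\<And>b. b \<in> B \<Longrightarrow> e * L < (\<Sum>t<b. c t) + (k * L - g b) / b) \<Longrightarrow> False"
  shows "stops_within k r B e"
  unfolding stops_within_def using assms by (meson not_le_imp_less)

text \<open>Branching on whether a cost vanishes leaves linear programs; the facts used in each branch
  are the support of a dual optimum.\<close>

lemma cost_le_3:
  assumes "0 \<le> L" "cost_profile 3 2 L w S T c g"
  shows "(\<Sum>t<2. c t) \<le> (1) * L"
proof (rule ccontr)
  assume neg: "\<not> ?thesis"
  interpret two_profile 3 L w S T c g using assms by unfold_locales
  have n: "1 * L < c 0 + c 1"
    using neg by (simp add: sum_upto field_simps)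
  have lt: "0 < (3::nat)" "1 < (3::nat)" by simp_all
  note r = r1[OF lt(2), unfolded of_nat_numeral]
  note g1 = g1[OF lt(1)]
  note g2 = g2[OF lt(2)]
  show False
  proof (cases "c 0 = 0")
    case z0: True
    show ?thesis
    using z0 h[OF lt(2)] T[OF lt(2)] n(1) S[OF lt(2)] L by linarith
  next
    case False
    note p0 = d[OF lt(1) False]
    show ?thesis
    proof (cases "c 1 = 0")
      case z1: True
      show ?thesis
      using p0(1) z1 n(1) S[OF lt(1)] L by linarith
    next
      case False
      note p1 = d[OF lt(2) False]
      show ?thesis
      using p0(2) g1 p1(1) r(1) n(1) L by linarith
    qed
  qed
qed

text \<open>The values 1, 3 / 2 and 2 for k = 3, 4, 5 are prescribed: with the two base points added
  they equal the minimum of r + k / r over integers r, less 1 / 2.\<close>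

lemma cost_le_4:
  assumes "0 \<le> L" "cost_profile 4 2 L w S T c g"
  shows "(\<Sum>t<2. c t) \<le> (3 / 2) * L"
proof (rule ccontr)
  assume neg: "\<not> ?thesis"
  interpret two_profile 4 L w S T c g using assms by unfold_locales
  have n: "3 * L < 2 * c 0 + 2 * c 1"
    using neg by (simp add: sum_upto field_simps)
  have lt: "0 < (4::nat)" "1 < (4::nat)" by simp_all
  note r = r1[OF lt(2), unfolded of_nat_numeral]
  note g1 = g1[OF lt(1)]
  note g2 = g2[OF lt(2)]
  show False
  proof (cases "c 1 = 0")
    case z1: True
    show ?thesis
    using h[OF lt(1)] T[OF lt(1)] z1 n(1) S[OF lt(1)] L by linarith
  next
    case False
    note p1 = d[OF lt(2) False]
    show ?thesis
    using h[OF lt(1)] T[OF lt(1)] g1 p1(1) r(1) n(1) S[OF lt(2)] L by linarith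
  qed
qed

lemma cost_le_5:
  assumes "0 \<le> L" "cost_profile 5 2 L w S T c g"
  shows "(\<Sum>t<4. c t) \<le> (2) * L"
proof (rule ccontr)
  assume neg: "\<not> ?thesis"
  interpret two_profile 5 L w S T c g using assms by unfold_locales
  have n: "2 * L < c 0 + c 1 + c 2 + c 3"
    using neg by (simp add: sum_upto field_simps)
  have lt: "0 < (5::nat)" "1 < (5::nat)" "2 < (5::nat)" "3 < (5::nat)" by simp_all
  note r = r1[OF lt(2), unfolded of_nat_numeral] r2[OF lt(3), unfolded of_nat_numeral] r3[OF lt(4), unfolded of_nat_numeral]
  note g1 = g1[OF lt(1)]
  note g2 = g2[OF lt(2)]
  note g3 = g3[OF lt(3)]
  note g4 = g4[OF lt(4)]
  have gn: "0 \<le> g 1" "0 \<le> g 2" "0 \<le> g 3" by (rule g_nonneg; simp)+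
  show False
  proof (cases "c 3 = 0")
    case z3: True
    show ?thesis
    proof (cases "c 2 = 0")
      case z2: True
      show ?thesis
      using h[OF lt(1)] T[OF lt(1)] g1 h[OF lt(2)] T[OF lt(2)] r(1) z2 z3 n(1) S[OF lt(1)] L by linarith
    next
      case False
      note p2 = d[OF lt(3) False]
      show ?thesis
      using h[OF lt(1)] T[OF lt(1)] g1 h[OF lt(2)] T[OF lt(2)] g2 p2(1) r(2) z3 n(1) S[OF lt(3)] L by linarith
    qed
  next
    case False
    note p3 = d[OF lt(4) False]
    show ?thesis
    proof (cases "c 0 = 0")
      case z0: True
      show ?thesis
      proof (cases "c 1 = 0")
        case z1: True
        show ?thesis
        using z0 z1 h[OF lt(3)] T[OF lt(3)] p3(1) n(1) S[OF lt(3)] S[OF lt(4)] L by linarith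
      next
        case False
        note p1 = d[OF lt(2) False]
        show ?thesis
        proof (cases "c 2 = 0")
          case z2: True
          show ?thesis
          using z0 p1(1) z2 p3(1) n(1) S[OF lt(2)] S[OF lt(4)] L by linarith
        next
          case False
          note p2 = d[OF lt(3) False]
          show ?thesis
          using z0 T[OF lt(1)] p1(2) g2 p2(2) g3 p3(1) r(3) n(1) gn(1) L by linarith
        qed
      qed
    next
      case False
      note p0 = d[OF lt(1) False]
      show ?thesis
      proof (cases "c 1 = 0")
        case z1: True
        show ?thesis
        proof (cases "c 2 = 0")
          case z2: True
          show ?thesis
          using p0(1) z1 z2 p3(1) n(1) S[OF lt(1)] S[OF lt(4)] L by linarith
        next
          case False
          note p2 = d[OF lt(3) False]
          show ?thesis
          using p0(2) g1 z1 st[OF lt(2)] T[OF lt(2)] g2 p2(2) g3 p3(1) r(3) n(1) L by linarith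
        qed
      next
        case False
        note p1 = d[OF lt(2) False]
        show ?thesis
        using p0(2) g1 p1(2) g2 h[OF lt(3)] T[OF lt(3)] g3 p3(1) r(3) n(1) c[OF lt(3)] L by linarith
      qed
    qed
  qed
qed

text \<open>For k from 6 to 11 the value is k / 3 + 1 / 2. This makes 2 plus the value equal to 3 +
  k / 3 - 1 / 2, the target for d = 0, as r + k / r is least at r = 3 for these k.\<close>

lemma stops_within_6: "stops_within 6 2 {4} (5 / 2)"
proof (rule stops_withinI)
  fix L w S T c g assume a: "0 \<le> L" "cost_profile 6 2 L w S T c g"
    "\<And>b. b \<in> {4} \<Longrightarrow> (5 / 2) * L < (\<Sum>t<b. c t) + (real 6 * L - g b) / real b"
  interpret two_profile 6 L w S T c g using a by unfold_locales
  have n: "20 * L < 8 * c 0 + 8 * c 1 + 8 * c 2 + 8 * c 3 + 12 * L - 2 * g 4"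
    using a(3)[of 4] by (simp_all add: sum_upto field_simps)
  have lt: "0 < (6::nat)" "1 < (6::nat)" "2 < (6::nat)" "3 < (6::nat)" by simp_all
  note r = r1[OF lt(2), unfolded of_nat_numeral] r2[OF lt(3), unfolded of_nat_numeral] r3[OF lt(4), unfolded of_nat_numeral]
  note g1 = g1[OF lt(1)]
  note g2 = g2[OF lt(2)]
  note g3 = g3[OF lt(3)]
  note g4 = g4[OF lt(4)]
  have gn: "0 \<le> g 1" "0 \<le> g 2" "0 \<le> g 3" by (rule g_nonneg; simp)+
  show False
  proof (cases "c 3 = 0")
    case z3: True
    show ?thesis
    proof (cases "c 2 = 0")
      case z2: True
      show ?thesis
      using h[OF lt(1)] T[OF lt(1)] g1 h[OF lt(2)] T[OF lt(2)] r(1) g2 z2 st[OF lt(3)] g3 z3 st[OF lt(4)] g4 n(1) S[OF lt(1)] L by linarith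
    next
      case False
      note p2 = d[OF lt(3) False]
      show ?thesis
      using h[OF lt(1)] T[OF lt(1)] g1 h[OF lt(2)] T[OF lt(2)] g2 p2(1) p2(2) r(2) g3 z3 st[OF lt(4)] g4 n(1) S[OF lt(3)] L by linarith
    qed
  next
    case False
    note p3 = d[OF lt(4) False]
    show ?thesis
    proof (cases "c 0 = 0")
      case z0: True
      show ?thesis
      proof (cases "c 1 = 0")
        case z1: True
        show ?thesis
        using z0 z1 h[OF lt(3)] T[OF lt(3)] g3 p3(1) p3(2) g4 n(1) S[OF lt(3)] S[OF lt(4)] gn(2) L by linarith
      next
        case False
        note p1 = d[OF lt(2) False]
        show ?thesis
        proof (cases "c 2 = 0")
          case z2: True
          show ?thesis
          using z0 p1(1) p1(2) g2 z2 st[OF lt(3)] g3 p3(1) p3(2) g4 n(1) S[OF lt(2)] S[OF lt(4)] gn(1) L by linarith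
        next
          case False
          note p2 = d[OF lt(3) False]
          show ?thesis
          using z0 T[OF lt(1)] p1(2) g2 p2(2) g3 p3(1) p3(2) r(3) g4 n(1) S[OF lt(2)] S[OF lt(3)] gn(1) L by linarith
        qed
      qed
    next
      case False
      note p0 = d[OF lt(1) False]
      show ?thesis
      proof (cases "c 1 = 0")
        case z1: True
        show ?thesis
        proof (cases "c 2 = 0")
          case z2: True
          show ?thesis
          using p0(1) p0(2) g1 z1 st[OF lt(2)] g2 z2 st[OF lt(3)] g3 p3(1) p3(2) g4 n(1) S[OF lt(1)] S[OF lt(4)] L by linarith
        next
          case False
          note p2 = d[OF lt(3) False]
          show ?thesis
          using p0(2) g1 z1 st[OF lt(2)] T[OF lt(2)] g2 p2(2) g3 p3(1) p3(2) r(3) g4 n(1) S[OF lt(1)] S[OF lt(3)] L by linarith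
        qed
      next
        case False
        note p1 = d[OF lt(2) False]
        show ?thesis
        using p0(2) g1 p1(2) g2 h[OF lt(3)] T[OF lt(3)] g3 p3(1) p3(2) r(3) g4 n(1) c[OF lt(3)] S[OF lt(1)] S[OF lt(2)] L by linarith
      qed
    qed
  qed
qed

text \<open>Two stopping points are offered: depending on which costs vanish, a branch is settled by
  b = 4 or by b = 5.\<close>

lemma stops_within_7: "stops_within 7 2 {4, 5} (17 / 6)"
proof (rule stops_withinI)
  fix L w S T c g assume a: "0 \<le> L" "cost_profile 7 2 L w S T c g"
    "\<And>b. b \<in> {4, 5} \<Longrightarrow> (17 / 6) * L < (\<Sum>t<b. c t) + (real 7 * L - g b) / real b"
  interpret two_profile 7 L w S T c g using a by unfold_locales
  have n: "68 * L < 24 * c 0 + 24 * c 1 + 24 * c 2 + 24 * c 3 + 42 * L - 6 * g 4" "85 * L < 30 * c 0 + 30 * c 1 + 30 * c 2 + 30 * c 3 + 30 * c 4 + 42 * L - 6 * g 5"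
    using a(3)[of 4] a(3)[of 5] by (simp_all add: sum_upto field_simps)
  have lt: "0 < (7::nat)" "1 < (7::nat)" "2 < (7::nat)" "3 < (7::nat)" "4 < (7::nat)" by simp_all
  note r = r1[OF lt(2), unfolded of_nat_numeral] r2[OF lt(3), unfolded of_nat_numeral] r3[OF lt(4), unfolded of_nat_numeral] r4[OF lt(5), unfolded of_nat_numeral]
  note g1 = g1[OF lt(1)]
  note g2 = g2[OF lt(2)]
  note g3 = g3[OF lt(3)]
  note g4 = g4[OF lt(4)]
  note g5 = g5[OF lt(5)]
  have gn: "0 \<le> g 1" "0 \<le> g 2" "0 \<le> g 3" "0 \<le> g 4" by (rule g_nonneg; simp)+
  show False
  proof (cases "c 3 = 0")
    case z3: True
    show ?thesis
    proof (cases "c 2 = 0")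
      case z2: True
      show ?thesis
      using h[OF lt(1)] T[OF lt(1)] g1 h[OF lt(2)] T[OF lt(2)] r(1) g2 z2 st[OF lt(3)] g3 z3 st[OF lt(4)] g4 n(1) S[OF lt(1)] L by linarith
    next
      case False
      note p2 = d[OF lt(3) False]
      show ?thesis
      using h[OF lt(1)] T[OF lt(1)] g1 h[OF lt(2)] T[OF lt(2)] g2 p2(1) p2(2) r(2) g3 z3 st[OF lt(4)] g4 n(1) S[OF lt(3)] L by linarith
    qed
  next
    case False
    note p3 = d[OF lt(4) False]
    show ?thesis
    proof (cases "c 4 = 0")
      case z4: True
      show ?thesis
      proof (cases "c 0 = 0")
        case z0: True
        show ?thesis
        proof (cases "c 1 = 0")
          case z1: True
          show ?thesis
          using z0 z1 h[OF lt(3)] T[OF lt(3)] g3 p3(1) p3(2) g4 z4 st[OF lt(5)] g5 n(2) S[OF lt(3)] S[OF lt(4)] gn(2) L by linarith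
        next
          case False
          note p1 = d[OF lt(2) False]
          show ?thesis
          proof (cases "c 2 = 0")
            case z2: True
            show ?thesis
            using z0 p1(1) p1(2) g2 z2 st[OF lt(3)] g3 p3(1) p3(2) g4 z4 st[OF lt(5)] g5 n(2) S[OF lt(2)] S[OF lt(4)] gn(1) L by linarith
          next
            case False
            note p2 = d[OF lt(3) False]
            show ?thesis
            using z0 T[OF lt(1)] p1(1) p1(2) g2 p2(1) p2(2) g3 p3(1) p3(2) r(3) g4 z4 st[OF lt(5)] g5 n(2) S[OF lt(2)] S[OF lt(3)] gn(1) L by linarith
          qed
        qed
      next
        case False
        note p0 = d[OF lt(1) False]
        show ?thesis
        proof (cases "c 1 = 0")
          case z1: True
          show ?thesis
          proof (cases "c 2 = 0")
            case z2: True
            show ?thesis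
            using p0(1) p0(2) g1 z1 st[OF lt(2)] g2 z2 st[OF lt(3)] g3 p3(1) p3(2) g4 z4 st[OF lt(5)] g5 n(2) S[OF lt(1)] S[OF lt(4)] L by linarith
          next
            case False
            note p2 = d[OF lt(3) False]
            show ?thesis
            using p0(1) p0(2) g1 z1 st[OF lt(2)] T[OF lt(2)] g2 p2(1) p2(2) g3 p3(1) p3(2) r(3) g4 z4 st[OF lt(5)] g5 n(2) S[OF lt(1)] S[OF lt(3)] L by linarith
          qed
        next
          case False
          note p1 = d[OF lt(2) False]
          show ?thesis
          using p0(1) p0(2) g1 p1(1) p1(2) r(1) g2 h[OF lt(3)] T[OF lt(3)] g3 p3(1) p3(2) r(3) g4 z4 st[OF lt(5)] g5 n(2) c[OF lt(3)] S[OF lt(1)] L by linarith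
        qed
      qed
    next
      case False
      note p4 = d[OF lt(5) False]
      show ?thesis
      proof (cases "c 0 = 0")
        case z0: True
        show ?thesis
        proof (cases "c 1 = 0")
          case z1: True
          show ?thesis
          using z0 z1 h[OF lt(3)] T[OF lt(3)] g3 p3(1) p3(2) g4 n(1) S[OF lt(3)] S[OF lt(4)] gn(2) L by linarith
        next
          case False
          note p1 = d[OF lt(2) False]
          show ?thesis
          proof (cases "c 2 = 0")
            case z2: True
            show ?thesis
            using z0 p1(1) p1(2) g2 z2 st[OF lt(3)] g3 p3(1) p3(2) g4 n(1) S[OF lt(2)] S[OF lt(4)] gn(1) L by linarith
          next
            case False
            note p2 = d[OF lt(3) False]
            show ?thesis
            using z0 T[OF lt(1)] p1(2) g2 p2(2) g3 p3(1) p3(2) r(3) g4 p4(1) p4(2) r(4) g5 n(2) S[OF lt(2)] S[OF lt(3)] S[OF lt(4)] gn(1) L by linarith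
          qed
        qed
      next
        case False
        note p0 = d[OF lt(1) False]
        show ?thesis
        proof (cases "c 1 = 0")
          case z1: True
          show ?thesis
          proof (cases "c 2 = 0")
            case z2: True
            show ?thesis
            using p0(1) p0(2) g1 z1 st[OF lt(2)] g2 z2 st[OF lt(3)] g3 p3(1) p3(2) g4 n(1) S[OF lt(1)] S[OF lt(4)] L by linarith
          next
            case False
            note p2 = d[OF lt(3) False]
            show ?thesis
            using p0(2) g1 z1 st[OF lt(2)] T[OF lt(2)] g2 p2(2) g3 p3(1) p3(2) r(3) g4 p4(1) p4(2) r(4) g5 n(2) S[OF lt(1)] S[OF lt(3)] S[OF lt(4)] L by linarith
          qed
        next
          case False
          note p1 = d[OF lt(2) False]
          show ?thesis
          using p0(2) g1 p1(1) p1(2) r(1) g2 h[OF lt(3)] T[OF lt(3)] g3 p3(1) p3(2) g4 p4(1) p4(2) r(4) g5 n(2) c[OF lt(3)] S[OF lt(1)] S[OF lt(2)] S[OF lt(4)] L by linarith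
        qed
      qed
    qed
  qed
qed

lemma stops_within_8: "stops_within 8 2 {4, 5} (19 / 6)"
proof (rule stops_withinI)
  fix L w S T c g assume a: "0 \<le> L" "cost_profile 8 2 L w S T c g"
    "\<And>b. b \<in> {4, 5} \<Longrightarrow> (19 / 6) * L < (\<Sum>t<b. c t) + (real 8 * L - g b) / real b"
  interpret two_profile 8 L w S T c g using a by unfold_locales
  have n: "76 * L < 24 * c 0 + 24 * c 1 + 24 * c 2 + 24 * c 3 + 48 * L - 6 * g 4" "95 * L < 30 * c 0 + 30 * c 1 + 30 * c 2 + 30 * c 3 + 30 * c 4 + 48 * L - 6 * g 5"
    using a(3)[of 4] a(3)[of 5] by (simp_all add: sum_upto field_simps)
  have lt: "0 < (8::nat)" "1 < (8::nat)" "2 < (8::nat)" "3 < (8::nat)" "4 < (8::nat)" by simp_all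
  note r = r1[OF lt(2), unfolded of_nat_numeral] r2[OF lt(3), unfolded of_nat_numeral] r3[OF lt(4), unfolded of_nat_numeral] r4[OF lt(5), unfolded of_nat_numeral]
  note g1 = g1[OF lt(1)]
  note g2 = g2[OF lt(2)]
  note g3 = g3[OF lt(3)]
  note g4 = g4[OF lt(4)]
  note g5 = g5[OF lt(5)]
  have gn: "0 \<le> g 1" "0 \<le> g 2" "0 \<le> g 3" "0 \<le> g 4" by (rule g_nonneg; simp)+
  show False
  proof (cases "c 3 = 0")
    case z3: True
    show ?thesis
    proof (cases "c 1 = 0")
      case z1: True
      show ?thesis
      using h[OF lt(1)] T[OF lt(1)] g1 z1 st[OF lt(2)] g2 h[OF lt(3)] T[OF lt(3)] g3 z3 st[OF lt(4)] g4 n(1) S[OF lt(1)] S[OF lt(3)] L by linarith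
    next
      case False
      note p1 = d[OF lt(2) False]
      show ?thesis
      using h[OF lt(1)] T[OF lt(1)] g1 p1(1) p1(2) r(1) g2 h[OF lt(3)] T[OF lt(3)] r(2) g3 z3 st[OF lt(4)] g4 n(1) S[OF lt(2)] L by linarith
    qed
  next
    case False
    note p3 = d[OF lt(4) False]
    show ?thesis
    proof (cases "c 4 = 0")
      case z4: True
      show ?thesis
      using h[OF lt(1)] T[OF lt(1)] g1 h[OF lt(2)] T[OF lt(2)] g2 h[OF lt(3)] T[OF lt(3)] g3 p3(1) p3(2) r(3) g4 z4 st[OF lt(5)] g5 n(2) S[OF lt(4)] L by linarith
    next
      case False
      note p4 = d[OF lt(5) False]
      show ?thesis
      proof (cases "c 0 = 0")
        case z0: True
        show ?thesis
        proof (cases "c 1 = 0")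
          case z1: True
          show ?thesis
          using z0 z1 h[OF lt(3)] T[OF lt(3)] g3 p3(1) p3(2) g4 n(1) S[OF lt(3)] S[OF lt(4)] gn(2) L by linarith
        next
          case False
          note p1 = d[OF lt(2) False]
          show ?thesis
          proof (cases "c 2 = 0")
            case z2: True
            show ?thesis
            using z0 p1(1) p1(2) g2 z2 st[OF lt(3)] g3 p3(1) p3(2) g4 n(1) S[OF lt(2)] S[OF lt(4)] gn(1) L by linarith
          next
            case False
            note p2 = d[OF lt(3) False]
            show ?thesis
            using z0 T[OF lt(1)] p1(1) p1(2) g2 p2(1) p2(2) g3 p3(1) p3(2) r(3) g4 p4(1) p4(2) r(4) g5 n(2) S[OF lt(2)] S[OF lt(3)] gn(1) L by linarith
          qed
        qed
      next
        case False
        note p0 = d[OF lt(1) False]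
        show ?thesis
        proof (cases "c 1 = 0")
          case z1: True
          show ?thesis
          proof (cases "c 2 = 0")
            case z2: True
            show ?thesis
            using p0(1) p0(2) g1 z1 st[OF lt(2)] g2 z2 st[OF lt(3)] g3 p3(1) p3(2) g4 n(1) S[OF lt(1)] S[OF lt(4)] L by linarith
          next
            case False
            note p2 = d[OF lt(3) False]
            show ?thesis
            using p0(1) p0(2) g1 z1 st[OF lt(2)] T[OF lt(2)] g2 p2(1) p2(2) g3 p3(1) p3(2) r(3) g4 p4(1) p4(2) r(4) g5 n(2) S[OF lt(1)] S[OF lt(3)] L by linarith
          qed
        next
          case False
          note p1 = d[OF lt(2) False]
          show ?thesis
          using p0(2) g1 p1(1) p1(2) r(1) g2 h[OF lt(3)] T[OF lt(3)] g3 p3(1) p3(2) r(3) g4 p4(1) p4(2) r(4) g5 n(2) c[OF lt(3)] S[OF lt(1)] S[OF lt(4)] L by linarith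
        qed
      qed
    qed
  qed
qed

lemma stops_within_9: "stops_within 9 2 {4} (7 / 2)"
proof (rule stops_withinI)
  fix L w S T c g assume a: "0 \<le> L" "cost_profile 9 2 L w S T c g"
    "\<And>b. b \<in> {4} \<Longrightarrow> (7 / 2) * L < (\<Sum>t<b. c t) + (real 9 * L - g b) / real b"
  interpret two_profile 9 L w S T c g using a by unfold_locales
  have n: "28 * L < 8 * c 0 + 8 * c 1 + 8 * c 2 + 8 * c 3 + 18 * L - 2 * g 4"
    using a(3)[of 4] by (simp_all add: sum_upto field_simps)
  have lt: "0 < (9::nat)" "1 < (9::nat)" "2 < (9::nat)" "3 < (9::nat)" by simp_all
  note r = r1[OF lt(2), unfolded of_nat_numeral] r2[OF lt(3), unfolded of_nat_numeral] r3[OF lt(4), unfolded of_nat_numeral]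
  note g1 = g1[OF lt(1)]
  note g2 = g2[OF lt(2)]
  note g3 = g3[OF lt(3)]
  note g4 = g4[OF lt(4)]
  show False
  proof (cases "c 3 = 0")
    case z3: True
    show ?thesis
    proof (cases "c 1 = 0")
      case z1: True
      show ?thesis
      using h[OF lt(1)] T[OF lt(1)] g1 z1 st[OF lt(2)] g2 h[OF lt(3)] T[OF lt(3)] g3 z3 st[OF lt(4)] g4 n(1) S[OF lt(1)] S[OF lt(3)] L by linarith
    next
      case False
      note p1 = d[OF lt(2) False]
      show ?thesis
      using h[OF lt(1)] T[OF lt(1)] g1 p1(1) p1(2) r(1) g2 h[OF lt(3)] T[OF lt(3)] r(2) g3 z3 st[OF lt(4)] g4 n(1) S[OF lt(1)] L by linarith
    qed
  next
    case False
    note p3 = d[OF lt(4) False]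
    show ?thesis
    using h[OF lt(1)] T[OF lt(1)] g1 h[OF lt(2)] T[OF lt(2)] g2 h[OF lt(3)] T[OF lt(3)] g3 p3(1) p3(2) r(3) g4 n(1) L by linarith
  qed
qed

lemma stops_within_10: "stops_within 10 2 {4} (23 / 6)"
proof (rule stops_withinI)
  fix L w S T c g assume a: "0 \<le> L" "cost_profile 10 2 L w S T c g"
    "\<And>b. b \<in> {4} \<Longrightarrow> (23 / 6) * L < (\<Sum>t<b. c t) + (real 10 * L - g b) / real b"
  interpret two_profile 10 L w S T c g using a by unfold_locales
  have n: "92 * L < 24 * c 0 + 24 * c 1 + 24 * c 2 + 24 * c 3 + 60 * L - 6 * g 4"
    using a(3)[of 4] by (simp_all add: sum_upto field_simps)
  have lt: "0 < (10::nat)" "1 < (10::nat)" "2 < (10::nat)" "3 < (10::nat)" by simp_all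
  note r = r1[OF lt(2), unfolded of_nat_numeral] r2[OF lt(3), unfolded of_nat_numeral] r3[OF lt(4), unfolded of_nat_numeral]
  note g1 = g1[OF lt(1)]
  note g2 = g2[OF lt(2)]
  note g3 = g3[OF lt(3)]
  note g4 = g4[OF lt(4)]
  show False
  proof (cases "c 3 = 0")
    case z3: True
    show ?thesis
    using h[OF lt(1)] T[OF lt(1)] g1 h[OF lt(2)] T[OF lt(2)] r(1) g2 h[OF lt(3)] T[OF lt(3)] r(2) g3 z3 st[OF lt(4)] g4 n(1) S[OF lt(1)] L by linarith
  next
    case False
    note p3 = d[OF lt(4) False]
    show ?thesis
    using h[OF lt(1)] T[OF lt(1)] g1 h[OF lt(2)] T[OF lt(2)] r(1) g2 h[OF lt(3)] T[OF lt(3)] r(2) g3 p3(1) p3(2) r(3) g4 n(1) S[OF lt(1)] L by linarith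
  qed
qed

lemma stops_within_11: "stops_within 11 2 {4} (25 / 6)"
proof (rule stops_withinI)
  fix L w S T c g assume a: "0 \<le> L" "cost_profile 11 2 L w S T c g"
    "\<And>b. b \<in> {4} \<Longrightarrow> (25 / 6) * L < (\<Sum>t<b. c t) + (real 11 * L - g b) / real b"
  interpret two_profile 11 L w S T c g using a by unfold_locales
  have n: "100 * L < 24 * c 0 + 24 * c 1 + 24 * c 2 + 24 * c 3 + 66 * L - 6 * g 4"
    using a(3)[of 4] by (simp_all add: sum_upto field_simps)
  have lt: "0 < (11::nat)" "1 < (11::nat)" "2 < (11::nat)" "3 < (11::nat)" by simp_all
  note r = r1[OF lt(2), unfolded of_nat_numeral] r2[OF lt(3), unfolded of_nat_numeral] r3[OF lt(4), unfolded of_nat_numeral]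
  note g1 = g1[OF lt(1)]
  note g2 = g2[OF lt(2)]
  note g3 = g3[OF lt(3)]
  note g4 = g4[OF lt(4)]
  show False
  proof (cases "c 3 = 0")
    case z3: True
    show ?thesis
    using h[OF lt(1)] T[OF lt(1)] g1 h[OF lt(2)] T[OF lt(2)] r(1) g2 h[OF lt(3)] T[OF lt(3)] r(2) g3 z3 st[OF lt(4)] g4 n(1) S[OF lt(1)] L by linarith
  next
    case False
    note p3 = d[OF lt(4) False]
    show ?thesis
    using h[OF lt(1)] T[OF lt(1)] g1 h[OF lt(2)] T[OF lt(2)] r(1) g2 h[OF lt(3)] T[OF lt(3)] r(2) g3 p3(1) p3(2) r(3) g4 n(1) S[OF lt(1)] L by linarith
  qed
qed

text \<open>Consider the last nonzero cost c t, and let C be the sum before it. Since g t >= r C,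
  the greedy inequality gives r^2 C - r t L <= (k - t) S t, whereas c t <= L - S t: large earlier
  costs make the next hit part large and the next cost small. Eliminating S t yields r^2 (C + c t)
  <= (k + (r - 1) t) L if r^2 <= k - t, and r (C + c t) <= (r + t) L otherwise; with t <= b - 1
  these are the two conditions on M.\<close>

lemma cost_sum_le:
  fixes M :: real
  assumes p: "cost_profile k r L w S T c g" and r: "1 \<le> r" and L: "0 \<le> L" and b: "1 \<le> b" "b \<le> k"
    and M: "k + (real r - 1) * (real b - 1) \<le> r ^ 2 * M" "r + (real b - 1) \<le> r * M"
  shows "(\<Sum>t<b. c t) \<le> M * L"
proof -
  have M0: "0 \<le> M"
  proof -
    have "0 \<le> r * M" by (rule order_trans[OF _ M(2)]) (use b in auto)
    then show ?thesis using r by (simp add: zero_le_mult_iff)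
  qed
  have "(\<Sum>t<j. c t) \<le> M * L" if "j \<le> b" for j
    using that
  proof (induction j)
    case 0
    then show ?case using M0 L by simp
  next
    case (Suc t)
    define C where "C = (\<Sum>s<t. c s)"
    have tk: "t < k" using Suc.prems b by simp
    have IH: "C \<le> M * L" using Suc by (simp add: C_def)
    have tb: "real t \<le> real b - 1" using Suc.prems by simp
    show ?case
    proof (cases "c t = 0")
      case True
      then show ?thesis using IH by (simp add: C_def)
    next
      case False
      have f: "c t + S t \<le> L" "0 \<le> S t" "0 \<le> c t" "r * g t - (\<Sum>s<t. T s) \<le> real (k - t) * S t"
        using p tk False unfolding cost_profile_def by auto
      have "(\<Sum>s<t. T s) \<le> (\<Sum>s<t. r * L)"
        using p tk unfolding cost_profile_def by (intro sum_mono) auto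
      moreover have "real r * (r * C) \<le> real r * g t"
        unfolding C_def using cost_profile_sum[OF p r, of t] tk by (intro mult_left_mono) auto
      ultimately have S: "r ^ 2 * C - r * (t * L) \<le> (real k - t) * S t"
        using f(4) tk by (simp add: of_nat_diff power2_eq_square algebra_simps)
      have kt: "real k - t > 0" using tk by simp
      have cS: "c t \<le> L - S t" using f by simp
      have goal: "C + c t \<le> M * L"
      proof (cases "r ^ 2 \<le> real k - t")
        case True
        have "r ^ 2 * (C + c t) \<le> r ^ 2 * C + r ^ 2 * (L - S t)"
          using mult_left_mono[OF cS, of "real (r ^ 2)"] by (simp add: distrib_left)
        also have "\<dots> \<le> (real k - t) * S t + r * (t * L) + r ^ 2 * (L - S t)" using S by simp
        also have "\<dots> = (real k - t) * L + r * (t * L) + (r ^ 2 - (real k - t)) * (L - S t)" by (simp add: algebra_simps)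
        also have "\<dots> \<le> (real k - t) * L + r * (t * L)"
          using True cS f(3) by (simp add: mult_nonpos_nonneg)
        also have "\<dots> = (k + (real r - 1) * t) * L" by (simp add: algebra_simps)
        also have "\<dots> \<le> (k + (real r - 1) * (real b - 1)) * L"
          using tb r L by (intro mult_right_mono add_left_mono mult_left_mono) auto
        also have "\<dots> \<le> (r ^ 2 * M) * L" using M(1) L by (intro mult_right_mono) auto
        finally have "r ^ 2 * (C + c t) \<le> r ^ 2 * (M * L)" by (simp add: mult.assoc)
        then show ?thesis using r by (simp add: mult_le_cancel_left)
      next
        case False
        have "r * C - t * L \<le> r * S t"
        proof (cases "r * C - t * L \<le> 0")
          case True
          then show ?thesis using f(2) by (meson mult_nonneg_nonneg of_nat_0_le_iff order_trans)
        next
          case pos: False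
          have "(real k - t) * (r * C - t * L) \<le> r ^ 2 * (r * C - t * L)"
            using False pos by (intro mult_right_mono) auto
          also have "\<dots> = r * (r ^ 2 * C - r * (t * L))" by (simp add: power2_eq_square algebra_simps)
          also have "\<dots> \<le> r * ((real k - t) * S t)" using S by (intro mult_left_mono) auto
          also have "\<dots> = (real k - t) * (r * S t)" by simp
          finally show ?thesis using kt by (simp add: mult_le_cancel_left)
        qed
        moreover have "r * c t \<le> r * (L - S t)" using cS by (intro mult_left_mono) auto
        ultimately have "r * (C + c t) \<le> (r + t) * L" by (simp add: algebra_simps)
        also have "\<dots> \<le> (r + (real b - 1)) * L" using tb L by (intro mult_right_mono) auto
        also have "\<dots> \<le> (r * M) * L" using M(2) L by (intro mult_right_mono) auto
        finally have "r * (C + c t) \<le> r * (M * L)" by (simp add: mult.assoc)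
        then show ?thesis using r by (simp add: mult_le_cancel_left)
      qed
      then show ?thesis by (simp add: C_def)
    qed
  qed
  then show ?thesis by blast
qed

text \<open>With C the sum of the first b costs, g b >= r C bounds the total by k / b L + (1 - r /
  b) C, which increases with C because r <= b.\<close>

lemma stops_within_single:
  fixes M :: real
  assumes r: "1 \<le> r" "r \<le> b" and b: "b \<le> k"
    and M: "k + (real r - 1) * (real b - 1) \<le> r ^ 2 * M" "r + (real b - 1) \<le> r * M"
  shows "stops_within k r {b} (k / b + (1 - r / b) * M)"
proof (rule stops_withinI)
  fix L w :: real and S T c g :: "nat \<Rightarrow> real"
  assume L: "0 \<le> L" and p: "cost_profile k r L w S T c g"
    and n: "\<And>b'. b' \<in> {b} \<Longrightarrow> (k / b + (1 - r / b) * M) * L < (\<Sum>t<b'. c t) + (k * L - g b') / b'"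
  define C where "C = (\<Sum>t<b. c t)"
  have b0: "real b > 0" using r by simp
  have "(k * L - g b) / b \<le> (k * L - r * C) / b"
    using cost_profile_sum[OF p r(1) b] b0 by (intro divide_right_mono) (auto simp: C_def)
  then have "C + (k * L - g b) / b \<le> C + (k * L - r * C) / b" by simp
  also have "\<dots> = k / b * L + (1 - r / b) * C" using b0 by (simp add: field_simps)
  also have "\<dots> \<le> k / b * L + (1 - r / b) * (M * L)"
    unfolding C_def using cost_sum_le[OF p r(1) L _ b M] r b0
    by (intro add_left_mono mult_left_mono) auto
  finally show False using n[of b] by (simp add: C_def algebra_simps)
qed

section \<open>Comparison of exponents\<close>

text \<open>Truncated subtraction makes this the last sum in \<open>gamma_exponent\<close>, with the
  index shifted by one. It is constant in r from r = d on.\<close>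

definition tri :: "nat \<Rightarrow> nat \<Rightarrow> real" where
  "tri r d = (\<Sum>l<r. real (d - l))"

lemma tri_ge: "d \<le> r \<Longrightarrow> tri r d = tri d d"
  unfolding tri_def by (rule sum.mono_neutral_right) auto

text \<open>Replacing d by d - c lowers the summand l = 0 by exactly c, which pays for c freely
  chosen common values.\<close>

lemma tri_shift: "1 \<le> r \<Longrightarrow> c \<le> d \<Longrightarrow> c + tri r (d - c) \<le> tri r d"
proof -
  assume a: "1 \<le> r" "c \<le> d"
  have e: "{..<r} = insert 0 {1..<r}" using a(1) by auto
  have "(\<Sum>l=1..<r. real (d - c - l)) \<le> (\<Sum>l=1..<r. real (d - l))" by (intro sum_mono) auto
  then show ?thesis using a(2) unfolding tri_def e by (simp add: of_nat_diff)
qed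

text \<open>r + k / r is convex with its minimum at the square root of k, so among integers s or s +
  1 is best. After clearing denominators this reads (s - r) (k - s r) >= 0 for r <= s, and (r - s -
  1) ((s + 1) r - k) >= 0 for r > s.\<close>

lemma add_divide_ge_min:
  fixes s k r :: nat
  assumes s: "s ^ 2 \<le> k" "k \<le> (s + 1) ^ 2" and r: "1 \<le> r"
  shows "min (s + k / s) (real s + 1 + k / (real s + 1)) \<le> r + k / r"
proof (cases "r \<le> s")
  case True
  have "(real s - r) * (real s * r) \<le> (real s - r) * k"
  proof (rule mult_left_mono)
    have "s * r \<le> s * s" using True by (rule mult_le_mono2)
    then have "s * r \<le> k" using s(1) unfolding power2_eq_square by (rule order_trans)
    then show "real s * r \<le> k" by (metis of_nat_le_iff of_nat_mult)
  qed (use True in simp)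
  then have "s + k / s \<le> r + k / r" using r True by (simp add: field_simps)
  then show ?thesis by linarith
next
  case False
  have "(real r - (real s + 1)) * k \<le> (real r - (real s + 1)) * ((real s + 1) * r)"
  proof (rule mult_left_mono)
    have "(s + 1) * (s + 1) \<le> (s + 1) * r" using False by (intro mult_le_mono) auto
    then have "k \<le> (s + 1) * r" using s unfolding power2_eq_square by linarith
    then have "real k \<le> real ((s + 1) * r)" by (simp only: of_nat_le_iff)
    then show "real k \<le> (real s + 1) * r" by (simp add: distrib_right)
  qed (use False in simp)
  then have "real s + 1 + k / (real s + 1) \<le> r + k / r" using r by (simp add: field_simps)
  then show ?thesis by linarith
qed

text \<open>Expand (b^i - a^i) (b^(m - i) - a^(m - i)) >= 0.\<close>

lemma power_pair_le:
  fixes a b :: real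
  assumes "0 \<le> a" "a \<le> b" "i \<le> m"
  shows "b ^ i * a ^ (m - i) + b ^ (m - i) * a ^ i \<le> a ^ m + b ^ m"
proof -
  have "0 \<le> (b ^ i - a ^ i) * (b ^ (m - i) - a ^ (m - i))"
    using assms by (intro mult_nonneg_nonneg) (auto intro: power_mono)
  also have "\<dots> = b ^ m + a ^ m - (b ^ i * a ^ (m - i) + b ^ (m - i) * a ^ i)"
    using assms(3) by (simp add: algebra_simps flip: power_add)
  finally show ?thesis by simp
qed

text \<open>The trapezoidal rule overestimates the integral of the convex function \<open>x ^ m\<close>.\<close>

lemma trapezoid_power:
  "real k ^ Suc m / real (Suc m) - real k ^ m / 2 \<le> (\<Sum>i=1..k-1. real i ^ m)" if "1 \<le> m" "1 \<le> k"
  using that(2)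
proof (induction k rule: nat_induct_at_least)
  case base
  then show ?case using that(1) by (simp add: field_simps)
next
  case (Suc k)
  define a where "a = real k"
  have arith: "P / n - B / 2 \<le> Q / n - A / 2 + A" if "2 * (P - Q) \<le> n * (A + B)" "0 < n" for P Q A B n :: real
  proof -
    have "(P - Q) / n \<le> (A + B) / 2" using that by (simp add: field_simps)
    then show ?thesis unfolding diff_divide_distrib add_divide_distrib by linarith
  qed
  have "(a + 1) ^ Suc m - a ^ Suc m = (\<Sum>i\<le>m. (a + 1) ^ i * a ^ (m - i))"
    using diff_power_eq_sum[of "a + 1" m a] by (simp add: lessThan_Suc_atMost)
  \<comment> \<open>The sum equals its reversal; added term by term, the two form the pairs of
    \<open>power_pair_le\<close>.\<close>
  moreover have "(\<Sum>i\<le>m. (a + 1) ^ i * a ^ (m - i)) = (\<Sum>i\<le>m. (a + 1) ^ (m - i) * a ^ i)"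
    by (rule sum.reindex_bij_witness[of _ "\<lambda>i. m - i" "\<lambda>i. m - i"]) auto
  ultimately have "2 * ((a + 1) ^ Suc m - a ^ Suc m) = (\<Sum>i\<le>m. (a + 1) ^ i * a ^ (m - i) + (a + 1) ^ (m - i) * a ^ i)"
    by (simp add: sum.distrib)
  also have "\<dots> \<le> (\<Sum>i\<le>m. a ^ m + (a + 1) ^ m)"
    by (intro sum_mono power_pair_le) (auto simp: a_def)
  also have "\<dots> = Suc m * (a ^ m + (a + 1) ^ m)" by simp
  finally have "(a + 1) ^ Suc m / Suc m - (a + 1) ^ m / 2 \<le> a ^ Suc m / Suc m - a ^ m / 2 + a ^ m"
    by (rule arith) simp
  moreover have "(\<Sum>i=1..Suc k-1. real i ^ m) = (\<Sum>i=1..k-1. real i ^ m) + a ^ m"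
    using Suc.hyps by (cases k) (auto simp: a_def)
  moreover have "real (Suc k) = a + 1" by (simp add: a_def)
  ultimately show ?case using Suc.IH by (simp only: a_def)
qed

text \<open>One E serves every r in the conclusion: r + k / r - 1 / 2 is compared at its minimum,
  and \<open>tri\<close> no longer changes for r >= d. The condition 4 d^2 < k gives 2 d <= s, so
  the number of base points chosen below is at least d, as the second phase requires.\<close>

lemma two_phase_large:
  assumes k: "12 \<le> k" and d: "4 * d ^ 2 < k"
  shows "\<exists>E. solution_bound k d E \<and> (\<forall>r\<ge>max 1 d. E \<le> r + k / r - 1 / 2 + tri r d)"
proof -
  define s where "s = floor_sqrt k"
  have s: "s ^ 2 \<le> k" "k < (s + 1) ^ 2" unfolding s_def by (simp_all add: Suc_floor_sqrt_power2_gt[simplified])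
  then have ks: "k \<le> s ^ 2 + 2 * s" by (simp add: power2_eq_square)
  have s3: "3 \<le> s"
  proof (rule ccontr)
    assume "\<not> 3 \<le> s"
    then have "s + 1 \<le> 3" by simp
    then have "(s + 1) ^ 2 \<le> 3 ^ 2" by (intro power_mono) auto
    then show False using s k by simp
  qed
  have ds: "2 * d \<le> s"
  proof (rule ccontr)
    assume "\<not> 2 * d \<le> s"
    then have "(s + 1) ^ 2 \<le> (2 * d) ^ 2" by (intro power_mono) auto
    then show False using s d by (simp add: power_mult_distrib)
  qed
  \<comment> \<open>\<open>r = \<surd>k / 2\<close> and \<open>b = 2 \<surd>k\<close> nearly minimise \<open>r + k / b + (1 - r / b) * M\<close>\<close>
  define r where "r = (s + 3) div 2"
  define b where "b = 2 * s"
  have r: "1 \<le> r" "r \<le> b" "d \<le> r" using s3 ds by (auto simp: r_def b_def)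
  have ss: "s * s \<le> k" using s(1) by (simp add: power2_eq_square)
  have "3 * s \<le> s * s" using s3 by simp
  then have bk: "b \<le> k" "r < k" using ss s3 unfolding b_def r_def by linarith+
  define M where "M = max ((k + (real r - 1) * (real b - 1)) / r ^ 2) ((r + (real b - 1)) / r)"
  have st: "stops_within k r {b} (k / b + (1 - r / b) * M)"
    by (rule stops_within_single) (use r bk in \<open>auto simp: M_def field_simps max_def\<close>)
  have M0: "0 \<le> M" unfolding M_def using r by (intro max.coboundedI2 divide_nonneg_nonneg) auto
  have rb: "0 \<le> 1 - r / b" using r by simp
  have e0: "d / b \<le> k / b + (1 - r / b) * M"
  proof -
    have "d / b \<le> k / b" using r bk by (intro divide_right_mono) auto
    then show ?thesis using mult_nonneg_nonneg[OF rb M0] by linarith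
  qed
  have dk: "2 * d < k" using ds bk s3 unfolding b_def by linarith
  have sb: "solution_bound k d (r + tri r d + (k / b + (1 - r / b) * M) - d / b)"
    using two_phase_bound[OF dk r(1) bk(2) r(3), of "{b}" b] st e0 bk r unfolding tri_def by simp
  \<comment> \<open>The minimum is at least 2 s. For s >= 9 the estimates r + k / b <= s + 5 / 2, M
    <= 8 and 1 - r / b <= 3 / 4 give at most s + 17 / 2 <= 2 s - 1 / 2; for smaller s each value is
    checked.\<close>
  have main: "r + (k / b + (1 - r / b) * M) \<le> min (s + k / s) (real s + 1 + k / (real s + 1)) - 1 / 2"
  proof (cases "s \<le> 8")
    case True
    have kr: "real (s ^ 2) \<le> k" "real k \<le> real (s ^ 2 + 2 * s)" "real 12 \<le> k" using s ks k by (simp_all only: of_nat_le_iff)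
    from True s3 have "s \<in> {3, 4, 5, 6, 7, 8}" by auto
    then consider "s = 3" | "s = 4" | "s = 5" | "s = 6" | "s = 7" | "s = 8" by blast
    then show ?thesis
      by cases (use kr in \<open>auto simp: r_def b_def M_def min_def max_def field_simps\<close>)
  next
    case False
    then have s9: "9 \<le> real s" by simp
    have rs: "real s + 2 \<le> 2 * real r" "2 * real r \<le> real s + 3" unfolding r_def by linarith+
    have bs: "real b = 2 * real s" by (simp add: b_def)
    have kr: "real k \<le> real s ^ 2 + 2 * real s" using ks by (metis of_nat_add of_nat_le_iff of_nat_mult of_nat_numeral of_nat_power)
    have "k / b \<le> (real s ^ 2 + 2 * real s) / (2 * real s)"
      unfolding bs using kr by (intro divide_right_mono) auto
    also have "\<dots> = s / 2 + 1" using s9 by (simp add: field_simps power2_eq_square)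
    finally have 1: "k / b \<le> s / 2 + 1" .
    have 2: "M \<le> 8"
    proof -
      have "(real r - 1) * (real b - 1) \<le> ((s + 1) / 2) * (2 * real s)"
        using rs bs s9 by (intro mult_mono) auto
      then have "k + (real r - 1) * (real b - 1) \<le> 2 * real s ^ 2 + 3 * real s"
        using kr by (simp add: field_simps power2_eq_square)
      also have "\<dots> \<le> 2 * (real s + 2) ^ 2" by (simp add: power2_eq_square algebra_simps)
      also have "\<dots> \<le> 2 * (2 * real r) ^ 2" using rs s9 by (intro mult_left_mono power_mono) auto
      finally have "(k + (real r - 1) * (real b - 1)) / r ^ 2 \<le> 8" using r by (simp add: field_simps)
      moreover have "(r + (real b - 1)) / r \<le> 8" using rs bs r by (simp add: field_simps)
      ultimately show ?thesis by (simp add: M_def)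
    qed
    have "1 / 4 \<le> real r / b" using rs bs s9 by (simp add: field_simps)
    then have "(1 - r / b) * M \<le> (3 / 4) * 8" using 2 M0 rb by (intro mult_mono) auto
    moreover have sk: "real s * s \<le> k" using ss by (metis of_nat_le_iff of_nat_mult)
    moreover have "s \<le> k / s" using sk s9 by (simp add: field_simps)
    moreover have "s - 1 \<le> k / (real s + 1)"
    proof -
      have "(real s - 1) * (real s + 1) \<le> k" using sk by (simp add: algebra_simps)
      then show ?thesis using s9 by (simp add: field_simps)
    qed
    ultimately show ?thesis using 1 rs s9 by (auto simp: min_def)
  qed
  have "r + tri r d + (k / b + (1 - r / b) * M) - d / b \<le> r0 + k / r0 - 1 / 2 + tri r0 d" if r0: "r0 \<ge> max 1 d" for r0
  proof -
    have "tri r0 d = tri r d" using tri_ge[of d r0] tri_ge[of d r] r0 r by simp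
    moreover have "0 \<le> real d / b" by simp
    moreover have "min (s + k / s) (real s + 1 + k / (real s + 1)) \<le> r0 + k / r0"
      using add_divide_ge_min[of s k r0] s r0 by simp
    ultimately show ?thesis using main by linarith
  qed
  then show ?thesis using sb by blast
qed


section \<open>Small k, and the combination of all bounds\<close>

lemma small_cases:
  assumes "3 \<le> k" "k < 12"
  obtains "k = 3" | "k = 4" | "k = 5" | "k = 6" | "k = 7" | "k = 8" | "k = 9" | "k = 10" | "k = (11::nat)"
  using assms by atomize_elim auto

lemma min_sum_small:
  fixes k r :: nat
  assumes "3 \<le> k" "k < 12" "1 \<le> r"
  shows "(if k < 4 then 7 / 2 else if k < 6 then 2 + k / 2 else if k < 9 then 3 + k / 3 else 3 + k / 3) \<le> r + k / r"
proof -
  have s: "(if k < 4 then 1 else if k < 9 then 2 else 3 :: nat) ^ 2 \<le> k"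
    "k \<le> ((if k < 4 then 1 else if k < 9 then 2 else 3 :: nat) + 1) ^ 2" using assms by (auto simp: power2_eq_square)
  show ?thesis using assms(1,2) add_divide_ge_min[OF s assms(3)]
    by (cases rule: small_cases[OF assms(1,2)]) (auto simp: min_def split: if_splits)
qed

text \<open>Two base points with the stopping rules computed above. For k = 6 and d = 1,
  \<open>one_phase_bound\<close> with r = 2 gives exactly 11 / 2 = k - 1 / 2, too weak for the
  strict inequality in \<open>component_bound_strict\<close>; the term d / bm = 1 / 4 brings it down
  to 21 / 4.\<close>

lemma two_phase_small:
  assumes k: "6 \<le> k" "k < 12" and d: "d \<le> 1"
  shows "\<exists>E. solution_bound k d E \<and> (\<forall>r\<ge>max 1 d. E \<le> r + k / r - 1 / 2 + tri r d)"
    and "k = 6 \<Longrightarrow> d = 1 \<Longrightarrow> solution_bound k d (21 / 4)"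
proof -
  have dk: "2 * d < k" "d \<le> 2" using k d by simp_all
  have sb: "solution_bound k d (2 + tri 2 d + e - d / bm)"
    if "stops_within k 2 B e" "B \<subseteq> {1..bm}" "B \<subseteq> {1..k}" "d / bm \<le> e" for B e bm
    using two_phase_bound[OF dk(1) _ _ dk(2) that(2,3,1,4)] k unfolding tri_def by simp
  have lt: "d / bm \<le> e" if "1 \<le> bm" "1 \<le> e" for bm :: nat and e :: real
  proof -
    have "real d / bm \<le> 1" using d that by (simp add: divide_le_eq_1)
    then show ?thesis using that(2) by (rule order_trans)
  qed
  have conc: "\<exists>E. solution_bound k d E \<and> (\<forall>r\<ge>max 1 d. E \<le> r + k / r - 1 / 2 + tri r d)"
    if "solution_bound k d (2 + tri 2 d + e - d / bm)" "2 + e \<le> (if k < 6 then 2 + k / 2 else 3 + k / 3) - 1 / 2" for e and bm :: nat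
  proof -
    have "2 + tri 2 d + e - d / bm \<le> r + k / r - 1 / 2 + tri r d" if r: "r \<ge> max 1 d" for r
    proof -
      have "tri r d = tri 2 d" using tri_ge[of d r] tri_ge[of d 2] r dk by simp
      moreover have "(if k < 6 then 2 + k / 2 else 3 + k / 3) \<le> r + k / r" using min_sum_small[of k r] k r by (auto split: if_splits)
      moreover have "0 \<le> real d / bm" by simp
      ultimately show ?thesis using \<open>2 + e \<le> (if k < 6 then 2 + k / 2 else 3 + k / 3) - 1 / 2\<close> by linarith
    qed
    then show ?thesis using that(1) by blast
  qed
  consider "k = 6" | "k = 7" | "k = 8" | "k = 9" | "k = 10" | "k = 11" using k by atomize_elim auto
  then show "\<exists>E. solution_bound k d E \<and> (\<forall>r\<ge>max 1 d. E \<le> r + k / r - 1 / 2 + tri r d)"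
  proof cases
    case 1
    show ?thesis by (rule conc[OF sb[OF stops_within_6[folded 1] _ _ lt, of 4]]) (use 1 in auto)
  next
    case 2
    show ?thesis by (rule conc[OF sb[OF stops_within_7[folded 2] _ _ lt, of 5]]) (use 2 in auto)
  next
    case 3
    show ?thesis by (rule conc[OF sb[OF stops_within_8[folded 3] _ _ lt, of 5]]) (use 3 in auto)
  next
    case 4
    show ?thesis by (rule conc[OF sb[OF stops_within_9[folded 4] _ _ lt, of 4]]) (use 4 in auto)
  next
    case 5
    show ?thesis by (rule conc[OF sb[OF stops_within_10[folded 5] _ _ lt, of 4]]) (use 5 in auto)
  next
    case 6
    show ?thesis by (rule conc[OF sb[OF stops_within_11[folded 6] _ _ lt, of 4]]) (use 6 in auto)
  qed
  show "solution_bound k d (21 / 4)" if "k = 6" "d = 1"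
    using sb[OF stops_within_6[folded that(1)] _ _ lt, of 4] that by (simp add: tri_def numeral_2_eq_2)
qed

text \<open>For r <= 2 d one phase saves d / r >= 1 / 2. For r > 2 d the sum \<open>tri\<close> is
  already constant. If then k <= 4 d^2, one phase with 2 d base points saves exactly 1 / 2, and r +
  k / r increases from 2 d on. If k > 4 d^2, d is small compared with k and two phases are used; k <
  6 is treated case by case.\<close>

lemma disjoint_bound:
  assumes k: "3 \<le> k" and dk: "2 * d < k" and r: "2 \<le> r"
  shows "\<exists>E. solution_bound k d E \<and> E \<le> r + k / r - 1 / 2 + tri r d"
proof (cases "r \<le> 2 * d")
  case True
  have "solution_bound k d (r + tri r d + (real k - d) / r)"
    using one_phase_bound[OF dk, of r] r unfolding tri_def by simp
  moreover have "1 / 2 \<le> real d / r" using True r by (simp add: field_simps)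
  ultimately show ?thesis by (intro exI conjI) (assumption, simp add: diff_divide_distrib)
next
  case r2: False
  have trr: "tri r d = tri (2 * d) d" using tri_ge[of d r] tri_ge[of d "2 * d"] r2 by simp
  show ?thesis
  proof (cases "k \<le> 4 * d ^ 2")
    case True
    then have d: "1 \<le> d" using k by (cases d) auto
    have sb: "solution_bound k d (2 * d + tri (2 * d) d + (real k - d) / (2 * d))"
      using one_phase_bound[OF dk, of "2 * d"] d unfolding tri_def by simp
    have "(real r - 2 * d) * k \<le> (real r - 2 * d) * (2 * d * r)"
    proof (rule mult_left_mono)
      have "2 * d * (2 * d) \<le> 2 * d * r" using r2 by (intro mult_le_mono2) simp
      moreover have "k \<le> 2 * d * (2 * d)" using True by (simp add: power2_eq_square)
      ultimately have "k \<le> 2 * d * r" by (rule order_trans[rotated])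
      then have "real k \<le> real (2 * d * r)" by (simp only: of_nat_le_iff)
      then show "real k \<le> 2 * d * r" by simp
    qed (use r2 in simp)
    then have "2 * d + k / (2 * d) \<le> r + k / r" using d r by (simp add: field_simps)
    moreover have "(real k - d) / (2 * d) = k / (2 * d) - 1 / 2" using d by (simp add: field_simps)
    ultimately show ?thesis using sb trr by (intro exI conjI) (assumption, simp)
  next
    case False
    have rd: "r \<ge> max 1 d" using r r2 by simp
    consider "12 \<le> k" | "6 \<le> k" "k < 12" | "k < 6" by linarith
    then show ?thesis
    proof cases
      case 1
      then show ?thesis using two_phase_large[of k d] False rd by auto
    next
      case 2
      have "d \<le> 1"
      proof (rule ccontr)
        assume "\<not> d \<le> 1"
        then have "2 ^ 2 \<le> d ^ 2" by (intro power_mono) auto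
        then show False using False 2 by simp
      qed
      then show ?thesis using two_phase_small(1)[OF 2] rd by auto
    next
      case 3
      have "d \<le> 1"
      proof (rule ccontr)
        assume "\<not> d \<le> 1"
        then have "2 ^ 2 \<le> d ^ 2" by (intro power_mono) auto
        then show False using False 3 by simp
      qed
      then consider "d = 0" "k = 3" | "d = 0" "k = 4" | "d = 0" "k = 5" | "d = 1" "k = 5"
        using 3 k False by (atomize_elim) (auto simp: le_Suc_eq)
      then show ?thesis
      proof cases
        case 1
        have "solution_bound 3 0 (2 + 1)" by (rule solution_bound_linear) (use cost_le_3 in \<open>auto simp: numeral_2_eq_2\<close>)
        then show ?thesis using 1 min_sum_small[of 3 r] r by (intro exI[of _ 3]) (auto simp: tri_def)
      next
        case 2
        have "solution_bound 4 0 (2 + 3 / 2)" by (rule solution_bound_hyperbola) (use cost_le_4 in auto)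
        then show ?thesis using 2 min_sum_small[of 4 r] r by (intro exI[of _ "2 + 3 / 2"]) (auto simp: tri_def)
      next
        case 3
        have "solution_bound 5 0 (2 + 2)" by (rule solution_bound_linear) (use cost_le_5 in auto)
        then show ?thesis using 3 min_sum_small[of 5 r] r by (intro exI[of _ 4]) (auto simp: tri_def)
      next
        \<comment> \<open>Here r >= 3, as r > 2 d, so the target is at least 9 / 2 - 1 / 2 + 1 = 5,
          which one phase with two base points attains.\<close>
        case 4
        have "solution_bound 5 1 (real 2 + (\<Sum>l<2. real (1 - l)) + (real 5 - real 1) / real 2)"
          by (rule one_phase_bound) auto
        then have sb: "solution_bound k d 5" using 4 by (simp add: numeral_2_eq_2)
        have "tri r d = 1" using tri_ge[of d r] rd 4 by (simp add: tri_def)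
        moreover have "3 \<le> r" using r2 4 by simp
        then have "r = 3 \<or> 4 \<le> r" by auto
        then have "9 / 2 \<le> r + 5 / r" using min_sum_small[of 5 r] by (auto simp: field_simps)
        ultimately show ?thesis using sb 4 by (intro exI[of _ 5]) auto
      qed
    qed
  qed
qed

text \<open>The exponent of the solutions with c common values: these values are free, and the rest
  is a system with parameters k - c and d - c. Fewer than three variables remain only for k = 3 and
  d = c = 1, where the trivial exponent suffices.\<close>

lemma component_bound:
  assumes k: "3 \<le> k" and dk: "2 * d < k" and c: "c \<le> d" and r: "2 \<le> r"
  shows "\<exists>E. solution_bound (k - c) (d - c) E \<and> c + E \<le> r + k / r - 1 / 2 + tri r d"
proof (cases "3 \<le> k - c")
  case True
  have "2 * (d - c) < k - c" using dk c by simp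
  then obtain E where E: "solution_bound (k - c) (d - c) E" "E \<le> r + real (k - c) / r - 1 / 2 + tri r (d - c)"
    using disjoint_bound[OF True _ r, of "d - c"] by blast
  have "real (k - c) / r \<le> k / r" by (intro divide_right_mono) auto
  then show ?thesis using E tri_shift[of r c d] r c by (intro exI[of _ E]) auto
next
  case False
  then have kdc: "k = 3" "d = 1" "c = 1" using k dk c by auto
  have "solution_bound 2 0 (real 2 + 1)" by (rule solution_bound_trivial) simp
  moreover have "7 / 2 \<le> r + 3 / r" using min_sum_small[of 3 r] r by simp
  moreover have "tri r d = 1" using tri_ge[of d r] r kdc by (simp add: tri_def)
  ultimately show ?thesis using kdc by (intro exI[of _ 3]) auto
qed

text \<open>Strictness leaves room for the \<epsilon> that the second claim of the theorem does not
  have. For c = 0 one phase with r = 2 gives (k + 3 d) / 2 + 1, which is below k - 1 / 2 exactly if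
  k > 3 d + 3; under k >= 4 d + 2 this fails only for k = 6, d = 1. For c >= 1 the reduced
  parameters satisfy 4 (d - c) + 4 < k - c.\<close>

lemma component_bound_strict:
  assumes d: "1 \<le> d" and k: "4 * d + 2 \<le> k" and c: "c \<le> d"
  shows "\<exists>E. solution_bound (k - c) (d - c) E \<and> c + E < k - 1 / 2"
proof (cases "c = 0")
  case True
  show ?thesis
  proof (cases "k = 6 \<and> d = 1")
    case True
    then show ?thesis using two_phase_small(2)[of k d] \<open>c = 0\<close> by (intro exI[of _ "21 / 4"]) simp
  next
    case False
    have "2 * d < k" using k by simp
    then have "solution_bound k d (real 2 + (\<Sum>l<2. real (d - l)) + (real k - d) / real 2)"
      by (rule one_phase_bound) simp
    moreover have "3 * d + 3 < k" using k d False by linarith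
    then have "real 2 + (\<Sum>l<2. real (d - l)) + (real k - d) / real 2 < k - 1 / 2"
      using d by (simp add: numeral_2_eq_2 of_nat_diff field_simps)
    ultimately show ?thesis using \<open>c = 0\<close> by (intro exI[of _ "real 2 + (\<Sum>l<2. real (d - l)) + (real k - d) / real 2"]) simp
  qed
next
  case False
  have "3 \<le> k - c" "2 * (d - c) < k - c" using k c False by simp_all
  then obtain E where E: "solution_bound (k - c) (d - c) E" "E \<le> 2 + real (k - c) / 2 - 1 / 2 + tri 2 (d - c)"
    using disjoint_bound[of "k - c" "d - c" 2] by auto
  have "tri 2 (d - c) \<le> 2 * real (d - c)" by (simp add: tri_def numeral_2_eq_2)
  moreover have "4 * (d - c) + 4 < k - c" using k c False d by linarith
  then have "4 * real (d - c) + 4 < real (k - c)" by linarith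
  ultimately have "E < real (k - c) - 1 / 2" using E(2) by linarith
  then show ?thesis using E(1) k c by (intro exI[of _ E]) (simp add: of_nat_diff)
qed

section \<open>From multisets to tuples\<close>

lemma mset_eq_power_sums:
  assumes "size A = k" "size B = k" "\<And>j. j \<in> {1..k} \<Longrightarrow> power_sum j A = power_sum j B"
  shows "A = B"
proof -
  have "root_poly A = root_poly B"
  proof (rule poly_eqI)
    fix j
    have "esym A (k - j) = esym B (k - j)" if "j \<le> k"
      by (rule esym_eq_below) (use assms(3) that in auto)
    then show "coeff (root_poly A) j = coeff (root_poly B) j"
      using assms(1,2) by (cases "j \<le> k") (auto simp: coeff_root_poly coeff_eq_0)
  qed
  then show ?thesis by (simp add: root_poly_inject)
qed

lemma card_multisets_size_le: "card {M. set_mset M \<subseteq> {1..int N} \<and> size M = c} \<le> N ^ c"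
proof -
  have "{M. set_mset M \<subseteq> {1..int N} \<and> size M = c} \<subseteq> mset ` {l. set l \<subseteq> {1..int N} \<and> length l = c}"
  proof
    fix M assume M: "M \<in> {M. set_mset M \<subseteq> {1..int N} \<and> size M = c}"
    obtain l where "mset l = M" using ex_mset by blast
    then show "M \<in> mset ` {l. set l \<subseteq> {1..int N} \<and> length l = c}" using M by (auto intro!: image_eqI[of _ _ l])
  qed
  moreover have fin: "finite {l. set l \<subseteq> {1..int N} \<and> length l = c}" by (intro finite_lists_length_eq) simp
  ultimately have "card {M. set_mset M \<subseteq> {1..int N} \<and> size M = c} \<le> card (mset ` {l. set l \<subseteq> {1..int N} \<and> length l = c})"
    by (intro card_mono) auto
  also have "\<dots> \<le> card {l. set l \<subseteq> {1..int N} \<and> length l = c}" by (rule card_image_le[OF fin])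
  also have "\<dots> = N ^ c" by (subst card_lists_length_eq) auto
  finally show ?thesis .
qed

definition unequal_pairs :: "nat \<Rightarrow> nat \<Rightarrow> nat \<Rightarrow> (int multiset \<times> int multiset) set" where
  "unequal_pairs k d N = {(A, B). psum_sys k d A B \<and> set_mset A \<subseteq> {1..int N} \<and> set_mset B \<subseteq> {1..int N} \<and> A \<noteq> B}"

text \<open>Removing the common part of size \<open>c\<close> from both sides leaves a system of the same shape in which
  \<open>k - d\<close> is unchanged; if \<open>c > d\<close> then all power sums agree and nothing is left.\<close>

lemma remove_common:
  assumes "(A, B) \<in> unequal_pairs k d N" "d < k"
  shows "size (A \<inter># B) \<le> d"
    and "(A - B, B - A) \<in> sol_pairs (k - size (A \<inter># B)) (d - size (A \<inter># B)) N"
proof -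
  have sys: "psum_sys k d A B" and ne: "A \<noteq> B" using assms by (auto simp: unequal_pairs_def)
  have sz: "size A = k" "size B = k" using sys by (auto simp: psum_sys_def)
  define Z where "Z = A \<inter># B"
  have AB: "A = (A - B) + Z" "B = (B - A) + Z" unfolding Z_def by (simp_all add: multiset_eq_iff min_def)
  have sz': "size (A - B) = k - size Z" "size (B - A) = k - size Z" "size Z \<le> k"
    using sz AB by (metis add_diff_cancel_right' size_union le_add2)+
  have ps: "power_sum j (A - B) = power_sum j (B - A)" if "j \<in> {1..k}" "j \<noteq> k - d" for j
  proof -
    have "power_sum j A = power_sum j (A - B) + power_sum j Z" "power_sum j B = power_sum j (B - A) + power_sum j Z"
      by (metis AB(1) power_sum_def image_mset_union sum_mset.union)
        (metis AB(2) power_sum_def image_mset_union sum_mset.union)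
    then show ?thesis using sys that unfolding psum_sys_def by simp
  qed
  show *: "size (A \<inter># B) \<le> d"
  proof (rule ccontr)
    assume "\<not> size (A \<inter># B) \<le> d"
    then have "A - B = B - A"
      using sz' ps unfolding Z_def[symmetric] by (intro mset_eq_power_sums[of _ "k - size Z"]) auto
    then show False using AB ne by metis
  qed
  have "psum_sys (k - size Z) (d - size Z) (A - B) (B - A)"
    unfolding psum_sys_def using sz' ps * assms(2) by (auto simp: Z_def)
  moreover have "set_mset (A - B) \<inter> set_mset (B - A) = {}" by (auto simp: in_diff_count)
  moreover have "set_mset (A - B) \<subseteq> {1..int N}" "set_mset (B - A) \<subseteq> {1..int N}"
    using assms(1) by (auto simp: unequal_pairs_def dest: in_diffD)
  ultimately show "(A - B, B - A) \<in> sol_pairs (k - size (A \<inter># B)) (d - size (A \<inter># B)) N"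
    by (simp add: sol_pairs_def Z_def)
qed

lemma finite_unequal_pairs: "finite (unequal_pairs k d N)"
proof -
  have "unequal_pairs k d N \<subseteq> {M. set_mset M \<subseteq> {1..int N} \<and> size M = k} \<times> {M. set_mset M \<subseteq> {1..int N} \<and> size M = k}"
    by (auto simp: unequal_pairs_def psum_sys_def)
  then show ?thesis by (rule finite_subset) (intro finite_cartesian_product finite_multisets_size; simp)
qed

lemma card_unequal_pairs_le:
  assumes "d < k"
  shows "card (unequal_pairs k d N) \<le> (\<Sum>c\<le>d. N ^ c * card (sol_pairs (k - c) (d - c) N))"
proof -
  define f where "f = (\<lambda>(A, B). (A \<inter># B, (A - B, B - A :: int multiset)))"
  define Y where "Y = (\<lambda>c. {M. set_mset M \<subseteq> {1..int N} \<and> size M = c} \<times> sol_pairs (k - c) (d - c) N)"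
  have "inj_on f (unequal_pairs k d N)"
  proof (rule inj_onI)
    fix p q assume eq: "f p = f q"
    obtain A B A' B' where pq: "p = (A, B)" "q = (A', B')" by (metis surj_pair)
    have e: "A \<inter># B = A' \<inter># B'" "A - B = A' - B'" "B - A = B' - A'" using eq by (simp_all add: pq f_def)
    have dec: "A = (A - B) + A \<inter># B" "B = (B - A) + A \<inter># B" for A B :: "int multiset"
      by (simp_all add: multiset_eq_iff min_def)
    have "A = (A - B) + A \<inter># B" by (rule dec)
    also have "\<dots> = A'" unfolding e by (rule dec(1)[symmetric])
    finally have "A = A'" .
    have "B = (B - A) + A \<inter># B" by (rule dec)
    also have "\<dots> = B'" unfolding e by (rule dec(2)[symmetric])
    finally show "p = q" using \<open>A = A'\<close> pq by simp
  qed
  then have "card (unequal_pairs k d N) = card (f ` unequal_pairs k d N)" by (simp add: card_image)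
  also have "\<dots> \<le> card (\<Union>c\<le>d. Y c)"
  proof (rule card_mono)
    show "finite (\<Union>c\<le>d. Y c)"
      unfolding Y_def by (intro finite_UN_I finite_cartesian_product finite_multisets_size finite_sol_pairs) auto
    show "f ` unequal_pairs k d N \<subseteq> (\<Union>c\<le>d. Y c)"
    proof
      fix y assume "y \<in> f ` unequal_pairs k d N"
      then obtain A B where p: "(A, B) \<in> unequal_pairs k d N" "y = f (A, B)" by auto
      have "set_mset (A \<inter># B) \<subseteq> {1..int N}" using p by (auto simp: unequal_pairs_def)
      then show "y \<in> (\<Union>c\<le>d. Y c)"
        using remove_common[OF p(1) assms] p(2) by (auto simp: f_def Y_def)
    qed
  qed
  also have "\<dots> \<le> (\<Sum>c\<le>d. card (Y c))" by (rule card_UN_le) simp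
  also have "\<dots> \<le> (\<Sum>c\<le>d. N ^ c * card (sol_pairs (k - c) (d - c) N))"
    unfolding Y_def card_cartesian_product by (intro sum_mono mult_right_mono card_multisets_size_le) simp
  finally show ?thesis .
qed

lemma unequal_pairs_bound:
  fixes G :: real
  assumes dk: "d < k" and E: "\<And>c. c \<le> d \<Longrightarrow> solution_bound (k - c) (d - c) (E c) \<and> c + E c \<le> G"
    and eps: "\<epsilon> > 0"
  shows "\<exists>C\<ge>0. \<forall>N\<ge>1. real (card (unequal_pairs k d N)) \<le> C * real N powr (G + \<epsilon>)"
proof -
  have "\<forall>c\<in>{..d}. \<exists>C\<ge>0. \<forall>N\<ge>1. real (card (sol_pairs (k - c) (d - c) N)) \<le> C * real N powr (E c + \<epsilon>)"
    using E eps unfolding solution_bound_def by auto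
  then obtain C where C: "\<forall>c\<in>{..d}. C c \<ge> 0 \<and> (\<forall>N\<ge>1. real (card (sol_pairs (k - c) (d - c) N)) \<le> C c * real N powr (E c + \<epsilon>))"
    using bchoice by metis
  have "real (card (unequal_pairs k d N)) \<le> (\<Sum>c\<le>d. C c) * real N powr (G + \<epsilon>)" if N: "N \<ge> 1" for N
  proof -
    have "real (card (unequal_pairs k d N)) \<le> real (\<Sum>c\<le>d. N ^ c * card (sol_pairs (k - c) (d - c) N))"
      using card_unequal_pairs_le[OF dk, of N] by (simp only: of_nat_le_iff)
    also have "\<dots> = (\<Sum>c\<le>d. real N ^ c * real (card (sol_pairs (k - c) (d - c) N)))" by simp
    also have "\<dots> \<le> (\<Sum>c\<le>d. C c * real N powr (G + \<epsilon>))"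
    proof (rule sum_mono)
      fix c assume c: "c \<in> {..d}"
      have "real N ^ c * real (card (sol_pairs (k - c) (d - c) N)) \<le> real N powr real c * (C c * real N powr (E c + \<epsilon>))"
        using C c N by (intro mult_mono) (auto simp: powr_realpow)
      also have "\<dots> = C c * real N powr (c + E c + \<epsilon>)" by (simp add: powr_add)
      also have "\<dots> \<le> C c * real N powr (G + \<epsilon>)"
        using C c N E[of c] by (intro mult_left_mono powr_mono) auto
      finally show "real N ^ c * real (card (sol_pairs (k - c) (d - c) N)) \<le> C c * real N powr (G + \<epsilon>)" .
    qed
    finally show ?thesis by (simp add: sum_distrib_right)
  qed
  moreover have "0 \<le> (\<Sum>c\<le>d. C c)" using C by (intro sum_nonneg) auto
  ultimately show ?thesis by blast
qed

section \<open>Counting tuples through their multisets\<close>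

definition tuple_mset :: "nat \<Rightarrow> (nat \<Rightarrow> int) \<Rightarrow> int multiset" where
  "tuple_mset k x = image_mset x (mset_set {1..k})"

lemma size_tuple_mset: "size (tuple_mset k x) = k" by (simp add: tuple_mset_def)

lemma box_eq: "box k X = {1..k} \<rightarrow>\<^sub>E {1..int (nat \<lfloor>X\<rfloor>)}" if "1 \<le> X"
proof -
  have "{n::int. 1 \<le> n \<and> real_of_int n \<le> X} = {1..int (nat \<lfloor>X\<rfloor>)}"
    using that by (auto simp: le_floor_iff)
  then show ?thesis by (simp add: box_def)
qed

lemma finite_box: "finite (box k X)" if "1 \<le> X"
  unfolding box_eq[OF that] by (intro finite_PiE) auto

lemma permuted_iff:
  "(\<exists>\<pi>. \<pi> permutes {1..k} \<and> (\<forall>i\<in>{1..k}. x i = y (\<pi> i))) \<longleftrightarrow> tuple_mset k x = tuple_mset k y"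
proof
  assume "\<exists>\<pi>. \<pi> permutes {1..k} \<and> (\<forall>i\<in>{1..k}. x i = y (\<pi> i))"
  then show "tuple_mset k x = tuple_mset k y"
    unfolding tuple_mset_def using permutes_implies_image_mset_eq[of _ "{1..k}" x y] by metis
next
  assume "tuple_mset k x = tuple_mset k y"
  then show "\<exists>\<pi>. \<pi> permutes {1..k} \<and> (\<forall>i\<in>{1..k}. x i = y (\<pi> i))"
    unfolding tuple_mset_def using image_mset_eq_implies_permutes[of "{1..k}" x y] by auto
qed

lemma power_sum_tuple: "power_sum j (tuple_mset k x) = (\<Sum>i=1..k. x i ^ j)"
  by (simp add: power_sum_def tuple_mset_def image_mset.compositionality o_def sum_unfold_sum_mset)

lemma card_fixed_tuple_mset_le: "card {x \<in> {1..k} \<rightarrow>\<^sub>E S. tuple_mset k x = M} \<le> k ^ k"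
proof (cases "\<exists>x. tuple_mset k x = M")
  case True
  then have "size M = k" by (auto simp: tuple_mset_def)
  then have cM: "card (set_mset M) \<le> k" using size_mset_mono[OF mset_set_set_mset_msubset[of M]] by simp
  have "{x \<in> {1..k} \<rightarrow>\<^sub>E S. tuple_mset k x = M} \<subseteq> {1..k} \<rightarrow>\<^sub>E set_mset M"
    by (auto simp: tuple_mset_def PiE_def)
  then have "card {x \<in> {1..k} \<rightarrow>\<^sub>E S. tuple_mset k x = M} \<le> card ({1..k} \<rightarrow>\<^sub>E set_mset M)"
    by (intro card_mono finite_PiE) auto
  also have "\<dots> = card (set_mset M) ^ k" by (simp add: card_PiE)
  also have "\<dots> \<le> k ^ k" using cM by (rule power_mono) simp
  finally show ?thesis .
next
  case False
  then have "{x \<in> {1..k} \<rightarrow>\<^sub>E S. tuple_mset k x = M} = {}" by auto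
  then show ?thesis by (simp only: card.empty)
qed

text \<open>The pairs counted by T are the solutions whose multisets agree. A multiset has at most
  k^k arrangements as a tuple, so each pair of different multisets accounts for at most (k^k)^2 of
  the remaining solutions.\<close>

lemma count_difference:
  assumes X: "1 \<le> X"
  shows "\<bar>real (I_count k d X) - real (T_count k X)\<bar> \<le> real (k ^ k) ^ 2 * real (card (unequal_pairs k d (nat \<lfloor>X\<rfloor>)))"
proof -
  define I where "I = {(x, y). x \<in> box k X \<and> y \<in> box k X \<and>
     (\<forall>j\<in>{1..k}. j \<noteq> k - d \<longrightarrow> (\<Sum>i=1..k. x i ^ j) = (\<Sum>i=1..k. y i ^ j))}"
  define T where "T = {(x, y). x \<in> box k X \<and> y \<in> box k X \<and> tuple_mset k x = tuple_mset k y}"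
  define f where "f = (\<lambda>(x, y). (tuple_mset k x, tuple_mset k y))"
  have Ic: "I_count k d X = card I" by (simp add: I_count_def I_def)
  have Tc: "T_count k X = card T" by (simp only: T_count_def T_def permuted_iff)
  have "I \<subseteq> box k X \<times> box k X" by (auto simp: I_def)
  then have fin: "finite I" using finite_box[OF X] finite_subset by blast
  have "(\<Sum>i=1..k. x i ^ j) = (\<Sum>i=1..k. y i ^ j)" if "tuple_mset k x = tuple_mset k y" for x y j
    unfolding power_sum_tuple[symmetric] that ..
  then have sub: "T \<subseteq> I" unfolding I_def T_def by blast
  have img: "f ` (I - T) \<subseteq> unequal_pairs k d (nat \<lfloor>X\<rfloor>)"
  proof
    fix p assume "p \<in> f ` (I - T)"
    then obtain x y where p: "(x, y) \<in> I - T" "p = (tuple_mset k x, tuple_mset k y)" by (auto simp: f_def)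
    then have ps: "psum_sys k d (tuple_mset k x) (tuple_mset k y)"
      unfolding psum_sys_def power_sum_tuple I_def by (auto simp: size_tuple_mset)
    from p have "set_mset (tuple_mset k x) \<subseteq> {1..int (nat \<lfloor>X\<rfloor>)}" "set_mset (tuple_mset k y) \<subseteq> {1..int (nat \<lfloor>X\<rfloor>)}"
      unfolding I_def box_eq[OF X] by (auto simp: tuple_mset_def PiE_def)
    then show "p \<in> unequal_pairs k d (nat \<lfloor>X\<rfloor>)"
      using p ps by (auto simp: unequal_pairs_def I_def T_def)
  qed
  have "card (I - T) \<le> (k ^ k) ^ 2 * card (f ` (I - T))"
  proof (rule card_le_fibers)
    show "finite (I - T)" using fin by simp
    fix p :: "int multiset \<times> int multiset"
    obtain A B where p: "p = (A, B)" by (cases p)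
    have "{z \<in> I - T. f z = p} \<subseteq> {x \<in> box k X. tuple_mset k x = A} \<times> {y \<in> box k X. tuple_mset k y = B}"
      by (auto simp: I_def f_def p)
    then have "card {z \<in> I - T. f z = p} \<le> card ({x \<in> box k X. tuple_mset k x = A} \<times> {y \<in> box k X. tuple_mset k y = B})"
      using finite_box[OF X] by (intro card_mono) auto
    also have "\<dots> \<le> k ^ k * k ^ k"
      unfolding card_cartesian_product box_eq[OF X] by (intro mult_mono card_fixed_tuple_mset_le) auto
    finally show "card {z \<in> I - T. f z = p} \<le> (k ^ k) ^ 2" by (simp add: power2_eq_square)
  qed
  also have "\<dots> \<le> (k ^ k) ^ 2 * card (unequal_pairs k d (nat \<lfloor>X\<rfloor>))"
    using card_mono[OF finite_unequal_pairs img] by simp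
  finally have "real (card (I - T)) \<le> real ((k ^ k) ^ 2 * card (unequal_pairs k d (nat \<lfloor>X\<rfloor>)))" by (simp only: of_nat_le_iff)
  moreover have "card (I - T) = card I - card T" "card T \<le> card I"
    using sub fin by (auto intro: card_mono simp: card_Diff_subset finite_subset)
  ultimately show ?thesis by (simp add: Ic Tc of_nat_diff)
qed

lemma count_difference_bound:
  fixes G :: real
  assumes dk: "d < k" and E: "\<And>c. c \<le> d \<Longrightarrow> \<exists>E. solution_bound (k - c) (d - c) E \<and> c + E \<le> G"
    and eps: "\<epsilon> > 0" and G: "0 \<le> G"
  shows "\<exists>C. \<forall>X\<ge>1. \<bar>real (I_count k d X) - real (T_count k X)\<bar> \<le> C * X powr (G + \<epsilon>)"
proof -
  obtain F where F: "\<And>c. c \<le> d \<Longrightarrow> solution_bound (k - c) (d - c) (F c) \<and> c + F c \<le> G" using E by metis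
  obtain C where C: "C \<ge> 0" "\<forall>N\<ge>1. real (card (unequal_pairs k d N)) \<le> C * real N powr (G + \<epsilon>)"
    using unequal_pairs_bound[OF dk F eps] by blast
  have "\<bar>real (I_count k d X) - real (T_count k X)\<bar> \<le> real (k ^ k) ^ 2 * C * X powr (G + \<epsilon>)" if X: "X \<ge> 1" for X
  proof -
    have N: "1 \<le> nat \<lfloor>X\<rfloor>" "real (nat \<lfloor>X\<rfloor>) \<le> X" using X by (auto simp: le_nat_iff le_floor_iff)
    have "\<bar>real (I_count k d X) - real (T_count k X)\<bar> \<le> real (k ^ k) ^ 2 * real (card (unequal_pairs k d (nat \<lfloor>X\<rfloor>)))"
      by (rule count_difference[OF X])
    also have "\<dots> \<le> real (k ^ k) ^ 2 * (C * real (nat \<lfloor>X\<rfloor>) powr (G + \<epsilon>))"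
      using C N by (intro mult_left_mono) auto
    also have "\<dots> \<le> real (k ^ k) ^ 2 * (C * X powr (G + \<epsilon>))"
      using C N eps G by (intro mult_left_mono powr_mono2) auto
    finally show ?thesis by (simp add: mult.assoc)
  qed
  then show ?thesis by blast
qed

section \<open>The number of pairs that are permutations of each other\<close>

lemma card_non_injective_le:
  "card {y \<in> {1..k} \<rightarrow>\<^sub>E {1..int N}. \<not> inj_on y {1..k}} \<le> k ^ 2 * N ^ (k - 1)"
proof -
  define B where "B = {1..k} \<rightarrow>\<^sub>E {1..int N}"
  define Y where "Y = (\<lambda>(i, j). {y \<in> B. i \<noteq> j \<and> y i = y j})"
  have finB: "finite B" unfolding B_def by (intro finite_PiE) auto
  have one: "card (Y p) \<le> N ^ (k - 1)" if p: "p \<in> {1..k} \<times> {1..k}" for p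
  proof -
    obtain i j where ij: "p = (i, j)" "i \<in> {1..k}" "j \<in> {1..k}" using p by auto
    have "inj_on (\<lambda>y. restrict y ({1..k} - {i})) (Y p)"
    proof (rule inj_onI)
      fix y z assume y: "y \<in> Y p" and z: "z \<in> Y p" and e: "restrict y ({1..k} - {i}) = restrict z ({1..k} - {i})"
      have eq: "y t = z t" if "t \<in> {1..k} - {i}" for t using fun_cong[OF e, of t] that by simp
      \<comment> \<open>The omitted entry i is recovered from the entry j, with which it
        coincides.\<close>
      have "y i = z i" using y z ij eq[of j] by (auto simp: Y_def)
      then have "y t = z t" if "t \<in> {1..k}" for t using eq[of t] that by (cases "t = i") auto
      moreover have "y \<in> B" "z \<in> B" using y z ij by (auto simp: Y_def)
      ultimately show "y = z" unfolding B_def by (intro PiE_ext) auto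
    qed
    then have "card (Y p) = card ((\<lambda>y. restrict y ({1..k} - {i})) ` Y p)" by (simp add: card_image)
    also have "\<dots> \<le> card (({1..k} - {i}) \<rightarrow>\<^sub>E {1..int N})"
    proof (intro card_mono finite_PiE image_subsetI)
      fix y assume "y \<in> Y p"
      then have "y \<in> B" by (auto simp: Y_def ij)
      then show "restrict y ({1..k} - {i}) \<in> ({1..k} - {i}) \<rightarrow>\<^sub>E {1..int N}"
        unfolding B_def by (intro restrict_PiE_iff[THEN iffD2]) (auto dest: PiE_mem)
    qed auto
    also have "\<dots> = N ^ (k - 1)" using ij by (simp add: card_PiE)
    finally show ?thesis .
  qed
  have "{y \<in> B. \<not> inj_on y {1..k}} \<subseteq> (\<Union>p\<in>{1..k} \<times> {1..k}. Y p)" by (auto simp: inj_on_def Y_def)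
  then have "card {y \<in> B. \<not> inj_on y {1..k}} \<le> card (\<Union>p\<in>{1..k} \<times> {1..k}. Y p)"
    using finB by (intro card_mono) (auto simp: Y_def)
  also have "\<dots> \<le> (\<Sum>p\<in>{1..k} \<times> {1..k}. card (Y p))" by (rule card_UN_le) simp
  also have "\<dots> \<le> (\<Sum>p\<in>{1..k} \<times> {1..k}. N ^ (k - 1))" by (intro sum_mono one)
  also have "\<dots> = k ^ 2 * N ^ (k - 1)" by (simp add: card_cartesian_product power2_eq_square)
  finally show ?thesis by (simp add: B_def)
qed

text \<open>Every such pair comes from some (y, \<pi>), and \<pi> is unique when the entries of y
  are distinct. The y with a repeated entry form the error term.\<close>

lemma T_count_bounds:
  assumes X: "1 \<le> X" and N: "N = nat \<lfloor>X\<rfloor>"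
  shows "T_count k X \<le> fact k * N ^ k" "fact k * N ^ k \<le> T_count k X + fact k * (k ^ 2 * N ^ (k - 1))"
proof -
  define P where "P = {\<pi>. \<pi> permutes {1..k}}"
  define T where "T = {(x, y). x \<in> box k X \<and> y \<in> box k X \<and>
     (\<exists>\<pi>. \<pi> permutes {1..k} \<and> (\<forall>i\<in>{1..k}. x i = y (\<pi> i)))}"
  define F where "F = (\<lambda>(y, \<pi>). (restrict (\<lambda>i. y (\<pi> i)) {1..k}, y :: nat \<Rightarrow> int))"
  define Y where "Y = {y \<in> box k X. inj_on y {1..k}}"
  have cP: "card P = fact k" and fP: "finite P" unfolding P_def by (simp_all add: card_permutations finite_permutations)
  have fb: "finite (box k X)" by (rule finite_box[OF X])
  have cB: "card (box k X) = N ^ k" unfolding box_eq[OF X] N by (simp add: card_PiE)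
  have TF: "T = F ` (box k X \<times> P)"
  proof (intro subset_antisym subsetI)
    fix p assume "p \<in> T"
    then obtain x y \<pi> where p: "p = (x, y)" "x \<in> box k X" "y \<in> box k X" "\<pi> permutes {1..k}" "\<forall>i\<in>{1..k}. x i = y (\<pi> i)"
      by (auto simp: T_def)
    have "x = restrict (\<lambda>i. y (\<pi> i)) {1..k}"
      using p(2,5) unfolding box_def by (intro ext) (auto simp: PiE_def extensional_def)
    then show "p \<in> F ` (box k X \<times> P)" using p by (auto simp: F_def P_def intro!: image_eqI[of _ _ "(y, \<pi>)"])
  next
    fix p assume "p \<in> F ` (box k X \<times> P)"
    then obtain y \<pi> where p: "p = F (y, \<pi>)" "y \<in> box k X" "\<pi> permutes {1..k}" by (auto simp: P_def)
    have "restrict (\<lambda>i. y (\<pi> i)) {1..k} \<in> box k X"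
      using p(2) permutes_in_image[OF p(3)] unfolding box_def by auto
    then show "p \<in> T" using p by (auto simp: T_def F_def)
  qed
  have Tc: "T_count k X = card T" by (simp add: T_count_def T_def)
  have "card T \<le> card (box k X \<times> P)" unfolding TF using fb fP by (intro card_image_le) auto
  then show "T_count k X \<le> fact k * N ^ k" by (simp add: Tc card_cartesian_product cP cB mult.commute)
  have inj: "inj_on F (Y \<times> P)"
  proof (rule inj_onI)
    fix p q assume p: "p \<in> Y \<times> P" and q: "q \<in> Y \<times> P" and e: "F p = F q"
    obtain y \<pi> \<sigma> where pq: "p = (y, \<pi>)" "q = (y, \<sigma>)" using p q e by (cases p; cases q) (auto simp: F_def)
    have pm: "\<pi> permutes {1..k}" "\<sigma> permutes {1..k}" and iy: "inj_on y {1..k}" using p q pq by (auto simp: P_def Y_def)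
    have r: "restrict (\<lambda>i. y (\<pi> i)) {1..k} = restrict (\<lambda>i. y (\<sigma> i)) {1..k}" using e by (simp add: F_def pq)
    have "\<pi> i = \<sigma> i" for i
    proof (cases "i \<in> {1..k}")
      case True
      have "y (\<pi> i) = y (\<sigma> i)" using fun_cong[OF r, of i] True by simp
      then show ?thesis using iy permutes_in_image[OF pm(1), of i] permutes_in_image[OF pm(2), of i] True by (auto dest: inj_onD)
    next
      case False
      then show ?thesis using pm by (simp add: permutes_not_in)
    qed
    then show "p = q" using pq by auto
  qed
  have "card Y * fact k = card (F ` (Y \<times> P))" by (simp add: card_image[OF inj] card_cartesian_product cP)
  also have "\<dots> \<le> card T" unfolding TF using fb fP by (intro card_mono) (auto simp: Y_def)
  finally have 1: "card Y * fact k \<le> card T" .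
  have "box k X = Y \<union> {y \<in> {1..k} \<rightarrow>\<^sub>E {1..int N}. \<not> inj_on y {1..k}}" using box_eq[OF X] N by (auto simp: Y_def)
  then have "N ^ k \<le> card Y + k ^ 2 * N ^ (k - 1)"
    using card_Un_le[of Y "{y \<in> {1..k} \<rightarrow>\<^sub>E {1..int N}. \<not> inj_on y {1..k}}"] card_non_injective_le[of k N] cB by simp
  then have "fact k * N ^ k \<le> fact k * (card Y + k ^ 2 * N ^ (k - 1))" by (rule mult_le_mono2)
  then show "fact k * N ^ k \<le> T_count k X + fact k * (k ^ 2 * N ^ (k - 1))"
    using 1 by (simp add: Tc distrib_left mult.commute)
qed

lemma T_count_asymptotic:
  assumes X: "1 \<le> X" and k: "1 \<le> k"
  shows "\<bar>real (T_count k X) - fact k * X ^ k\<bar> \<le> fact k * (real k + real k ^ 2) * X ^ (k - 1)"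
proof -
  define N where "N = nat \<lfloor>X\<rfloor>"
  have N: "real N \<le> X" "X - 1 \<le> real N" using X unfolding N_def by linarith+
  note b = T_count_bounds[OF X N_def, of k]
  have 1: "real (T_count k X) \<le> fact k * real N ^ k"
    using b(1) by (metis of_nat_fact of_nat_le_iff of_nat_mult of_nat_power)
  have "real (fact k * N ^ k) \<le> real (T_count k X + fact k * (k ^ 2 * N ^ (k - 1)))" using b(2) by (simp only: of_nat_le_iff)
  then have 2: "fact k * real N ^ k \<le> real (T_count k X) + fact k * (real k ^ 2 * real N ^ (k - 1))" by simp
  have 3: "real N ^ k \<le> X ^ k" "real N ^ (k - 1) \<le> X ^ (k - 1)" using N by (auto intro: power_mono)
  have 4: "X ^ k \<le> real N ^ k + k * X ^ (k - 1)"
  proof -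
    \<comment> \<open>Bernoulli's inequality compares X^k with (X - 1)^k, and N >= X - 1.\<close>
    have "X ^ k * (1 - k / X) \<le> X ^ k * (1 + (- 1 / X)) ^ k"
      using Bernoulli_inequality[of "- 1 / X" k] X by (intro mult_left_mono) (auto simp: field_simps)
    also have "\<dots> = (X - 1) ^ k" using X by (simp add: power_mult_distrib[symmetric] field_simps)
    also have "\<dots> \<le> real N ^ k" using N X by (intro power_mono) auto
    finally have "X ^ k * (1 - k / X) \<le> real N ^ k" .
    moreover have "X ^ k * (1 - k / X) = X ^ k - k * X ^ (k - 1)"
      using X k by (cases k) (auto simp: field_simps)
    ultimately show ?thesis by simp
  qed
  have "real (T_count k X) \<le> fact k * X ^ k" using 1 3(1) by (meson fact_ge_zero mult_left_mono order_trans)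
  moreover have "fact k * X ^ k \<le> fact k * (real N ^ k + k * X ^ (k - 1))" using 4 by (intro mult_left_mono) auto
  moreover have "fact k * (real k ^ 2 * real N ^ (k - 1)) \<le> fact k * (real k ^ 2 * X ^ (k - 1))"
    using 3(2) by (intro mult_left_mono) auto
  moreover have "fact k * (real k + real k ^ 2) * X ^ (k - 1) = fact k * (k * X ^ (k - 1)) + fact k * (real k ^ 2 * X ^ (k - 1))"
    by (simp add: algebra_simps)
  ultimately have "fact k * X ^ k \<le> real (T_count k X) + fact k * (real k + real k ^ 2) * X ^ (k - 1)" "real (T_count k X) \<le> fact k * X ^ k"
    using 2 unfolding distrib_left by linarith+
  moreover have "0 \<le> fact k * (real k + real k ^ 2) * X ^ (k - 1)" using X by auto
  ultimately show ?thesis by (simp add: abs_if)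
qed

text \<open>With m = r - 1, \<open>trapezoid_power\<close> divided by k^m bounds the middle term
  from below by k / r - 1 / 2.\<close>

lemma gamma_exponent_term_ge:
  assumes k: "3 \<le> k" and r: "2 \<le> r"
  shows "real r + k / r - 1 / 2 + tri r d \<le>
     real r + real k powi (1 - int r) * (\<Sum>i=1..k-1. real i ^ (r - 1)) + (\<Sum>l=1..r. max (real d - real l + 1) 0)"
proof -
  define m where "m = r - 1"
  have m: "r = Suc m" "1 \<le> m" using r by (auto simp: m_def)
  have k0: "real k > 0" using k by simp
  have pw: "real k powi (1 - int r) = 1 / real k ^ m"
    using m by (simp add: power_int_minus divide_inverse)
  have "k / r - 1 / 2 = (1 / real k ^ m) * (real k ^ Suc m / real (Suc m) - real k ^ m / 2)"
  proof -
    have "K / n - 1 / 2 = (1 / A) * (K * A / n - A / 2)" if "A > 0" "n > 0" for A K n :: real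
      using that by (simp add: field_simps)
    from this[of "real k ^ m" "real (Suc m)" "real k"] show ?thesis using k0 m by simp
  qed
  also have "\<dots> \<le> (1 / real k ^ m) * (\<Sum>i=1..k-1. real i ^ m)"
    using trapezoid_power[OF m(2), of k] k by (intro mult_left_mono) auto
  finally have 1: "k / r - 1 / 2 \<le> real k powi (1 - int r) * (\<Sum>i=1..k-1. real i ^ (r - 1))"
    by (simp add: pw m_def)
  have "(\<Sum>l=1..r. max (real d - real l + 1) 0) = (\<Sum>l<r. max (real d - real (Suc l) + 1) 0)"
    by (rule sum.reindex_bij_witness[of _ Suc "\<lambda>l. l - 1"]) auto
  also have "\<dots> = tri r d" unfolding tri_def by (intro sum.cong) (auto simp: max_def of_nat_diff)
  finally show ?thesis using 1 by simp
qed

theorem theorem5p1: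
  fixes k d :: nat
  assumes "k \<ge> 3" and "real d < real k / 2"
  shows "(\<forall>\<epsilon>>0. \<exists>C::real. \<forall>X\<ge>1.
           \<bar>real (I_count k d X) - real (T_count k X)\<bar> \<le> C * X powr (gamma_exponent k d + \<epsilon>)) \<and>
         (d \<ge> 1 \<and> k \<ge> 4 * d + 2 \<longrightarrow>
           (\<exists>C::real. \<forall>X\<ge>1.
             \<bar>real (I_count k d X) - fact k * X ^ k\<bar> \<le> C * X powr (real k - 1/2)))"
proof (intro conjI allI impI)
  have dk: "2 * d < k" "d < k" using assms(2) by linarith+
  fix \<epsilon> :: real assume eps: "\<epsilon> > 0"
  \<comment> \<open>The minimum is attained at some r, and it suffices to stay below the term for
    this r.\<close>
  define S where "S = (\<lambda>r. real r + real k powi (1 - int r) * (\<Sum>i=1..k-1. real i ^ (r - 1)) + (\<Sum>l=1..r. max (real d - real l + 1) 0)) ` {2..k}"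
  have S: "finite S" "S \<noteq> {}" using assms(1) by (auto simp: S_def)
  have "gamma_exponent k d = Min S" by (simp add: gamma_exponent_def S_def)
  then have "gamma_exponent k d \<in> S" using Min_in[OF S] by simp
  then obtain r where r: "r \<in> {2..k}" and g: "gamma_exponent k d = real r + real k powi (1 - int r) * (\<Sum>i=1..k-1. real i ^ (r - 1)) + (\<Sum>l=1..r. max (real d - real l + 1) 0)"
    by (auto simp: S_def)
  have le: "real r + k / r - 1 / 2 + tri r d \<le> gamma_exponent k d"
    unfolding g using gamma_exponent_term_ge[OF assms(1)] r by simp
  have "0 \<le> gamma_exponent k d" unfolding g by (intro add_nonneg_nonneg mult_nonneg_nonneg sum_nonneg) auto
  moreover have "\<exists>E. solution_bound (k - c) (d - c) E \<and> c + E \<le> gamma_exponent k d" if "c \<le> d" for c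
    using component_bound[OF assms(1) dk(1) that, of r] r le by (meson atLeastAtMost_iff order_trans)
  ultimately show "\<exists>C::real. \<forall>X\<ge>1. \<bar>real (I_count k d X) - real (T_count k X)\<bar> \<le> C * X powr (gamma_exponent k d + \<epsilon>)"
    by (intro count_difference_bound[OF dk(2) _ eps]) auto
next
  assume a: "d \<ge> 1 \<and> k \<ge> 4 * d + 2"
  have dk: "d < k" using a by simp
  obtain F where F: "\<And>c. c \<le> d \<Longrightarrow> solution_bound (k - c) (d - c) (F c) \<and> c + F c < k - 1 / 2"
    using component_bound_strict[of d k] a by metis
  \<comment> \<open>The finitely many c have a common gap below k - 1 / 2, which serves as
    \<epsilon>. The 0 ensures G >= 0, as \<open>count_difference_bound\<close> asks.\<close>
  define G where "G = Max (insert 0 ((\<lambda>c. c + F c) ` {..d}))"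
  have G0: "0 \<le> G" and GF: "\<And>c. c \<le> d \<Longrightarrow> c + F c \<le> G" unfolding G_def by (rule Max_ge; auto)+
  have "G \<in> insert 0 ((\<lambda>c. c + F c) ` {..d})" unfolding G_def by (rule Max_in) auto
  then have Gk: "G < k - 1 / 2" using F a by auto
  define \<epsilon> where "\<epsilon> = k - 1 / 2 - G"
  have "\<exists>C. \<forall>X\<ge>1. \<bar>real (I_count k d X) - real (T_count k X)\<bar> \<le> C * X powr (G + \<epsilon>)"
  proof (rule count_difference_bound[OF dk _ _ G0])
    show "\<exists>E. solution_bound (k - c) (d - c) E \<and> c + E \<le> G" if "c \<le> d" for c
      using F[OF that] GF[OF that] by blast
    show "\<epsilon> > 0" using Gk by (simp add: \<epsilon>_def)
  qed
  then obtain C where C: "\<And>X. X \<ge> 1 \<Longrightarrow> \<bar>real (I_count k d X) - real (T_count k X)\<bar> \<le> C * X powr (real k - 1/2)"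
    by (auto simp: \<epsilon>_def)
  define C' where "C' = fact k * (real k + real k ^ 2)"
  have "\<bar>real (I_count k d X) - fact k * X ^ k\<bar> \<le> (C + C') * X powr (real k - 1/2)" if X: "X \<ge> 1" for X
  proof -
    have "\<bar>real (T_count k X) - fact k * X ^ k\<bar> \<le> C' * X ^ (k - 1)"
      using T_count_asymptotic[OF X, of k] a by (simp add: C'_def)
    also have "X ^ (k - 1) = X powr (real (k - 1))" using X by (simp add: powr_realpow)
    also have "C' * X powr (real (k - 1)) \<le> C' * X powr (real k - 1/2)"
      using X a by (intro mult_left_mono powr_mono) (auto simp: C'_def of_nat_diff)
    finally show ?thesis using C[OF X] by (simp add: distrib_right)
  qed
  then show "\<exists>C::real. \<forall>X\<ge>1. \<bar>real (I_count k d X) - fact k * X ^ k\<bar> \<le> C * X powr (real k - 1/2)" by blast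
qed

end
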